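(* Let $M$ be a compact connected Riemannian manifold with $\pi_1(M)=\{0\}$, and let $\Gamma$ be a finitely presented group, with finite generating set $S$, acting freely on $M$ by homeomorphisms. Then $\pi_{1,\theta}(\mathcal{O}_\Gamma^t(M))\cong\Gamma$ for every $\theta$ and $t$ large enough (that is, there is $\theta_0$ such that for every $\theta\ge\theta_0$ there is $t_0=t_0(\theta)$ such that the isomorphism holds for all $t\ge t_0$).
   Context: Discrete fundamental group. Let $(Z,\rho)$ be a metric space and $\theta>0$. A $\theta$-path is a finite sequence $(z_0,\dots,z_n)$ with $\rho(z_i,z_{i+1})\le\theta$, viewed as a $\theta$-Lipschitz map $[n]=\{0,\dots,n\}\to Z$. A lazification of it is its precomposition with a surjective monotone map $[m]\to[n]$. Two $\theta$-paths $Z_1,Z_2$ of the same length $n$ are $\theta$-grid homotopic if there is a $\theta$-Lipschitz map $H\colon[n]\times[m]\to Z$ (with the $\ell^1$ metric on $[n]\times[m]$) with $H(\cdot,0)=Z_1$, $H(\cdot,m)=Z_2$ and $H(0,\cdot)$, $H(n,\cdot)$ constant. $\theta$-homotopy is the equivalence relation generated by lazifications and $\theta$-grid homotopies. $\pi_{1,\theta}(Z)$ is the group of $\theta$-homotopy classes of closed $\theta$-paths based at a fixed point, with concatenation (up to isomorphism it does not depend on the base point for the spaces considered). Level sets of warped cones. Let $d$ be the Riemannian distance on $M$ and, for $t\ge1$, $d^t=t\cdot d$. The level set $\mathcal{O}_\Gamma^t(M)$ is the metric space $(M,\delta_S^t)$, where $\delta_S^t$ is the largest metric on $M$ such that $\delta_S^t\le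 d^t$ and $\delta_S^t(x,s\cdot x)\le1$ for all $x\in M$, $s\in S$. *)

theory Defs
  imports "HOL-Analysis.Analysis" "HOL-Algebra.Generated_Groups" "HOL-Algebra.Group_Action"
begin

section \<open>Riemannian manifolds and the Riemannian distance\<close>

text \<open>
  The model space of a manifold is a type of class \<open>{real_inner, heine_borel}\<close>. By Riesz'
  theorem the Heine-Borel property says that it is finite-dimensional; unlike
  \<open>euclidean_space\<close>, this also admits the zero-dimensional model space.
\<close>

primrec Ck_on ::
  "nat \<Rightarrow> 'a::real_normed_vector set \<Rightarrow> ('a \<Rightarrow> 'b::real_normed_vector) \<Rightarrow> bool" where
  "Ck_on 0 S f \<longleftrightarrow> continuous_on S f"
| "Ck_on (Suc k) S f \<longleftrightarrow> (\<forall>x\<in>S. f differentiable (at x)) \<and>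
     (\<forall>v. Ck_on k S (\<lambda>x. frechet_derivative f (at x) v))"

definition smooth_on ::
  "'a::real_normed_vector set \<Rightarrow> ('a \<Rightarrow> 'b::real_normed_vector) \<Rightarrow> bool" where
  "smooth_on S f \<longleftrightarrow> open S \<and> (\<forall>k. Ck_on k S f)"

text \<open>A chart is a pair of its domain and its coordinate map (irrelevant off the domain).\<close>

type_synonym ('m, 'e) chart = "'m set \<times> ('m \<Rightarrow> 'e)"

definition smooth_atlas ::
  "'m::t2_space set \<Rightarrow> ('m, 'e::{real_inner, heine_borel}) chart set \<Rightarrow> bool" where
  "smooth_atlas M A \<longleftrightarrow>
     (\<Union>(U, \<phi>)\<in>A. U) = M \<and>
     (\<forall>(U, \<phi>)\<in>A. openin (top_of_set M) U \<and> open (\<phi> ` U) \<and>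
        homeomorphism U (\<phi> ` U) \<phi> (inv_into U \<phi>)) \<and>
     (\<forall>(U, \<phi>)\<in>A. \<forall>(V, \<psi>)\<in>A. smooth_on (\<phi> ` (U \<inter> V)) (\<psi> \<circ> inv_into U \<phi>))"

text \<open>
  A Riemannian metric in coordinates: \<open>g c p v w\<close> is the inner product of the two tangent
  vectors at \<open>p\<close> whose coordinates in the chart \<open>c\<close> are \<open>v\<close> and \<open>w\<close>. The last clause is the
  transformation law of a \<open>(0,2)\<close>-tensor.
\<close>

type_synonym ('m, 'e) metric_tensor = "('m, 'e) chart \<Rightarrow> 'm \<Rightarrow> 'e \<Rightarrow> 'e \<Rightarrow> real"

definition riemannian_metric ::
  "('m::t2_space, 'e::{real_inner, heine_borel}) chart set \<Rightarrow> ('m, 'e) metric_tensor \<Rightarrow> bool" where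
  "riemannian_metric A g \<longleftrightarrow>
     (\<forall>(U, \<phi>)\<in>A.
        (\<forall>p\<in>U. bilinear (g (U, \<phi>) p) \<and>
           (\<forall>v w. g (U, \<phi>) p v w = g (U, \<phi>) p w v) \<and>
           (\<forall>v. v \<noteq> 0 \<longrightarrow> 0 < g (U, \<phi>) p v v)) \<and>
        (\<forall>v w. smooth_on (\<phi> ` U) (\<lambda>y. g (U, \<phi>) (inv_into U \<phi> y) v w))) \<and>
     (\<forall>(U, \<phi>)\<in>A. \<forall>(V, \<psi>)\<in>A. \<forall>p\<in>U \<inter> V. \<forall>v w.
        g (U, \<phi>) p v w =
        (let D = frechet_derivative (\<psi> \<circ> inv_into U \<phi>) (at (\<phi> p)) in g (V, \<psi>) p (D v) (D w)))"

text \<open>Manifolds have no boundary. Second countability is automatic in the compact case.\<close>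

definition riemannian_manifold ::
  "'m::t2_space set \<Rightarrow> ('m, 'e::{real_inner, heine_borel}) chart set \<Rightarrow>
   ('m, 'e) metric_tensor \<Rightarrow> bool" where
  "riemannian_manifold M A g \<longleftrightarrow> smooth_atlas M A \<and> riemannian_metric A g"

text \<open>\<open>\<gamma>\<close> is \<open>C\<^sup>1\<close> on \<open>[a, b]\<close>, with one-sided derivatives at the endpoints.\<close>

definition C1_curve ::
  "('m::t2_space, 'e::{real_inner, heine_borel}) chart set \<Rightarrow> (real \<Rightarrow> 'm) \<Rightarrow>
   real \<Rightarrow> real \<Rightarrow> bool" where
  "C1_curve A \<gamma> a b \<longleftrightarrow>
     (\<forall>(U, \<phi>)\<in>A. \<exists>D.
        (\<forall>s\<in>{s\<in>{a..b}. \<gamma> s \<in> U}. ((\<phi> \<circ> \<gamma>) has_vector_derivative D s) (at s within {a..b})) \<and>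
        continuous_on {s\<in>{a..b}. \<gamma> s \<in> U} D)"

definition piecewise_C1_curve ::
  "'m::t2_space set \<Rightarrow> ('m, 'e::{real_inner, heine_borel}) chart set \<Rightarrow> (real \<Rightarrow> 'm) \<Rightarrow> bool" where
  "piecewise_C1_curve M A \<gamma> \<longleftrightarrow> path \<gamma> \<and> path_image \<gamma> \<subseteq> M \<and>
     (\<exists>(n::nat) \<tau>. \<tau> 0 = 0 \<and> \<tau> n = 1 \<and>
        (\<forall>i<n. \<tau> i < \<tau> (Suc i) \<and> C1_curve A \<gamma> (\<tau> i) (\<tau> (Suc i))))"

text \<open>
  By the transformation law the speed does not depend on the chart selected around \<open>\<gamma> s\<close>. At the
  finitely many points where \<open>\<gamma>\<close> is not differentiable its value is irrelevant for the length.
\<close>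

definition speed ::
  "('m::t2_space, 'e::{real_inner, heine_borel}) chart set \<Rightarrow> ('m, 'e) metric_tensor \<Rightarrow>
   (real \<Rightarrow> 'm) \<Rightarrow> real \<Rightarrow> real" where
  "speed A g \<gamma> s =
     (let c = (SOME c. c \<in> A \<and> \<gamma> s \<in> fst c);
          v = vector_derivative (snd c \<circ> \<gamma>) (at s)
      in sqrt (g c (\<gamma> s) v v))"

definition curve_length ::
  "('m::t2_space, 'e::{real_inner, heine_borel}) chart set \<Rightarrow> ('m, 'e) metric_tensor \<Rightarrow>
   (real \<Rightarrow> 'm) \<Rightarrow> real" where
  "curve_length A g \<gamma> = integral {0..1} (speed A g \<gamma>)"

definition riemannian_dist ::
  "'m::t2_space set \<Rightarrow> ('m, 'e::{real_inner, heine_borel}) chart set \<Rightarrow>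
   ('m, 'e) metric_tensor \<Rightarrow> 'm \<Rightarrow> 'm \<Rightarrow> real" where
  "riemannian_dist M A g p q =
     Inf {curve_length A g \<gamma> | \<gamma>. piecewise_C1_curve M A \<gamma> \<and> pathstart \<gamma> = p \<and> pathfinish \<gamma> = q}"

text \<open>\<open>\<pi>\<^sub>1(M, x)\<close> is trivial for every base point \<open>x\<close>.\<close>

definition trivial_fundamental_group :: "'m::topological_space set \<Rightarrow> bool" where
  "trivial_fundamental_group M \<longleftrightarrow>
     (\<forall>x\<in>M. \<forall>p. path p \<and> path_image p \<subseteq> M \<and> pathstart p = x \<and> pathfinish p = x \<longrightarrow>
        homotopic_paths M p (\<lambda>_. x))"


section \<open>Finitely presented groups\<close>

text \<open>
  The letter \<open>(a, True)\<close> stands for the generator \<open>a\<close>, and \<open>(a, False)\<close> for its inverse.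
\<close>

type_synonym word = "(nat \<times> bool) list"

definition words :: "nat set \<Rightarrow> word set" where
  "words X = lists (X \<times> UNIV)"

inductive word_step :: "nat set \<Rightarrow> word set \<Rightarrow> word \<Rightarrow> word \<Rightarrow> bool" for X R where
  relator: "\<lbrakk>u \<in> words X; v \<in> words X; r \<in> R\<rbrakk> \<Longrightarrow> word_step X R (u @ r @ v) (u @ v)"
| cancel: "\<lbrakk>u \<in> words X; v \<in> words X; a \<in> X\<rbrakk> \<Longrightarrow>
    word_step X R (u @ [(a, b), (a, \<not> b)] @ v) (u @ v)"

definition word_rel :: "nat set \<Rightarrow> word set \<Rightarrow> (word \<times> word) set" where
  "word_rel X R = {(u, v). u \<in> words X \<and> v \<in> words X \<and> equivclp (word_step X R) u v}"

text \<open>The group \<open>\<langle>X | R\<rangle>\<close>, for relators \<open>R \<subseteq> words X\<close>.\<close>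

definition presented_group :: "nat set \<Rightarrow> word set \<Rightarrow> word set monoid" where
  "presented_group X R =
     \<lparr>carrier = words X // word_rel X R,
      mult = (\<lambda>P Q. \<Union>u\<in>P. \<Union>v\<in>Q. word_rel X R `` {u @ v}),
      one = word_rel X R `` {[]}\<rparr>"

definition finitely_presented :: "('g, 'b) monoid_scheme \<Rightarrow> bool" where
  "finitely_presented G \<longleftrightarrow>
     group G \<and> (\<exists>X R. finite X \<and> finite R \<and> R \<subseteq> words X \<and> G \<cong> presented_group X R)"


section \<open>The discrete fundamental group\<close>

text \<open>The path \<open>(z\<^sub>0, \<dots>, z\<^sub>n)\<close> is a list of length \<open>n + 1\<close>.\<close>

definition theta_paths :: "real \<Rightarrow> 'a set \<Rightarrow> ('a \<Rightarrow> 'a \<Rightarrow> real) \<Rightarrow> 'a list set" where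
  "theta_paths \<theta> Z \<rho> =
     {zs. zs \<noteq> [] \<and> set zs \<subseteq> Z \<and> (\<forall>i. Suc i < length zs \<longrightarrow> \<rho> (zs ! i) (zs ! Suc i) \<le> \<theta>)}"

definition lazification_of :: "'a list \<Rightarrow> 'a list \<Rightarrow> bool" where
  "lazification_of ws zs \<longleftrightarrow>
     (\<exists>f. mono_on {..<length ws} f \<and> f ` {..<length ws} = {..<length zs} \<and>
        (\<forall>i<length ws. ws ! i = zs ! f i))"

definition grid_homotopic ::
  "real \<Rightarrow> 'a set \<Rightarrow> ('a \<Rightarrow> 'a \<Rightarrow> real) \<Rightarrow> 'a list \<Rightarrow> 'a list \<Rightarrow> bool" where
  "grid_homotopic \<theta> Z \<rho> zs ws \<longleftrightarrow>
     (\<exists>n m H. length zs = Suc n \<and> length ws = Suc n \<and>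
        (\<forall>i\<le>n. \<forall>j\<le>m. H i j \<in> Z) \<and>
        (\<forall>i\<le>n. \<forall>j\<le>m. \<forall>i'\<le>n. \<forall>j'\<le>m.
           \<rho> (H i j) (H i' j') \<le> \<theta> * (\<bar>real i - real i'\<bar> + \<bar>real j - real j'\<bar>)) \<and>
        (\<forall>i\<le>n. H i 0 = zs ! i \<and> H i m = ws ! i) \<and>
        (\<forall>j\<le>m. H 0 j = H 0 0 \<and> H n j = H n 0))"

definition theta_step ::
  "real \<Rightarrow> 'a set \<Rightarrow> ('a \<Rightarrow> 'a \<Rightarrow> real) \<Rightarrow> 'a list \<Rightarrow> 'a list \<Rightarrow> bool" where
  "theta_step \<theta> Z \<rho> zs ws \<longleftrightarrow>
     zs \<in> theta_paths \<theta> Z \<rho> \<and> ws \<in> theta_paths \<theta> Z \<rho> \<and>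
     (lazification_of ws zs \<or> grid_homotopic \<theta> Z \<rho> zs ws)"

definition theta_homotopy ::
  "real \<Rightarrow> 'a set \<Rightarrow> ('a \<Rightarrow> 'a \<Rightarrow> real) \<Rightarrow> ('a list \<times> 'a list) set" where
  "theta_homotopy \<theta> Z \<rho> =
     {(zs, ws). zs \<in> theta_paths \<theta> Z \<rho> \<and> ws \<in> theta_paths \<theta> Z \<rho> \<and>
        equivclp (theta_step \<theta> Z \<rho>) zs ws}"

definition theta_loops :: "real \<Rightarrow> 'a set \<Rightarrow> ('a \<Rightarrow> 'a \<Rightarrow> real) \<Rightarrow> 'a \<Rightarrow> 'a list set" where
  "theta_loops \<theta> Z \<rho> z = {zs \<in> theta_paths \<theta> Z \<rho>. hd zs = z \<and> last zs = z}"

text \<open>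
  Lazifications and grid homotopies fix endpoints, so the classes below consist of loops.
  The concatenation \<open>zs @ tl ws\<close> lists the common endpoint once.
\<close>

definition discrete_pi1 ::
  "real \<Rightarrow> 'a set \<Rightarrow> ('a \<Rightarrow> 'a \<Rightarrow> real) \<Rightarrow> 'a \<Rightarrow> 'a list set monoid" where
  "discrete_pi1 \<theta> Z \<rho> z =
     \<lparr>carrier = theta_loops \<theta> Z \<rho> z // theta_homotopy \<theta> Z \<rho>,
      mult = (\<lambda>P Q. \<Union>zs\<in>P. \<Union>ws\<in>Q. theta_homotopy \<theta> Z \<rho> `` {zs @ tl ws}),
      one = theta_homotopy \<theta> Z \<rho> `` {[z]}\<rparr>"


section \<open>Free actions and warped cones\<close>

definition acts_freely_by_homeomorphisms ::
  "('g, 'b) monoid_scheme \<Rightarrow> 'm::topological_space set \<Rightarrow> ('g \<Rightarrow> 'm \<Rightarrow> 'm) \<Rightarrow> bool" where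
  "acts_freely_by_homeomorphisms G M act \<longleftrightarrow>
     group_action G M act \<and>
     (\<forall>g\<in>carrier G. \<exists>h. homeomorphism M M (act g) h) \<and>
     (\<forall>g\<in>carrier G. \<forall>x\<in>M. act g x = x \<longrightarrow> g = \<one>\<^bsub>G\<^esub>)"

definition warped_admissible ::
  "'m set \<Rightarrow> ('m \<Rightarrow> 'm \<Rightarrow> real) \<Rightarrow> 'g set \<Rightarrow> ('g \<Rightarrow> 'm \<Rightarrow> 'm) \<Rightarrow> real \<Rightarrow>
   ('m \<Rightarrow> 'm \<Rightarrow> real) \<Rightarrow> bool" where
  "warped_admissible M d S act t \<delta> \<longleftrightarrow>
     Metric_space M \<delta> \<and>
     (\<forall>x\<in>M. \<forall>y\<in>M. \<delta> x y \<le> t * d x y) \<and>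
     (\<forall>x\<in>M. \<forall>s\<in>S. \<delta> x (act s x) \<le> 1)"

text \<open>
  The metric of the level set: the largest admissible metric. It is unique on \<open>M\<close>; the choice
  only concerns the irrelevant values off \<open>M\<close>.
\<close>

definition warped_metric ::
  "'m set \<Rightarrow> ('m \<Rightarrow> 'm \<Rightarrow> real) \<Rightarrow> 'g set \<Rightarrow> ('g \<Rightarrow> 'm \<Rightarrow> 'm) \<Rightarrow> real \<Rightarrow> 'm \<Rightarrow> 'm \<Rightarrow> real" where
  "warped_metric M d S act t =
     (SOME \<delta>. warped_admissible M d S act t \<delta> \<and>
        (\<forall>\<rho>. warped_admissible M d S act t \<rho> \<longrightarrow> (\<forall>x\<in>M. \<forall>y\<in>M. \<rho> x y \<le> \<delta> x y)))"

end

theory Submission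
  imports Defs
begin

text \<open>
  Since the action is free and \<open>M\<close> is compact, for large \<open>t\<close> two points at warped distance at most \<open>\<theta>\<close>
  differ, up to a tiny error in \<open>M\<close>, by a unique group element of bounded word length. These elements
  multiply to a trivial product around every small square, so their product along a \<open>\<theta>\<close>-path is a
  homotopy invariant, the holonomy. It is onto because \<open>S\<close> generates and \<open>M\<close> is path connected.
  For injectivity, every \<open>\<theta>\<close>-path is homotopic to an orbit path of a word in the generators followed by
  a finely sampled curve in \<open>M\<close>: jumps are moved to the front by applying the generator to the whole
  curve. If the holonomy is trivial, the word is a consequence of relators of bounded length, each of which
  is contracted in one step when \<open>\<theta>\<close> is larger than its length, and the remaining loop in \<open>M\<close> is
  contracted by sampling a null-homotopy.
  The only properties of the Riemannian distance that matter are that it is a continuous metric and that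
  points are joined by curves of almost minimal length.
\<close>


section \<open>The Riemannian distance\<close>


text \<open>Two obstacles shape the argument. The group acts only by homeomorphisms, so a generator
  can distort \<open>d\<close> badly, and compactness gives uniform continuity only for finitely
  many elements at a time. This dictates the order of the constants: \<theta> bounds the number of
  jumps in a step, this bound selects a finite ball of the group, and only then do freeness and
  uniform continuity give the admissible error \<eta> and the lower bound on \<open>t\<close>. The
  second obstacle is that the warped distance is an infimum: a step with \<delta> \<le> \<theta>
  comes with routes of cost slightly above \<theta>, which need not stay in the \<theta>-ball. The
  last stretch of such a route needs separate treatment before the step can be replaced by curves
  and single jumps. The two notions of homotopy are used asymmetrically. Invariance of the holonomy
  is shown for all lazifications and grid homotopies, whereas contractions are built from two
  elementary moves. The number 2 in the bound on \<theta> lets a jump and a sampling step of a curve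
  share one \<theta>-step.\<close>

text \<open>A finite 1/2-net of the unit ball spans the space: otherwise some unit vector would be
  orthogonal to the net, hence at distance at least 1 from each of its points. A zero vector in
  \<open>B\<close> is harmless, as its summand vanishes.\<close>

lemma finite_orthogonal_basis:
  "\<exists>B::'e::{real_inner, heine_borel} set. finite B \<and>
     (\<forall>v. v = (\<Sum>b\<in>B. (v \<bullet> b / (b \<bullet> b)) *\<^sub>R b))"
proof -
  have "compact (cball (0::'e) 1)" by simp
  then obtain K where K: "finite K" "cball (0::'e) 1 \<subseteq> (\<Union>x\<in>K. ball x (1/2))"
    unfolding compact_eq_totally_bounded using half_gt_zero[OF zero_less_one] that by meson
  obtain C where C: "finite C" "span C = span K" "pairwise orthogonal C"
    using basis_orthogonal[OF K(1)] by blast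
  have "v = (\<Sum>b\<in>C. (v \<bullet> b / (b \<bullet> b)) *\<^sub>R b)" for v
  proof (rule ccontr)
    define p where "p = (\<Sum>b\<in>C. (v \<bullet> b / (b \<bullet> b)) *\<^sub>R b)"
    define w where "w = v - p"
    define u where "u = w /\<^sub>R norm w"
    assume "v \<noteq> (\<Sum>b\<in>C. (v \<bullet> b / (b \<bullet> b)) *\<^sub>R b)"
    then have w0: "w \<noteq> 0" by (simp add: w_def p_def)
    have "p \<bullet> c = v \<bullet> c" if "c \<in> C" for c
    proof -
      have "p \<bullet> c = (\<Sum>b\<in>C. if b = c then v \<bullet> c else 0)"
        unfolding p_def inner_sum_left
      proof (rule sum.cong[OF refl])
        fix b assume "b \<in> C"
        with C(3) that show "(v \<bullet> b / (b \<bullet> b)) *\<^sub>R b \<bullet> c = (if b = c then v \<bullet> c else 0)"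
          by (cases "b = c"; cases "c = 0") (auto simp: pairwise_def orthogonal_def)
      qed
      also have "\<dots> = v \<bullet> c" using C(1) that by simp
      finally show ?thesis .
    qed
    then have "orthogonal w c" if "c \<in> C" for c
      using that by (simp add: w_def orthogonal_def inner_diff_left)
    then have ort: "orthogonal w x" if "x \<in> span C" for x
      using orthogonal_to_span[of x C w] that by auto
    have un: "norm u = 1" using w0 by (simp add: u_def)
    then have "u \<in> cball 0 1" by simp
    with K(2) obtain x where x: "x \<in> K" "dist x u < 1/2" by auto
    have "u \<bullet> x = 0"
      using ort[of x] x(1) C(2) span_base[of x K] by (simp add: u_def orthogonal_def)
    then have "(norm (u - x))\<^sup>2 = (norm u)\<^sup>2 + (norm x)\<^sup>2"
      by (simp add: power2_norm_eq_inner inner_diff inner_commute)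
    then have "1 \<le> (norm (u - x))\<^sup>2" using un by simp
    then have "1 \<le> norm (u - x)" by (simp add: abs_le_square_iff[of 1 "norm (u-x)", simplified])
    with x(2) show False by (simp add: dist_norm norm_minus_commute)
  qed
  with C(1) show ?thesis by blast
qed

text \<open>Expansion in a finite orthogonal family turns the value into a finite sum of products,
  so continuity of the coefficients \<open>G x v w\<close> for fixed vectors is enough.\<close>

lemma continuous_on_bilinear_family:
  fixes G :: "'a::topological_space \<Rightarrow> 'e::{real_inner, heine_borel} \<Rightarrow> 'e \<Rightarrow> real"
  assumes "\<And>v w. continuous_on S (\<lambda>x. G x v w)" and bil: "\<And>x. x \<in> S \<Longrightarrow> bilinear (G x)"
    and V: "continuous_on S V"
  shows "continuous_on S (\<lambda>x. G x (V x) (V x))"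
proof -
  obtain B :: "'e set" where B: "finite B" "\<And>v. v = (\<Sum>b\<in>B. (v \<bullet> b / (b \<bullet> b)) *\<^sub>R b)"
    using finite_orthogonal_basis by blast
  have "G x (V x) (V x) =
      (\<Sum>(b, b')\<in>B \<times> B. (V x \<bullet> b / (b \<bullet> b)) * ((V x \<bullet> b' / (b' \<bullet> b')) * G x b b'))" if "x \<in> S" for x
  proof -
    have "G x (V x) (V x) = G x (\<Sum>b\<in>B. (V x \<bullet> b / (b \<bullet> b)) *\<^sub>R b) (\<Sum>b\<in>B. (V x \<bullet> b / (b \<bullet> b)) *\<^sub>R b)"
      using B(2)[of "V x"] by metis
    also have "\<dots> = (\<Sum>(b, b')\<in>B \<times> B. G x ((V x \<bullet> b / (b \<bullet> b)) *\<^sub>R b) ((V x \<bullet> b' / (b' \<bullet> b')) *\<^sub>R b'))"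
      by (rule bilinear_sum[OF bil[OF that]])
    also have "\<dots> = (\<Sum>(b, b')\<in>B \<times> B. (V x \<bullet> b / (b \<bullet> b)) * ((V x \<bullet> b' / (b' \<bullet> b')) * G x b b'))"
      by (intro sum.cong refl)
        (simp add: split_def bilinear_lmul[OF bil[OF that]] bilinear_rmul[OF bil[OF that]] mult.left_commute
          del: times_divide_eq_left times_divide_eq_right)
    finally show ?thesis .
  qed
  moreover have "continuous_on S (\<lambda>x. \<Sum>(b, b')\<in>B \<times> B.
      (V x \<bullet> b / (b \<bullet> b)) * ((V x \<bullet> b' / (b' \<bullet> b')) * G x b b'))"
    unfolding split_def divide_inverse by (intro continuous_intros assms)
  ultimately show ?thesis
    by (subst continuous_on_cong[OF refl])
qed

section \<open>Charts, coordinate changes and the speed of a curve\<close>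

locale riemannian =
  fixes M :: "'m::t2_space set"
    and A :: "('m, 'e::{real_inner, heine_borel}) chart set"
    and g :: "('m, 'e) metric_tensor"
  assumes manifold: "riemannian_manifold M A g"
begin

lemma chart_cover: "p \<in> M \<Longrightarrow> \<exists>U \<phi>. (U, \<phi>) \<in> A \<and> p \<in> U"
  using manifold unfolding riemannian_manifold_def smooth_atlas_def by blast

lemma chart_openin: "(U, \<phi>) \<in> A \<Longrightarrow> openin (top_of_set M) U"
  using manifold unfolding riemannian_manifold_def smooth_atlas_def by blast

lemma chart_subset: "(U, \<phi>) \<in> A \<Longrightarrow> U \<subseteq> M"
  using chart_openin openin_imp_subset by blast

lemma chart_open_image: "(U, \<phi>) \<in> A \<Longrightarrow> open (\<phi> ` U)"
  using manifold unfolding riemannian_manifold_def smooth_atlas_def by blast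

lemma chart_homeo: "(U, \<phi>) \<in> A \<Longrightarrow> homeomorphism U (\<phi> ` U) \<phi> (inv_into U \<phi>)"
  using manifold unfolding riemannian_manifold_def smooth_atlas_def by blast

lemma chart_inv: "(U, \<phi>) \<in> A \<Longrightarrow> p \<in> U \<Longrightarrow> inv_into U \<phi> (\<phi> p) = p"
  using chart_homeo unfolding homeomorphism_def by blast

lemma chart_cont: "(U, \<phi>) \<in> A \<Longrightarrow> continuous_on U \<phi>"
  using chart_homeo unfolding homeomorphism_def by blast

lemma chart_inv_cont: "(U, \<phi>) \<in> A \<Longrightarrow> continuous_on (\<phi> ` U) (inv_into U \<phi>)"
  using chart_homeo unfolding homeomorphism_def by blast

lemma transition_smooth:
  "(U, \<phi>) \<in> A \<Longrightarrow> (V, \<psi>) \<in> A \<Longrightarrow> smooth_on (\<phi> ` (U \<inter> V)) (\<psi> \<circ> inv_into U \<phi>)"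
  using manifold unfolding riemannian_manifold_def smooth_atlas_def by blast

lemma metric_props:
  assumes "(U, \<phi>) \<in> A" "p \<in> U"
  shows "bilinear (g (U, \<phi>) p)" "v \<noteq> 0 \<Longrightarrow> 0 < g (U, \<phi>) p v v"
  using manifold assms unfolding riemannian_manifold_def riemannian_metric_def by blast+

lemma metric_smooth:
  "(U, \<phi>) \<in> A \<Longrightarrow> smooth_on (\<phi> ` U) (\<lambda>y. g (U, \<phi>) (inv_into U \<phi> y) v w)"
  using manifold unfolding riemannian_manifold_def riemannian_metric_def by blast

lemma metric_nonneg: "(U, \<phi>) \<in> A \<Longrightarrow> p \<in> U \<Longrightarrow> 0 \<le> g (U, \<phi>) p v v"
  using metric_props(2)[of U \<phi> p v] bilinear_lzero[OF metric_props(1)[of U \<phi> p], of 0]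
  by (cases "v = 0") (auto simp: less_imp_le)

lemma metric_transform:
  assumes "(U, \<phi>) \<in> A" "(V, \<psi>) \<in> A" "p \<in> U" "p \<in> V"
    "D = frechet_derivative (\<psi> \<circ> inv_into U \<phi>) (at (\<phi> p))"
  shows "g (V, \<psi>) p (D v) (D w) = g (U, \<phi>) p v w"
proof -
  have *: "\<forall>c\<in>A. \<forall>c'\<in>A. \<forall>p\<in>fst c \<inter> fst c'. \<forall>v w. g c p v w =
      (let D = frechet_derivative (snd c' \<circ> inv_into (fst c) (snd c)) (at (snd c p)) in g c' p (D v) (D w))"
    using manifold[unfolded riemannian_manifold_def riemannian_metric_def split_def, THEN conjunct2, THEN conjunct2]
    unfolding prod.collapse .
  have "p \<in> fst (U, \<phi>) \<inter> fst (V, \<psi>)" using assms(3,4) by simp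
  from *[rule_format, OF assms(1,2) this, of v w] show ?thesis
    unfolding Let_def assms(5) fst_conv snd_conv by (rule sym)
qed

lemma transition_derivative:
  assumes U: "(U, \<phi>) \<in> A" and V: "(V, \<psi>) \<in> A" and p: "p \<in> U" "p \<in> V"
  shows "(\<psi> \<circ> inv_into U \<phi> has_derivative
           frechet_derivative (\<psi> \<circ> inv_into U \<phi>) (at (\<phi> p))) (at (\<phi> p))"
proof -
  have "Ck_on (Suc 0) (\<phi> ` (U \<inter> V)) (\<psi> \<circ> inv_into U \<phi>)"
    using transition_smooth[OF U V] unfolding smooth_on_def by blast
  then have "(\<psi> \<circ> inv_into U \<phi>) differentiable (at (\<phi> p))" using p by auto
  then show ?thesis by (simp add: frechet_derivative_works)
qed

lemma transition_derivative_continuous: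
  assumes "(U, \<phi>) \<in> A" "(V, \<psi>) \<in> A"
  shows "continuous_on (\<phi> ` (U \<inter> V)) (\<lambda>y. frechet_derivative (\<psi> \<circ> inv_into U \<phi>) (at y) v)"
proof -
  have "Ck_on (Suc 0) (\<phi> ` (U \<inter> V)) (\<psi> \<circ> inv_into U \<phi>)"
    using transition_smooth[OF assms] unfolding smooth_on_def by blast
  then show ?thesis by simp
qed

lemma metric_continuous:
  assumes U: "(U, \<phi>) \<in> A" and c: "continuous_on S c" "c ` S \<subseteq> U"
  shows "continuous_on S (\<lambda>s. g (U, \<phi>) (c s) v w)"
proof -
  have "continuous_on (\<phi> ` U) (\<lambda>y. g (U, \<phi>) (inv_into U \<phi> y) v w)"
    using metric_smooth[OF U] unfolding smooth_on_def by (metis Ck_on.simps(1))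
  moreover have "continuous_on S (\<phi> \<circ> c)"
    using c chart_cont[OF U] by (intro continuous_on_compose) (auto elim: continuous_on_subset)
  ultimately have "continuous_on S (\<lambda>s. g (U, \<phi>) (inv_into U \<phi> ((\<phi> \<circ> c) s)) v w)"
    by (rule continuous_on_compose2) (use c(2) in auto)
  then show ?thesis
    by (rule continuous_on_eq) (use c(2) chart_inv[OF U] in \<open>auto simp: image_subset_iff\<close>)
qed

lemma eventually_in_chart:
  assumes U: "(U, \<phi>) \<in> A" and c: "continuous_on I c" "c ` I \<subseteq> M" and s: "s \<in> I" "c s \<in> U"
  shows "\<forall>\<^sub>F x in at s within I. c x \<in> U"
proof -
  obtain W where W: "open W" "U = M \<inter> W"
    using chart_openin[OF U] by (metis openin_open)
  have "(c \<longlongrightarrow> c s) (at s within I)"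
    using c(1) s(1) by (simp add: continuous_on_def)
  then have "\<forall>\<^sub>F x in at s within I. c x \<in> W"
    using W s(2) by (intro topological_tendstoD) auto
  moreover have "\<forall>\<^sub>F x in at s within I. c x \<in> M"
    using c(2) by (auto simp: eventually_at_filter image_subset_iff intro: always_eventually)
  ultimately show ?thesis unfolding W(2) by eventually_elim auto
qed

text \<open>This is the chain rule for the transition map. The composite through
  \<open>inv_into U \<phi>\<close> agrees with \<open>\<psi> \<circ> c\<close> only while the curve
  is in \<open>U\<close>, which holds near \<open>s\<close> because \<open>U\<close> is open in
  \<open>M\<close>.\<close>

lemma chart_change:
  assumes U: "(U, \<phi>) \<in> A" and V: "(V, \<psi>) \<in> A"
    and c: "continuous_on I c" "c ` I \<subseteq> M" and s: "s \<in> I" "c s \<in> U" "c s \<in> V"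
    and d: "((\<phi> \<circ> c) has_vector_derivative v) (at s within I)"
  shows "((\<psi> \<circ> c) has_vector_derivative
           frechet_derivative (\<psi> \<circ> inv_into U \<phi>) (at (\<phi> (c s))) v) (at s within I)"
proof -
  let ?D = "frechet_derivative (\<psi> \<circ> inv_into U \<phi>) (at (\<phi> (c s)))"
  note td = transition_derivative[OF U V s(2,3)]
  have "((\<psi> \<circ> inv_into U \<phi>) \<circ> (\<phi> \<circ> c) has_derivative ?D \<circ> (\<lambda>x. x *\<^sub>R v)) (at s within I)"
    using d td unfolding has_vector_derivative_def
    by (intro diff_chain_within) (auto intro: has_derivative_at_withinI)
  then have "((\<psi> \<circ> inv_into U \<phi>) \<circ> (\<phi> \<circ> c) has_vector_derivative ?D v) (at s within I)"
    unfolding has_vector_derivative_def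
    unfolding o_def[of ?D] linear_scale[OF has_derivative_linear[OF td]] .
  moreover have "\<forall>\<^sub>F x in at s within I. ((\<psi> \<circ> inv_into U \<phi>) \<circ> (\<phi> \<circ> c)) x = (\<psi> \<circ> c) x"
    using eventually_in_chart[OF U c s(1,2)] by eventually_elim (simp add: chart_inv[OF U])
  ultimately show ?thesis
    unfolding has_vector_derivative_def
    using s by (elim has_derivative_transform_eventually) (auto simp: chart_inv[OF U])
qed

text \<open>\<open>speed\<close> evaluates the tensor in a chart picked by \<open>SOME\<close>.
  Passing to \<open>(U, \<phi>)\<close> changes the velocity by the derivative of the transition
  map, which the transformation law of the tensor absorbs.\<close>

lemma speed_eq:
  assumes U: "(U, \<phi>) \<in> A" and c: "continuous_on {a<..<b} c" "c ` {a<..<b} \<subseteq> M"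
    and s: "s \<in> {a<..<b}" "c s \<in> U"
    and d: "((\<phi> \<circ> c) has_vector_derivative v) (at s)"
  shows "speed A g c s = sqrt (g (U, \<phi>) (c s) v v)"
proof -
  define ch where "ch = (SOME ch. ch \<in> A \<and> c s \<in> fst ch)"
  have "ch \<in> A \<and> c s \<in> fst ch"
    unfolding ch_def by (rule someI[of _ "(U, \<phi>)"]) (use U s in auto)
  then obtain V \<psi> where ch: "ch = (V, \<psi>)" "(V, \<psi>) \<in> A" "c s \<in> V"
    by (metis prod.collapse)
  have at: "at s within {a<..<b} = at s" by (rule at_within_open[OF s(1) open_greaterThanLessThan])
  have "vector_derivative (\<psi> \<circ> c) (at s) = frechet_derivative (\<psi> \<circ> inv_into U \<phi>) (at (\<phi> (c s))) v"
    by (rule vector_derivative_at, rule chart_change[OF U ch(2) c s ch(3), unfolded at, OF d])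
  then show ?thesis
    using metric_transform[OF U ch(2) s(2) ch(3) refl, of v v]
    unfolding speed_def Let_def ch_def[symmetric] unfolding ch(1) fst_conv snd_conv by simp
qed

lemma speed_nonneg: "c s \<in> M \<Longrightarrow> 0 \<le> speed A g c s"
proof -
  assume "c s \<in> M"
  define ch where "ch = (SOME ch. ch \<in> A \<and> c s \<in> fst ch)"
  have "ch \<in> A \<and> c s \<in> fst ch"
    unfolding ch_def using chart_cover[OF \<open>c s \<in> M\<close>] by (metis (mono_tags, lifting) fst_conv someI)
  then show ?thesis
    unfolding speed_def Let_def ch_def[symmetric]
    using metric_nonneg[of "fst ch" "snd ch" "c s"] by simp
qed

section \<open>Piecewise C1 curves on arbitrary intervals\<close>

text \<open>An inductive form of the subdivision in \<open>piecewise_C1_curve\<close>, with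
  arbitrary end points. Restriction, reparametrization and integrability are then proved for one
  piece and carried over \<open>join\<close> by rule induction.\<close>

inductive pcurve :: "(real \<Rightarrow> 'm) \<Rightarrow> real \<Rightarrow> real \<Rightarrow> bool" for c where
  piece: "\<lbrakk>a < b; C1_curve A c a b; continuous_on {a..b} c; c ` {a..b} \<subseteq> M\<rbrakk> \<Longrightarrow> pcurve c a b"
| join: "\<lbrakk>pcurve c a b; pcurve c b d\<rbrakk> \<Longrightarrow> pcurve c a d"

lemma pcurve_less: "pcurve c a b \<Longrightarrow> a < b"
  by (induction rule: pcurve.induct) auto

lemma pcurve_basics:
  assumes "pcurve c a b"
  shows "continuous_on {a..b} c \<and> c ` {a..b} \<subseteq> M"
  using assms
proof (induction rule: pcurve.induct)
  case (join a b d)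
  have "{a..d} = {a..b} \<union> {b..d}"
    using pcurve_less[OF join.hyps(1)] pcurve_less[OF join.hyps(2)] by auto
  with join.IH show ?case
    by (auto intro: continuous_on_closed_Un)
qed auto

lemmas pcurve_continuous = pcurve_basics[THEN conjunct1]
  and pcurve_in = pcurve_basics[THEN conjunct2]

lemma C1_curve_subinterval:
  assumes "C1_curve A c a b" "a \<le> a'" "b' \<le> b"
  shows "C1_curve A c a' b'"
  unfolding C1_curve_def split_def
proof
  fix ch assume "ch \<in> A"
  then obtain D where D: "\<forall>s\<in>{s\<in>{a..b}. c s \<in> fst ch}. ((snd ch \<circ> c) has_vector_derivative D s) (at s within {a..b})"
    "continuous_on {s\<in>{a..b}. c s \<in> fst ch} D"
    using assms(1) unfolding C1_curve_def split_def by blast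
  have sub: "{a'..b'} \<subseteq> {a..b}" using assms(2,3) by auto
  show "\<exists>D. (\<forall>s\<in>{s\<in>{a'..b'}. c s \<in> fst ch}. ((snd ch \<circ> c) has_vector_derivative D s) (at s within {a'..b'})) \<and>
      continuous_on {s\<in>{a'..b'}. c s \<in> fst ch} D"
    using D sub by (intro exI[of _ D])
      (auto intro: has_vector_derivative_within_subset[OF _ sub] continuous_on_subset)
qed

lemma pcurve_sub:
  assumes "pcurve c a b"
  shows "a \<le> a' \<Longrightarrow> a' < b' \<Longrightarrow> b' \<le> b \<Longrightarrow> pcurve c a' b'"
  using assms
proof (induction arbitrary: a' b' rule: pcurve.induct)
  case (piece a b)
  have sub: "{a'..b'} \<subseteq> {a..b}" using piece.prems by auto
  show ?case
    using piece sub by (intro pcurve.piece)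
      (auto intro: continuous_on_subset elim: C1_curve_subinterval)
next
  case (join a b d)
  consider "b' \<le> b" | "b \<le> a'" | "a' < b" "b < b'" by linarith
  then show ?case
  proof cases
    case 3 then show ?thesis using join by (intro pcurve.join[of c a' b b']) auto
  qed (use join in auto)
qed

lemma pcurve_cong:
  assumes "pcurve c a b" "\<And>s. s \<in> {a..b} \<Longrightarrow> c s = c' s"
  shows "pcurve c' a b"
  using assms
proof (induction rule: pcurve.induct)
  case (piece a b)
  have "C1_curve A c' a b"
    unfolding C1_curve_def split_def
  proof
    fix ch assume "ch \<in> A"
    then obtain D where D: "\<forall>s\<in>{s\<in>{a..b}. c s \<in> fst ch}. ((snd ch \<circ> c) has_vector_derivative D s) (at s within {a..b})"
      "continuous_on {s\<in>{a..b}. c s \<in> fst ch} D"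
      using piece(2) unfolding C1_curve_def split_def by blast
    have eq: "{s\<in>{a..b}. c' s \<in> fst ch} = {s\<in>{a..b}. c s \<in> fst ch}"
      using piece.prems by auto
    have "((snd ch \<circ> c') has_vector_derivative D s) (at s within {a..b})" if "s\<in>{a..b}" "c s \<in> fst ch" for s
      using D(1) that piece.prems by (auto intro: has_vector_derivative_transform[where f = "snd ch \<circ> c"])
    then show "\<exists>D. (\<forall>s\<in>{s\<in>{a..b}. c' s \<in> fst ch}. ((snd ch \<circ> c') has_vector_derivative D s) (at s within {a..b})) \<and>
        continuous_on {s\<in>{a..b}. c' s \<in> fst ch} D"
      unfolding eq using D(2) by blast
  qed
  then show ?case
    using piece by (intro pcurve.piece) (auto intro: continuous_on_eq[where f = c])
next
  case (join a b d)
  then show ?case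
    using pcurve_less[OF join.hyps(1)] pcurve_less[OF join.hyps(2)]
    by (intro pcurve.join[of c' a b d]) auto
qed

lemma C1_curve_affine:
  assumes "C1_curve A c (min (k*a+l) (k*b+l)) (max (k*a+l) (k*b+l))" "k \<noteq> 0" "a < b"
  shows "C1_curve A (\<lambda>s. c (k * s + l)) a b"
  unfolding C1_curve_def split_def
proof
  fix ch assume "ch \<in> A"
  define J where "J = {min (k*a+l) (k*b+l)..max (k*a+l) (k*b+l)}"
  obtain D where D: "\<forall>s\<in>{s\<in>J. c s \<in> fst ch}. ((snd ch \<circ> c) has_vector_derivative D s) (at s within J)"
    "continuous_on {s\<in>J. c s \<in> fst ch} D"
    using assms(1) \<open>ch \<in> A\<close> unfolding C1_curve_def split_def J_def by blast
  have J: "(\<lambda>s. k * s + l) ` {a..b} \<subseteq> J"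
  proof (cases "k > 0")
    case True
    then show ?thesis using \<open>a < b\<close> by (auto simp: J_def min_def max_def)
  next
    case False
    with \<open>k \<noteq> 0\<close> have "k < 0" by simp
    then show ?thesis using \<open>a < b\<close> by (auto simp: J_def min_def max_def)
  qed
  have "((snd ch \<circ> (\<lambda>s. c (k * s + l))) has_vector_derivative k *\<^sub>R D (k * s + l)) (at s within {a..b})"
    if "s \<in> {a..b}" "c (k * s + l) \<in> fst ch" for s
  proof -
    have "((\<lambda>s. k * s + l) has_vector_derivative k) (at s within {a..b})"
      by (auto intro!: derivative_eq_intros simp: has_real_derivative_iff_has_vector_derivative[symmetric])
    moreover have "((snd ch \<circ> c) has_vector_derivative D (k * s + l)) (at (k * s + l) within (\<lambda>s. k * s + l) ` {a..b})"
      using D(1) that J by (blast intro: has_vector_derivative_within_subset)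
    ultimately have "(snd ch \<circ> c \<circ> (\<lambda>s. k * s + l) has_vector_derivative k *\<^sub>R D (k * s + l)) (at s within {a..b})"
      by (rule vector_diff_chain_within)
    then show ?thesis by (simp add: o_def)
  qed
  moreover have "continuous_on {s\<in>{a..b}. c (k * s + l) \<in> fst ch} (\<lambda>s. k *\<^sub>R D (k * s + l))"
    using J by (intro continuous_intros continuous_on_compose2[OF D(2)]) (auto simp: image_subset_iff)
  ultimately show "\<exists>D. (\<forall>s\<in>{s\<in>{a..b}. c (k * s + l) \<in> fst ch}.
      ((snd ch \<circ> (\<lambda>s. c (k * s + l))) has_vector_derivative D s) (at s within {a..b})) \<and>
      continuous_on {s\<in>{a..b}. c (k * s + l) \<in> fst ch} D"
    by (intro exI[of _ "\<lambda>s. k *\<^sub>R D (k * s + l)"]) simp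
qed

lemma pcurve_affine:
  assumes "pcurve c a b" "k \<noteq> 0"
  shows "pcurve (\<lambda>s. c (k * s + l)) (min ((a-l)/k) ((b-l)/k)) (max ((a-l)/k) ((b-l)/k))"
  using assms(1)
proof (induction rule: pcurve.induct)
  case (piece a b)
  define a' where "a' = min ((a-l)/k) ((b-l)/k)"
  define b' where "b' = max ((a-l)/k) ((b-l)/k)"
  have ab: "a' < b'" and im: "(\<lambda>s. k * s + l) ` {a'..b'} \<subseteq> {a..b}"
    and e: "min (k*a'+l) (k*b'+l) = a" "max (k*a'+l) (k*b'+l) = b"
  proof -
    have "k > 0 \<or> k < 0" using assms(2) by auto
    then have "a' < b' \<and> (\<lambda>s. k * s + l) ` {a'..b'} \<subseteq> {a..b} \<and> min (k*a'+l) (k*b'+l) = a \<and> max (k*a'+l) (k*b'+l) = b"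
    proof
      assume "k > 0"
      then have "(a-l)/k < (b-l)/k" using piece(1) by (simp add: divide_strict_right_mono)
      then show ?thesis using \<open>k > 0\<close> piece(1) unfolding a'_def b'_def by (auto simp: field_simps min_def max_def)
    next
      assume "k < 0"
      then have "(b-l)/k < (a-l)/k" using piece(1) by (simp add: divide_strict_right_mono_neg)
      then show ?thesis using \<open>k < 0\<close> piece(1) unfolding a'_def b'_def by (auto simp: field_simps min_def max_def)
    qed
    then show "a' < b'" "(\<lambda>s. k * s + l) ` {a'..b'} \<subseteq> {a..b}"
      "min (k*a'+l) (k*b'+l) = a" "max (k*a'+l) (k*b'+l) = b" by auto
  qed
  have "C1_curve A (\<lambda>s. c (k * s + l)) a' b'"
    using piece(2) by (intro C1_curve_affine assms(2) ab) (simp add: e)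
  moreover have "continuous_on {a'..b'} (\<lambda>s. c (k * s + l))"
    using im by (intro continuous_on_compose2[OF piece(3)] continuous_intros) auto
  ultimately show ?case
    unfolding a'_def[symmetric] b'_def[symmetric] using ab im piece(4) by (intro pcurve.piece) auto
next
  case (join a b d)
  note lt = pcurve_less[OF join.hyps(1)] pcurve_less[OF join.hyps(2)]
  have "k > 0 \<or> k < 0" using assms(2) by auto
  then show ?case
  proof
    assume "k > 0"
    then have "(a-l)/k < (b-l)/k" "(b-l)/k < (d-l)/k" using lt by (simp_all add: divide_strict_right_mono)
    then show ?thesis using join.IH by (auto simp: min_def max_def intro: pcurve.join)
  next
    assume "k < 0"
    then have "(b-l)/k < (a-l)/k" "(d-l)/k < (b-l)/k" using lt by (simp_all add: divide_strict_right_mono_neg)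
    then show ?thesis using join.IH by (auto simp: min_def max_def intro: pcurve.join)
  qed
qed

lemma pcurve_partition:
  assumes "pcurve c a b"
  shows "\<exists>(n::nat) \<tau>. \<tau> 0 = a \<and> \<tau> n = b \<and> (\<forall>i<n. \<tau> i < \<tau> (Suc i) \<and> C1_curve A c (\<tau> i) (\<tau> (Suc i)))"
  using assms
proof (induction rule: pcurve.induct)
  case (piece a b)
  then show ?case by (intro exI[of _ 1] exI[of _ "\<lambda>i. if i = 0 then a else b"]) auto
next
  case (join a b d)
  then obtain n \<tau> n' \<tau>' where *: "\<tau> (0::nat) = a" "\<tau> n = b" "\<forall>i<n. \<tau> i < \<tau> (Suc i) \<and> C1_curve A c (\<tau> i) (\<tau> (Suc i))"
    "\<tau>' (0::nat) = b" "\<tau>' n' = d" "\<forall>i<n'. \<tau>' i < \<tau>' (Suc i) \<and> C1_curve A c (\<tau>' i) (\<tau>' (Suc i))"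
    by blast
  define \<sigma> where "\<sigma> i = (if i \<le> n then \<tau> i else \<tau>' (i - n))" for i
  have "\<sigma> i < \<sigma> (Suc i) \<and> C1_curve A c (\<sigma> i) (\<sigma> (Suc i))" if "i < n + n'" for i
  proof -
    consider "i < n" | "i = n" | "i > n" by linarith
    then show ?thesis
    proof cases
      case 2
      then have "0 < n'" using that by simp
      then show ?thesis using 2 * by (force simp: \<sigma>_def)
    next
      case 3
      then have "i - n < n'" "Suc i - n = Suc (i - n)" using that by auto
      then show ?thesis using 3 * by (simp add: \<sigma>_def)
    qed (use * in \<open>simp add: \<sigma>_def\<close>)
  qed
  moreover have "\<sigma> 0 = a" "\<sigma> (n + n') = d" using * by (auto simp: \<sigma>_def)
  ultimately show ?case by blast
qed

lemma piecewise_C1_curve_iff: "piecewise_C1_curve M A c \<longleftrightarrow> pcurve c 0 1"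
proof
  assume "piecewise_C1_curve M A c"
  then obtain n :: nat and \<tau> where p: "continuous_on {0..1} c" "c ` {0..1} \<subseteq> M"
    and t: "\<tau> 0 = 0" "\<tau> n = 1" "\<And>i. i < n \<Longrightarrow> \<tau> i < \<tau> (Suc i) \<and> C1_curve A c (\<tau> i) (\<tau> (Suc i))"
    unfolding piecewise_C1_curve_def path_def path_image_def by blast
  have mono: "\<tau> i \<le> \<tau> j" if "i \<le> j" "j \<le> n" for i j
    using that
  proof (induction rule: dec_induct)
    case (step k) then show ?case using t(3)[of k] by simp
  qed simp
  have piece: "pcurve c (\<tau> i) (\<tau> (Suc i))" if "i < n" for i
  proof -
    have "{\<tau> i..\<tau> (Suc i)} \<subseteq> {0..1}" using mono[of 0 i] mono[of "Suc i" n] that t(1,2) by auto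
    then show ?thesis using t(3)[OF that] p by (intro pcurve.piece) (auto intro: continuous_on_subset)
  qed
  have "pcurve c (\<tau> 0) (\<tau> (Suc j))" if "j < n" for j
    using that by (induction j) (auto intro: piece pcurve.join)
  moreover have "n > 0" using t(1,2) by (cases n) auto
  ultimately show "pcurve c 0 1" using t(1,2) by (metis Suc_pred lessI)
next
  assume c: "pcurve c 0 1"
  then show "piecewise_C1_curve M A c"
    using pcurve_basics[OF c] pcurve_partition[OF c]
    unfolding piecewise_C1_curve_def path_def path_image_def by blast
qed

lemma C1_curve_has_derivative:
  assumes "C1_curve A c a b" "s \<in> {a<..<b}" "(U, \<phi>) \<in> A" "c s \<in> U"
  shows "\<exists>v. ((\<phi> \<circ> c) has_vector_derivative v) (at s)"
proof -
  obtain D where "\<forall>s\<in>{s\<in>{a..b}. c s \<in> U}. ((\<phi> \<circ> c) has_vector_derivative D s) (at s within {a..b})"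
    using assms(1,3) unfolding C1_curve_def by blast
  then have "((\<phi> \<circ> c) has_vector_derivative D s) (at s within {a..b})" using assms(2,4) by auto
  then show ?thesis using at_within_Icc_at[of a s b] assms(2) by auto
qed

text \<open>The derivative is two-sided, as in \<open>speed\<close>, so it can fail to exist at the
  break points. All comparisons of lengths below leave out a finite set for this reason.\<close>

definition has_velocity_at :: "(real \<Rightarrow> 'm) \<Rightarrow> real \<Rightarrow> bool" where
  "has_velocity_at c s \<longleftrightarrow>
     (\<forall>(U, \<phi>)\<in>A. c s \<in> U \<longrightarrow> (\<exists>v. ((\<phi> \<circ> c) has_vector_derivative v) (at s)))"

lemma has_velocity_atD:
  "has_velocity_at c s \<Longrightarrow> (U, \<phi>) \<in> A \<Longrightarrow> c s \<in> U \<Longrightarrow> \<exists>v. ((\<phi> \<circ> c) has_vector_derivative v) (at s)"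
  unfolding has_velocity_at_def by blast

lemma pcurve_has_velocity:
  assumes "pcurve c a b"
  shows "\<exists>F. finite F \<and> (\<forall>s\<in>{a<..<b} - F. has_velocity_at c s)"
  using assms
proof (induction rule: pcurve.induct)
  case (piece a b)
  then have "\<forall>s\<in>{a<..<b} - {}. has_velocity_at c s"
    unfolding has_velocity_at_def using C1_curve_has_derivative[OF piece(2)] by blast
  then show ?case by blast
next
  case (join a b d)
  from join.IH obtain F G where FG: "finite F" "\<forall>s\<in>{a<..<b} - F. has_velocity_at c s"
    "finite G" "\<forall>s\<in>{b<..<d} - G. has_velocity_at c s" by (elim exE conjE)
  have "{a<..<d} - (F \<union> G \<union> {b}) \<subseteq> ({a<..<b} - F) \<union> ({b<..<d} - G)" by auto
  then have "\<forall>s\<in>{a<..<d} - (F \<union> G \<union> {b}). has_velocity_at c s"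
    using FG(2,4) by (metis UnE subsetD)
  moreover have "finite (F \<union> G \<union> {b})" using FG(1,3) by simp
  ultimately show ?case by (intro exI[of _ "F \<union> G \<union> {b}"] conjI)
qed

text \<open>\<open>speed\<close> uses two-sided derivatives and an arbitrary chart at each time, so
  its continuity is not visible. The function \<open>w\<close> is built from the one-sided
  derivatives instead; it is continuous on the closed interval and agrees with \<open>speed\<close>
  in the interior.\<close>

lemma C1_curve_speed_integrable:
  assumes "a < b" and C1: "C1_curve A c a b" and c: "continuous_on {a..b} c" "c ` {a..b} \<subseteq> M"
  shows "speed A g c integrable_on {a..b}"
proof -
  have "\<forall>ch\<in>A. \<exists>D. (\<forall>s\<in>{s\<in>{a..b}. c s \<in> fst ch}. ((snd ch \<circ> c) has_vector_derivative D s) (at s within {a..b})) \<and>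
        continuous_on {s\<in>{a..b}. c s \<in> fst ch} D"
    using C1 unfolding C1_curve_def split_def .
  from bchoice[OF this] obtain D where D0: "\<forall>ch\<in>A.
      (\<forall>s\<in>{s\<in>{a..b}. c s \<in> fst ch}. ((snd ch \<circ> c) has_vector_derivative D ch s) (at s within {a..b})) \<and>
      continuous_on {s\<in>{a..b}. c s \<in> fst ch} (D ch)" by (elim exE)
  have D: "ch \<in> A \<Longrightarrow> s \<in> {a..b} \<Longrightarrow> c s \<in> fst ch \<Longrightarrow>
      ((snd ch \<circ> c) has_vector_derivative D ch s) (at s within {a..b})"
    "ch \<in> A \<Longrightarrow> continuous_on {s\<in>{a..b}. c s \<in> fst ch} (D ch)" for ch s
    using bspec[OF D0, of ch] by simp_all
  have "\<forall>s\<in>{a..b}. \<exists>ch. ch \<in> A \<and> c s \<in> fst ch"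
    using c(2) chart_cover by (metis fst_conv image_subset_iff)
  then obtain ch where ch: "\<And>s. s \<in> {a..b} \<Longrightarrow> ch s \<in> A \<and> c s \<in> fst (ch s)" by metis
  define w where "w s = sqrt (g (ch s) (c s) (D (ch s) s) (D (ch s) s))" for s
  \<comment> \<open>The value does not depend on the chart: the derivatives in two charts are
    related by \<open>chart_change\<close>, and derivatives within a nontrivial interval are
    unique.\<close>
  have w: "w s = sqrt (g (U, \<phi>) (c s) (D (U, \<phi>) s) (D (U, \<phi>) s))"
    if s: "s \<in> {a..b}" and U: "(U, \<phi>) \<in> A" "c s \<in> U" for s U \<phi>
  proof -
    obtain V \<psi> where V: "ch s = (V, \<psi>)" "(V, \<psi>) \<in> A" "c s \<in> V"
      using ch[OF s] by (metis prod.collapse)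
    have d: "((\<phi> \<circ> c) has_vector_derivative D (U, \<phi>) s) (at s within {a..b})"
      "((\<psi> \<circ> c) has_vector_derivative D (V, \<psi>) s) (at s within {a..b})"
      using D(1)[of "(U, \<phi>)" s] D(1)[of "(V, \<psi>)" s] U V s by auto
    have "D (V, \<psi>) s = frechet_derivative (\<psi> \<circ> inv_into U \<phi>) (at (\<phi> (c s))) (D (U, \<phi>) s)"
      by (rule vector_derivative_unique_within_closed_interval[unfolded box_real, OF _ _ d(2)
            chart_change[OF U(1) V(2) c s U(2) V(3) d(1)]]) (use s \<open>a < b\<close> in auto)
    then show ?thesis
      unfolding w_def V(1) using metric_transform[OF U(1) V(2) U(2) V(3) refl] by simp
  qed
  have "continuous_on {a..b} w"
    unfolding continuous_on_eq_continuous_within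
  proof
    fix s assume s: "s \<in> {a..b}"
    obtain U \<phi> where U: "(U, \<phi>) \<in> A" "c s \<in> U"
      using chart_cover c(2) s by blast
    obtain W where W: "open W" "U = M \<inter> W"
      using chart_openin[OF U(1)] by (metis openin_open)
    define T where "T = {s\<in>{a..b}. c s \<in> U}"
    have T: "T = {a..b} \<inter> c -` W" using c(2) by (auto simp: T_def W(2))
    have "openin (top_of_set {a..b}) T"
      unfolding T by (rule continuous_openin_preimage_gen[OF c(1) W(1)])
    then obtain O' where O': "open O'" "T = {a..b} \<inter> O'" by (metis openin_open)
    have "continuous_on T (\<lambda>s. sqrt (g (U, \<phi>) (c s) (D (U, \<phi>) s) (D (U, \<phi>) s)))"
    proof (rule continuous_on_real_sqrt,
        rule continuous_on_bilinear_family[where V = "D (U, \<phi>)" and G = "\<lambda>s. g (U, \<phi>) (c s)"])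
      have "continuous_on T c" by (rule continuous_on_subset[OF c(1)]) (simp add: T)
      moreover have "c ` T \<subseteq> U" by (auto simp: T_def)
      ultimately show "continuous_on T (\<lambda>s. g (U, \<phi>) (c s) v w)" for v w
        by (rule metric_continuous[OF U(1)])
      show "bilinear (g (U, \<phi>) (c x))" if "x \<in> T" for x
        using metric_props(1)[OF U(1)] that by (auto simp: T_def)
      show "continuous_on T (D (U, \<phi>))" using D(2)[OF U(1)] by (simp add: T_def)
    qed
    then have "continuous_on T w"
      by (rule continuous_on_eq) (use w[OF _ U(1)] in \<open>auto simp: T_def\<close>)
    moreover have sT: "s \<in> T" using s U(2) by (simp add: T_def)
    ultimately have "continuous (at s within T) w"
      by (simp add: continuous_on_eq_continuous_within)
    \<comment> \<open>\<open>T\<close> is relatively open in \<open>{a..b}\<close>, so continuity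
      within \<open>T\<close> is continuity within the whole interval.\<close>
    moreover have "at s within T = at s within {a..b}"
      by (rule at_within_nhd[of _ O']) (use O' sT in auto)
    ultimately show "continuous (at s within {a..b}) w" by simp
  qed
  then have int: "w integrable_on {a..b}" by (rule integrable_continuous_real)
  have eq: "speed A g c s = w s" if "s \<in> {a..b} - {a, b}" for s
  proof -
    have s: "s \<in> {a..b}" "s \<in> {a<..<b}" using that by auto
    obtain U \<phi> where U: "(U, \<phi>) \<in> A" "c s \<in> U" using chart_cover c(2) s by blast
    have "((\<phi> \<circ> c) has_vector_derivative D (U, \<phi>) s) (at s)"
      using D(1)[of "(U, \<phi>)" s] U s(1) at_within_Icc_at[of a s b] s(2) by auto
    moreover have "continuous_on {a<..<b} c" "c ` {a<..<b} \<subseteq> M"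
      using c by (auto intro: continuous_on_subset)
    ultimately show ?thesis
      using speed_eq[where c = c and s = s, OF U(1) _ _ s(2) U(2)] w[OF s(1) U] by simp
  qed
  show ?thesis by (rule integrable_spike[where S = "{a, b}", OF int _ eq]) auto
qed

lemma pcurve_speed_integrable: "pcurve c a b \<Longrightarrow> speed A g c integrable_on {a..b}"
proof (induction rule: pcurve.induct)
  case (piece a b)
  then show ?case by (rule C1_curve_speed_integrable)
next
  case (join a b d)
  show ?case
    using pcurve_less[OF join.hyps(1)] pcurve_less[OF join.hyps(2)]
    by (intro Henstock_Kurzweil_Integration.integrable_combine[OF _ _ join.IH] less_imp_le)
qed

section \<open>Length of curves and the relation of being joined\<close>

abbreviation len :: "(real \<Rightarrow> 'm) \<Rightarrow> real \<Rightarrow> real \<Rightarrow> real" where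
  "len c a b \<equiv> integral {a..b} (speed A g c)"

lemma len_nonneg: "pcurve c a b \<Longrightarrow> 0 \<le> len c a b"
  using pcurve_in by (intro integral_nonneg pcurve_speed_integrable speed_nonneg) (auto simp: image_subset_iff)

lemma len_combine: "pcurve c a b \<Longrightarrow> a \<le> s \<Longrightarrow> s \<le> b \<Longrightarrow> len c a s + len c s b = len c a b"
  by (rule Henstock_Kurzweil_Integration.integral_combine) (auto intro: pcurve_speed_integrable)

text \<open>Outside \<open>{a..b}\<close> the two curves are unrelated, so their two-sided
  derivatives can differ at the end points. These and the break points form a finite set, which does
  not affect the integral.\<close>

lemma len_cong:
  assumes "pcurve c a b" "\<And>s. s \<in> {a..b} \<Longrightarrow> c s = c' s"
  shows "len c' a b = len c a b"
proof -
  obtain F where F: "finite F" "\<forall>s\<in>{a<..<b} - F. has_velocity_at c s"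
    using pcurve_has_velocity[OF assms(1)] by blast
  note c = pcurve_basics[OF assms(1)] and c' = pcurve_basics[OF pcurve_cong[OF assms]]
  have eq: "speed A g c s = speed A g c' s" if s: "s \<in> {a..b} - (F \<union> {a, b})" for s
  proof -
    have s': "s \<in> {a<..<b}" "s \<in> {a..b}" using s by auto
    obtain U \<phi> where U: "(U, \<phi>) \<in> A" "c s \<in> U" using chart_cover c s by blast
    then obtain v where v: "((\<phi> \<circ> c) has_vector_derivative v) (at s)"
      using F(2) s has_velocity_atD by (metis DiffE DiffI UnCI atLeastAtMost_iff greaterThanLessThan_iff insertCI less_eq_real_def)
    then have v': "((\<phi> \<circ> c') has_vector_derivative v) (at s)"
      by (rule has_vector_derivative_transform_within_open[OF _ open_greaterThanLessThan s'(1)]) (use assms(2) in auto)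
    have "continuous_on {a<..<b} c" "c ` {a<..<b} \<subseteq> M" "continuous_on {a<..<b} c'" "c' ` {a<..<b} \<subseteq> M"
      using c c' by (auto intro: continuous_on_subset)
    then show ?thesis
      using speed_eq[where c = c and s = s, OF U(1) _ _ s'(1) _ v] speed_eq[where c = c' and s = s, OF U(1) _ _ s'(1) _ v'] U(2) assms(2)[OF s'(2)] by simp
  qed
  show ?thesis
    by (rule integral_spike[where S = "F \<union> {a, b}", OF negligible_finite eq]) (use F(1) in simp_all)
qed

lemma speed_affine:
  assumes c: "continuous_on {a<..<b} c" "c ` {a<..<b} \<subseteq> M" and s: "k * s + l \<in> {a<..<b}"
    and U: "(U, \<phi>) \<in> A" "c (k * s + l) \<in> U"
    and d: "((\<phi> \<circ> c) has_vector_derivative v) (at (k * s + l))" and k: "k \<noteq> 0"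
  shows "speed A g (\<lambda>s. c (k * s + l)) s = \<bar>k\<bar> * speed A g c (k * s + l)"
proof -
  have "open ((\<lambda>s. k * s + l) -` {a<..<b})"
    by (intro open_vimage continuous_intros open_greaterThanLessThan)
  then obtain e where e: "e > 0" "{s - e<..<s + e} \<subseteq> (\<lambda>s. k * s + l) -` {a<..<b}"
    using s openE[of "(\<lambda>s. k * s + l) -` {a<..<b}" s] by (metis ball_eq_greaterThanLessThan vimageI)
  have "(\<phi> \<circ> c \<circ> (\<lambda>s. k * s + l) has_vector_derivative k *\<^sub>R v) (at s)"
    by (rule vector_diff_chain_at[where f = "\<lambda>s. k * s + l" and x = s, OF _ d])
       (auto intro!: derivative_eq_intros simp: has_real_derivative_iff_has_vector_derivative[symmetric])
  then have d': "((\<phi> \<circ> (\<lambda>s. c (k * s + l))) has_vector_derivative k *\<^sub>R v) (at s)" by (simp add: o_def)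
  have "continuous_on {s - e<..<s + e} (\<lambda>s. c (k * s + l))"
    by (intro continuous_on_compose2[OF c(1)] continuous_intros) (use e(2) in auto)
  moreover have "(\<lambda>s. c (k * s + l)) ` {s - e<..<s + e} \<subseteq> M" using e(2) c(2) by auto
  ultimately have "speed A g (\<lambda>s. c (k * s + l)) s = sqrt (g (U, \<phi>) (c (k * s + l)) (k *\<^sub>R v) (k *\<^sub>R v))"
    using e(1) by (intro speed_eq[where c = "\<lambda>s. c (k * s + l)" and s = s, OF U(1) _ _ _ U(2) d']) auto
  also have "\<dots> = sqrt (k\<^sup>2 * g (U, \<phi>) (c (k * s + l)) v v)"
    using metric_props(1)[OF U] by (simp add: bilinear_lmul bilinear_rmul power2_eq_square mult.assoc)
  also have "\<dots> = \<bar>k\<bar> * speed A g c (k * s + l)"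
    using speed_eq[where c = c and s = "k * s + l", OF U(1) c s U(2) d] by (simp add: real_sqrt_mult)
  finally show ?thesis .
qed

text \<open>The two cases for \<open>k\<close> are the orientation preserving and the reversing
  substitution. The factor \<open>1 / |k|\<close> from the change of variable cancels the factor
  \<open>|k|\<close> in the speed; \<open>F'\<close> collects the times at which the speed formula
  may fail.\<close>

lemma pcurve_reparam:
  assumes c: "pcurve c a b"
    and k: "k > 0 \<and> a = k * a' + l \<and> b = k * b' + l \<or> k < 0 \<and> a = k * b' + l \<and> b = k * a' + l"
  shows "pcurve (\<lambda>s. c (k * s + l)) a' b'" "len (\<lambda>s. c (k * s + l)) a' b' = len c a b"
proof -
  note ab = pcurve_less[OF c]
  have k0: "k \<noteq> 0" using k by auto
  have lt: "a' < b'" using k ab by auto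
  have "min ((a-l)/k) ((b-l)/k) = a'" "max ((a-l)/k) ((b-l)/k) = b'"
    using k lt by (auto simp: min_def max_def)
  then show pc: "pcurve (\<lambda>s. c (k * s + l)) a' b'" using pcurve_affine[OF c k0, of l] by simp
  have "(\<lambda>x. (1 / k) *\<^sub>R x + - ((1 / k) *\<^sub>R l)) ` {a..b} = {a'..b'}"
  proof (intro subset_antisym subsetI)
    fix x assume "x \<in> (\<lambda>x. (1 / k) *\<^sub>R x + - ((1 / k) *\<^sub>R l)) ` {a..b}"
    then obtain y where y: "y \<in> {a..b}" "x = (y - l) / k" by (auto simp: diff_divide_distrib)
    then have "y = k * x + l" using k0 by simp
    then show "x \<in> {a'..b'}" using y(1) k by (auto simp: mult_le_cancel_left)
  next
    fix x assume x: "x \<in> {a'..b'}"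
    have "k * x + l \<in> {a..b}" using x k by (auto simp: mult_le_cancel_left)
    moreover have "x = (1 / k) *\<^sub>R (k * x + l) + - ((1 / k) *\<^sub>R l)" using k0 by (simp add: field_simps)
    ultimately show "x \<in> (\<lambda>x. (1 / k) *\<^sub>R x + - ((1 / k) *\<^sub>R l)) ` {a..b}" by blast
  qed
  then have "((\<lambda>x. speed A g c (k * x + l)) has_integral (1 / \<bar>k\<bar>) * len c a b) {a'..b'}"
    using has_integral_affinity[OF _ k0, of "speed A g c" "len c a b" a b l] pcurve_speed_integrable[OF c]
    by (simp add: integrable_integral)
  then have I: "((\<lambda>x. \<bar>k\<bar> * speed A g c (k * x + l)) has_integral len c a b) {a'..b'}"
    using has_integral_mult_right[of "\<lambda>x. speed A g c (k * x + l)" "(1 / \<bar>k\<bar>) * len c a b" "{a'..b'}" "\<bar>k\<bar>"] k0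
    by simp
  obtain F where F: "finite F" "\<forall>s\<in>{a<..<b} - F. has_velocity_at c s"
    using pcurve_has_velocity[OF c] by blast
  define F' where "F' = {a', b'} \<union> (\<lambda>y. (y - l) / k) ` F"
  have eq: "speed A g (\<lambda>s. c (k * s + l)) s = \<bar>k\<bar> * speed A g c (k * s + l)" if s: "s \<in> {a'..b'} - F'" for s
  proof -
    have s': "k * s + l \<in> {a<..<b}" using s k by (auto simp: F'_def mult_less_cancel_left)
    have "k * s + l \<notin> F"
    proof
      assume "k * s + l \<in> F"
      then have "((k * s + l) - l) / k \<in> (\<lambda>y. (y - l) / k) ` F" by (rule imageI)
      moreover have "((k * s + l) - l) / k = s" using k0 by simp
      ultimately show False using s by (simp add: F'_def)
    qed
    with s' have s'': "k * s + l \<in> {a<..<b} - F" by blast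
    have "c (k * s + l) \<in> M" using s' pcurve_in[OF c] by (auto simp: image_subset_iff)
    then obtain U \<phi> where U: "(U, \<phi>) \<in> A" "c (k * s + l) \<in> U" using chart_cover by blast
    then obtain v where v: "((\<phi> \<circ> c) has_vector_derivative v) (at (k * s + l))" using F(2) s'' has_velocity_atD by metis
    have "continuous_on {a<..<b} c" "c ` {a<..<b} \<subseteq> M"
      using pcurve_basics[OF c] by (auto intro: continuous_on_subset)
    then show ?thesis by (rule speed_affine[where c = c and s = s, OF _ _ s' U v k0])
  qed
  have "(speed A g (\<lambda>s. c (k * s + l)) has_integral len c a b) {a'..b'}"
    by (rule has_integral_spike_finite[where S = F', OF _ eq I]) (use F(1) in \<open>simp add: F'_def\<close>)
  then show "len (\<lambda>s. c (k * s + l)) a' b' = len c a b" by (rule integral_unique)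
qed

text \<open>With the length as an argument, reversing and gluing curves become symmetry and
  additivity of a relation, and the Riemannian distance is the infimum of the possible
  \<open>L\<close>.\<close>

definition joined :: "'m \<Rightarrow> 'm \<Rightarrow> real \<Rightarrow> bool" where
  "joined p q L \<longleftrightarrow> (\<exists>c. pcurve c 0 1 \<and> c 0 = p \<and> c 1 = q \<and> len c 0 1 = L)"

lemma joined_pcurve:
  assumes "pcurve c a b"
  shows "joined (c a) (c b) (len c a b)" "joined (c b) (c a) (len c a b)"
proof -
  have ab: "a < b" using pcurve_less[OF assms] .
  show "joined (c a) (c b) (len c a b)"
    unfolding joined_def using pcurve_reparam[OF assms, of "b - a" 0 a 1] ab
    by (intro exI[of _ "\<lambda>s. c ((b - a) * s + a)"]) auto
  show "joined (c b) (c a) (len c a b)"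
    unfolding joined_def using pcurve_reparam[OF assms, of "a - b" 0 b 1] ab
    by (intro exI[of _ "\<lambda>s. c ((a - b) * s + b)"]) auto
qed

lemma joined_sym: "joined p q L \<Longrightarrow> joined q p L"
  using joined_pcurve(2)[of _ 0 1] by (auto simp: joined_def)

lemma joined_nonneg: "joined p q L \<Longrightarrow> 0 \<le> L"
  by (auto simp: joined_def len_nonneg)

lemma joined_trans:
  assumes "joined p q L" "joined q r L'"
  shows "joined p r (L + L')"
proof -
  obtain c c' where c: "pcurve c 0 1" "c 0 = p" "c 1 = q" "len c 0 1 = L"
    and c': "pcurve c' 0 1" "c' 0 = q" "c' 1 = r" "len c' 0 1 = L'"
    using assms unfolding joined_def by blast
  define h where "h s = (if s \<le> 1 then c s else c' (1 * s + (-1)))" for s :: real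
  have h1: "pcurve h 0 1" "len h 0 1 = L"
    using pcurve_cong[OF c(1), of h] len_cong[OF c(1), of h] c(4) by (auto simp: h_def)
  note r = pcurve_reparam[OF c'(1), of 1 1 "-1" 2]
  have eq: "c' (1 * s + (-1)) = h s" if "s \<in> {1..2}" for s
    using that c c' by (cases "s = 1") (auto simp: h_def)
  have h2: "pcurve h 1 2" "len h 1 2 = L'"
    using pcurve_cong[OF r(1) eq] len_cong[OF r(1) eq] r(2) c'(4) by auto
  have h: "pcurve h 0 2" using h1(1) h2(1) by (rule pcurve.join)
  have "len h 0 2 = L + L'" using len_combine[OF h, of 1] h1 h2 by simp
  moreover have "h 0 = p" "h 2 = r" using c c' by (auto simp: h_def)
  ultimately show ?thesis using joined_pcurve(1)[OF h] by simp
qed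

lemma riemannian_dist_eq: "riemannian_dist M A g p q = Inf {L. joined p q L}"
  unfolding riemannian_dist_def joined_def piecewise_C1_curve_iff curve_length_def pathstart_def pathfinish_def
  by (rule arg_cong[where f = Inf]) auto

section \<open>Comparison of lengths with coordinate distances\<close>

text \<open>On the compact product of \<open>K\<close> with the unit sphere the quadratic form is
  continuous and positive, hence bounded between positive constants. Homogeneity extends the bounds
  to all vectors.\<close>

lemma metric_bounds:
  assumes U: "(U, \<phi>) \<in> A" and K: "compact K" "K \<subseteq> \<phi> ` U"
  shows "\<exists>l>0. \<exists>C>0. \<forall>y\<in>K. \<forall>v. l * norm v \<le> sqrt (g (U, \<phi>) (inv_into U \<phi> y) v v) \<and>
           sqrt (g (U, \<phi>) (inv_into U \<phi> y) v v) \<le> C * norm v"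
proof -
  define G where "G y = g (U, \<phi>) (inv_into U \<phi> y)" for y
  have inv: "inv_into U \<phi> y \<in> U" if "y \<in> K" for y using that K(2) by (blast intro: inv_into_into)
  note G = metric_props[OF U inv, folded G_def]
  define Z where "Z = K \<times> sphere (0::'e) 1"
  have "sphere (0::'e) 1 = cball 0 1 \<inter> {x. norm x = 1}" by auto
  moreover have "closed {x::'e. norm x = 1}" by (intro closed_Collect_eq continuous_intros)
  ultimately have "compact (sphere (0::'e) 1)" using compact_Int_closed[OF compact_cball] by metis
  then have cZ: "compact Z" unfolding Z_def using K(1) by (intro compact_Times)
  have cont: "continuous_on Z (\<lambda>z. G (fst z) (snd z) (snd z))"
  proof (rule continuous_on_bilinear_family[where V = snd and G = "\<lambda>z. G (fst z)"])
    have "continuous_on Z (\<lambda>z. inv_into U \<phi> (fst z))"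
      by (rule continuous_on_compose2[OF chart_inv_cont[OF U]]) (use K(2) in \<open>auto simp: Z_def intro: continuous_intros\<close>)
    then show "continuous_on Z (\<lambda>z. G (fst z) v w)" for v w
      unfolding G_def by (rule metric_continuous[OF U]) (use inv in \<open>auto simp: Z_def\<close>)
  qed (use G in \<open>auto simp: Z_def intro: continuous_intros\<close>)
  have pos: "0 < G (fst z) (snd z) (snd z)" if "z \<in> Z" for z
  proof -
    have "snd z \<noteq> 0" "fst z \<in> K" using that by (auto simp: Z_def)
    then show ?thesis using G(2) by blast
  qed
  obtain m B where m: "0 < m" "0 < B" "\<And>z. z \<in> Z \<Longrightarrow> m \<le> G (fst z) (snd z) (snd z)"
    "\<And>z. z \<in> Z \<Longrightarrow> G (fst z) (snd z) (snd z) \<le> B"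
  \<comment> \<open>\<open>Z\<close> is empty if \<open>K\<close> is empty or if the model space has
    dimension zero.\<close>
  proof (cases "Z = {}")
    case True
    then show ?thesis using that[of 1 1] by simp
  next
    case False
    obtain z1 where z1: "z1 \<in> Z" "\<And>z. z \<in> Z \<Longrightarrow> G (fst z1) (snd z1) (snd z1) \<le> G (fst z) (snd z) (snd z)"
      using continuous_attains_inf[OF cZ False cont] by blast
    obtain z2 where z2: "z2 \<in> Z" "\<And>z. z \<in> Z \<Longrightarrow> G (fst z) (snd z) (snd z) \<le> G (fst z2) (snd z2) (snd z2)"
      using continuous_attains_sup[OF cZ False cont] by blast
    show ?thesis using that[OF pos[OF z1(1)] pos[OF z2(1)] z1(2) z2(2)] by blast
  qed
  have "sqrt m * norm v \<le> sqrt (G y v v) \<and> sqrt (G y v v) \<le> sqrt B * norm v" if y: "y \<in> K" for y v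
  proof (cases "v = 0")
    case True
    then show ?thesis using bilinear_lzero[OF G(1)[OF y]] by simp
  next
    case False
    define u where "u = v /\<^sub>R norm v"
    have z: "(y, u) \<in> Z" using y False by (simp add: Z_def u_def)
    have v: "v = norm v *\<^sub>R u" using False by (simp add: u_def)
    have "G y v v = G y (norm v *\<^sub>R u) (norm v *\<^sub>R u)" using v by simp
    also have "\<dots> = (norm v)\<^sup>2 * G y u u"
      by (simp only: bilinear_lmul[OF G(1)[OF y]] bilinear_rmul[OF G(1)[OF y]] real_scaleR_def power2_eq_square mult.assoc)
    finally have "sqrt (G y v v) = norm v * sqrt (G y u u)" by (simp add: real_sqrt_mult)
    moreover have "sqrt m \<le> sqrt (G y u u)" "sqrt (G y u u) \<le> sqrt B" using m(3,4)[OF z] by simp_all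
    ultimately show ?thesis by (simp only: mult.commute[of "norm v"]) (auto intro: mult_right_mono)
  qed
  then show ?thesis
    unfolding G_def using m(1,2) by (intro exI[of _ "sqrt m"] exI[of _ "sqrt B"] conjI ballI allI) auto
qed

lemma chart_ball_openin:
  assumes "(U, \<phi>) \<in> A"
  shows "openin (top_of_set M) {x\<in>U. \<phi> x \<in> ball y r}"
proof -
  have "openin (top_of_set U) (U \<inter> \<phi> -` ball y r)"
    by (rule continuous_openin_preimage_gen[OF chart_cont[OF assms] open_ball])
  then have "openin (top_of_set M) (U \<inter> \<phi> -` ball y r)" using chart_openin[OF assms] openin_trans by blast
  then show ?thesis by (simp add: Int_def vimage_def)
qed

text \<open>The curve is the preimage of the straight segment in coordinates. Its velocity is
  constant in the chart, so \<open>C\<close> bounds its speed and hence its length.\<close>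

lemma chart_segment:
  assumes U: "(U, \<phi>) \<in> A" and p: "p \<in> U" "q \<in> U" and r: "cball (\<phi> p) r \<subseteq> \<phi> ` U" "\<phi> q \<in> ball (\<phi> p) r"
    and C: "\<forall>y\<in>cball (\<phi> p) r. \<forall>v. sqrt (g (U, \<phi>) (inv_into U \<phi> y) v v) \<le> C * norm v"
  shows "\<exists>L \<le> C * dist (\<phi> p) (\<phi> q). joined p q L"
proof -
  define w where "w = \<phi> q - \<phi> p"
  define line where "line s = \<phi> p + s *\<^sub>R w" for s :: real
  define c where "c s = inv_into U \<phi> (line s)" for s
  have ball: "line s \<in> cball (\<phi> p) r" if "s \<in> {0..1}" for s
  proof -
    have "norm (s *\<^sub>R w) \<le> norm w" using that by (simp add: mult_left_le_one_le)
    also have "\<dots> \<le> r" using r(2) by (simp add: w_def dist_norm norm_minus_commute)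
    finally show ?thesis by (simp add: line_def dist_norm)
  qed
  then have im: "line s \<in> \<phi> ` U" if "s \<in> {0..1}" for s using that r(1) by blast
  have cU: "c s \<in> U" and \<phi>c: "\<phi> (c s) = line s" if "s \<in> {0..1}" for s
    using im[OF that] unfolding c_def by (auto intro: inv_into_into f_inv_into_f)
  have contl: "continuous_on S line" for S unfolding line_def by (intro continuous_intros)
  have contc: "continuous_on {0..1} c"
    unfolding c_def by (rule continuous_on_compose2[OF chart_inv_cont[OF U] contl]) (use im in blast)
  have cM: "c ` {0..1} \<subseteq> M" using cU chart_subset[OF U] by blast
  have dl: "(line has_vector_derivative w) (at s within S)" for s S
    unfolding line_def by (auto intro!: derivative_eq_intros)
  have d\<phi>: "((\<phi> \<circ> c) has_vector_derivative w) (at s within {0..1})" if "s \<in> {0..1}" for s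
    by (rule has_vector_derivative_transform[OF that _ dl]) (simp add: \<phi>c)
  have "C1_curve A c 0 1"
    unfolding C1_curve_def
  proof (clarify)
    fix V \<psi> assume V: "(V, \<psi>) \<in> A"
    define D where "D s = frechet_derivative (\<psi> \<circ> inv_into U \<phi>) (at (line s)) w" for s
    have "\<forall>s\<in>{s\<in>{0..1}. c s \<in> V}. ((\<psi> \<circ> c) has_vector_derivative D s) (at s within {0..1})"
    proof
      fix s assume "s \<in> {s\<in>{0..1}. c s \<in> V}"
      then have s: "s \<in> {0..1}" "c s \<in> V" by simp_all
      show "((\<psi> \<circ> c) has_vector_derivative D s) (at s within {0..1})"
        unfolding D_def using chart_change[OF U V contc cM s(1) cU[OF s(1)] s(2) d\<phi>[OF s(1)]]
        by (simp add: \<phi>c[OF s(1)])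
    qed
    moreover have "continuous_on {s\<in>{0..1}. c s \<in> V} D"
      unfolding D_def
    proof (rule continuous_on_compose2[OF transition_derivative_continuous[OF U V] contl], clarify)
      fix s :: real assume "s \<in> {0..1}" "c s \<in> V"
      then show "line s \<in> \<phi> ` (U \<inter> V)" using cU \<phi>c by (metis IntI imageI)
    qed
    ultimately show "\<exists>D. (\<forall>s\<in>{s\<in>{0..1}. c s \<in> V}. ((\<psi> \<circ> c) has_vector_derivative D s) (at s within {0..1})) \<and>
        continuous_on {s\<in>{0..1}. c s \<in> V} D" by (intro exI[of _ D] conjI)
  qed
  then have pc: "pcurve c 0 1" by (intro pcurve.piece contc cM) simp_all
  have "norm (speed A g c s) \<le> C * norm w" if s: "s \<in> cbox 0 1 - {0, 1}" for s
  proof -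
    have s': "s \<in> {0<..<1}" "s \<in> {0..1}" using s by auto
    have "((\<phi> \<circ> c) has_vector_derivative w) (at s)" using d\<phi>[OF s'(2)] at_within_Icc_at[of 0 s 1] s'(1) by simp
    moreover have "continuous_on {0<..<1} c" by (rule continuous_on_subset[OF contc]) auto
    moreover have "c ` {0<..<1} \<subseteq> M" using cM by (auto simp: image_subset_iff)
    ultimately have "speed A g c s = sqrt (g (U, \<phi>) (c s) w w)"
      by (intro speed_eq[where c = c and s = s, OF U _ _ s'(1) cU[OF s'(2)]])
    moreover have "sqrt (g (U, \<phi>) (c s) w w) \<le> C * norm w"
      using C ball[OF s'(2)] unfolding c_def by blast
    moreover have "0 \<le> speed A g c s" using speed_nonneg cM s'(2) by blast
    ultimately show ?thesis by simp
  qed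
  moreover have "(speed A g c has_integral len c 0 1) (cbox 0 1)"
    using pcurve_speed_integrable[OF pc] by (simp add: integrable_integral)
  moreover have "0 \<le> C * norm w"
    using C[rule_format, of "\<phi> p" w] ball[of 0] metric_nonneg[OF U p(1), of w]
    by (auto simp: line_def chart_inv[OF U p(1)] intro: order_trans[of _ "sqrt _"])
  ultimately have "norm (len c 0 1) \<le> C * norm w * measure lborel (cbox 0 (1::real))"
    by (intro has_integral_bound_spike_finite[where S = "{0, 1}" and f = "speed A g c"]) simp_all
  then have "len c 0 1 \<le> C * dist (\<phi> p) (\<phi> q)" by (simp add: w_def dist_norm norm_minus_commute)
  moreover have "c 0 = p" "c 1 = q" using chart_inv[OF U] p by (simp_all add: c_def line_def w_def)
  ultimately show ?thesis using pc unfolding joined_def by (intro exI[of _ "len c 0 1"] conjI exI[of _ c]) simp_all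
qed

text \<open>Coordinate segments reach every point of a small coordinate ball. This links length to
  the topology of \<open>M\<close>: both the joinability of any two points and the continuity of the
  distance rest on it.\<close>

lemma joined_locally:
  assumes p: "p \<in> M" and e: "0 < e"
  shows "\<exists>T. openin (top_of_set M) T \<and> p \<in> T \<and> (\<forall>q\<in>T. \<exists>L<e. joined p q L)"
proof -
  obtain U \<phi> where U: "(U, \<phi>) \<in> A" "p \<in> U" using chart_cover[OF p] by blast
  obtain r where r: "r > 0" "cball (\<phi> p) r \<subseteq> \<phi> ` U"
    using chart_open_image[OF U(1)] U(2) open_contains_cball by (metis imageI)
  obtain C where C: "C > 0" "\<forall>y\<in>cball (\<phi> p) r. \<forall>v. sqrt (g (U, \<phi>) (inv_into U \<phi> y) v v) \<le> C * norm v"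
    using metric_bounds[OF U(1) compact_cball r(2)] by blast
  define \<rho> where "\<rho> = min r (e / C)"
  define T where "T = {x\<in>U. \<phi> x \<in> ball (\<phi> p) \<rho>}"
  have "\<exists>L<e. joined p q L" if q: "q \<in> T" for q
  proof -
    have "C * dist (\<phi> p) (\<phi> q) < e" using q C(1) by (simp add: T_def \<rho>_def field_simps)
    moreover have "q \<in> U" "\<phi> q \<in> ball (\<phi> p) r" using q by (auto simp: T_def \<rho>_def)
    moreover obtain L where "L \<le> C * dist (\<phi> p) (\<phi> q)" "joined p q L"
      using chart_segment[OF U \<open>q \<in> U\<close> r(2) _ C(2)] calculation(3) by blast
    ultimately show ?thesis by (intro exI[of _ L]) simp
  qed
  moreover have "openin (top_of_set M) T" unfolding T_def by (rule chart_ball_openin[OF U(1)])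
  moreover have "p \<in> T" using U(2) r(1) e C(1) by (simp add: T_def \<rho>_def)
  ultimately show ?thesis by blast
qed

text \<open>A curve from \<open>p\<close> to \<open>q\<close> has to leave a small coordinate ball around \<open>p\<close>; up to the exit time
  its speed is bounded below by that of its coordinate representation.\<close>

lemma joined_lower_bound:
  assumes p: "p \<in> M" and q: "q \<in> M" and pq: "p \<noteq> q"
  shows "\<exists>e>0. \<forall>L. joined p q L \<longrightarrow> e \<le> L"
proof -
  obtain U \<phi> where U: "(U, \<phi>) \<in> A" "p \<in> U" using chart_cover[OF p] by blast
  obtain r0 where r0: "r0 > 0" "cball (\<phi> p) r0 \<subseteq> \<phi> ` U"
    using chart_open_image[OF U(1)] U(2) open_contains_cball by (metis imageI)
  \<comment> \<open>The radius is chosen such that \<open>q\<close> lies outside the open coordinate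
    ball \<open>W\<close>, whether or not \<open>q\<close> is in the chart.\<close>
  define r where "r = (if q \<in> U then min r0 (dist (\<phi> p) (\<phi> q)) else r0)"
  have "\<phi> p \<noteq> \<phi> q" if "q \<in> U" using pq that chart_inv[OF U(1)] U(2) by metis
  then have r: "r > 0" "cball (\<phi> p) r \<subseteq> \<phi> ` U" using r0 by (auto simp: r_def)
  define W where "W = {x\<in>U. \<phi> x \<in> ball (\<phi> p) r}"
  have qW: "q \<notin> W" and pW: "p \<in> W" using r(1) U(2) by (auto simp: W_def r_def)
  define K where "K = inv_into U \<phi> ` cball (\<phi> p) r"
  have "compact K" unfolding K_def
    by (rule compact_continuous_image[OF continuous_on_subset[OF chart_inv_cont[OF U(1)] r(2)] compact_cball])
  then have clK: "closed K" by (rule compact_imp_closed)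
  have KU: "x \<in> U" "\<phi> x \<in> cball (\<phi> p) r" if "x \<in> K" for x
    using that r(2) by (auto simp: K_def image_subset_iff subset_iff inv_into_into f_inv_into_f)
  have WK: "W \<subseteq> K"
  proof
    fix x assume "x \<in> W"
    then have "x = inv_into U \<phi> (\<phi> x)" "\<phi> x \<in> cball (\<phi> p) r"
      using chart_inv[OF U(1)] by (auto simp: W_def)
    then show "x \<in> K" unfolding K_def by (rule image_eqI)
  qed
  obtain O' where O': "open O'" "W = M \<inter> O'"
    using chart_ball_openin[OF U(1)] unfolding W_def[symmetric] by (metis openin_open W_def)
  obtain l where l: "l > 0" "\<forall>y\<in>cball (\<phi> p) r. \<forall>v. l * norm v \<le> sqrt (g (U, \<phi>) (inv_into U \<phi> y) v v)"
    using metric_bounds[OF U(1) compact_cball r(2)] by blast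
  have low: "l * norm v \<le> sqrt (g (U, \<phi>) x v v)" if "x \<in> K" for x v
    using l(2)[rule_format, OF KU(2)[OF that], of v] chart_inv[OF U(1) KU(1)[OF that]] by simp
  have "l * r \<le> len c 0 1" if c: "pcurve c 0 1" "c 0 = p" "c 1 = q" for c
  proof -
    note contc = pcurve_continuous[OF c(1)] and cM = pcurve_in[OF c(1)]
    define Z where "Z = {0..1} \<inter> c -` (- O')"
    have "closed Z" unfolding Z_def
      by (rule continuous_closed_preimage[OF contc]) (use O'(1) in auto)
    moreover have "1 \<in> Z" using qW c(3) q by (auto simp: Z_def O'(2))
    moreover have bdd: "bdd_below Z" by (rule bdd_belowI[of _ 0]) (simp add: Z_def)
    ultimately have "Inf Z \<in> Z" using closed_contains_Inf by blast
    \<comment> \<open>The first time at which the curve is outside \<open>W\<close>.\<close>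
    define s0 where "s0 = Inf Z"
    have "s0 \<in> Z" using \<open>Inf Z \<in> Z\<close> by (simp add: s0_def)
    then have s0Z: "s0 \<in> {0..1}" "c s0 \<notin> W" by (auto simp: Z_def O'(2))
    have "s0 \<noteq> 0" using s0Z(2) c(2) pW by auto
    then have s00: "0 < s0" "s0 \<le> 1" using s0Z(1) by auto
    have before: "c s \<in> W" if "s \<in> {0..<s0}" for s
    proof (rule ccontr)
      assume "c s \<notin> W"
      then have "s \<in> Z" using that s00 cM by (auto simp: Z_def O'(2) image_subset_iff)
      then have "s0 \<le> s" unfolding s0_def by (rule cInf_lower[OF _ bdd])
      then show False using that by simp
    qed
    have contc0: "continuous_on {0..s0} c" by (rule continuous_on_subset[OF contc]) (use s00 in auto)
    \<comment> \<open>\<open>K\<close> is compact, hence closed in the Hausdorff space. So the exit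
      point \<open>c s0\<close> still lies in the chart and, being outside \<open>W\<close>, has
      coordinate distance exactly \<open>r\<close> from \<open>p\<close>.\<close>
    have "closed ({0..s0} \<inter> c -` K)" by (rule continuous_closed_preimage[OF contc0 _ clK]) simp
    moreover have "{0..<s0} \<subseteq> {0..s0} \<inter> c -` K" using before WK by (force simp: subset_iff)
    ultimately have "closure {0..<s0} \<subseteq> {0..s0} \<inter> c -` K" by (metis closure_minimal)
    then have cK: "c s \<in> K" if "s \<in> {0..s0}" for s using that s00 by auto
    have n0: "norm (\<phi> (c s0) - \<phi> p) = r"
      using s0Z(2) KU[OF cK[of s0]] s00 by (auto simp: W_def dist_norm norm_minus_commute)
    \<comment> \<open>In the direction \<open>u\<close> of the exit point the coordinate of the
      curve grows by exactly \<open>r\<close> up to time \<open>s0\<close>, while the projected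
      velocity is at most the norm of the velocity.\<close>
    define u where "u = (\<phi> (c s0) - \<phi> p) /\<^sub>R r"
    have nu: "norm u = 1" using n0 r(1) by (simp add: u_def)
    define h where "h s = u \<bullet> \<phi> (c s)" for s
    define h' where "h' s = u \<bullet> vector_derivative (\<phi> \<circ> c) (at s)" for s
    obtain F where F: "finite F" "\<forall>s\<in>{0<..<1} - F. has_velocity_at c s"
      using pcurve_has_velocity[OF c(1)] by blast
    have vel: "((\<phi> \<circ> c) has_vector_derivative vector_derivative (\<phi> \<circ> c) (at s)) (at s)"
      if "s \<in> {0<..<s0} - F" for s
    proof -
      have "has_velocity_at c s" using F(2) that s00 by auto
      moreover have "c s \<in> U" using KU(1)[OF cK[of s]] that by auto
      ultimately show ?thesis using has_velocity_atD[OF _ U(1)] vector_derivative_works differentiableI_vector by metis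
    qed
    have "(h' has_integral (h s0 - h 0)) {0..s0}"
    proof (rule fundamental_theorem_of_calculus_interior_strong[OF F(1)])
      show "(h has_vector_derivative h' s) (at s)" if "s \<in> {0<..<s0} - F" for s
        using bounded_linear.has_vector_derivative[OF bounded_linear_inner_right vel[OF that], of u]
        unfolding h_def h'_def by (simp add: o_def)
      show "continuous_on {0..s0} h" unfolding h_def
        by (intro continuous_intros continuous_on_compose2[OF chart_cont[OF U(1)] contc0]) (use cK KU(1) in auto)
    qed (use s00 in simp)
    moreover have "h s0 - h 0 = r"
    proof -
      have "h s0 - h 0 = u \<bullet> (\<phi> (c s0) - \<phi> p)" by (simp add: h_def c(2) inner_diff_right)
      also have "\<dots> = u \<bullet> (r *\<^sub>R u)" using r(1) by (simp add: u_def)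
      also have "\<dots> = r" using nu by (simp add: power2_norm_eq_inner[symmetric])
      finally show ?thesis .
    qed
    ultimately have "(h' has_integral r) {0..s0}" by simp
    \<comment> \<open>Setting the integrand to zero at the exceptional times makes the comparison
      with the speed hold at every point of the interval.\<close>
    then have "((\<lambda>s. if s \<in> F \<union> {0, s0} then 0 else h' s) has_integral r) {0..s0}"
      by (rule has_integral_spike_finite[where S = "F \<union> {0, s0}", rotated 2]) (use F(1) in auto)
    then have I: "((\<lambda>s. l * (if s \<in> F \<union> {0, s0} then 0 else h' s)) has_integral l * r) {0..s0}"
      by (rule has_integral_mult_right)
    have pc0: "pcurve c 0 s0" using pcurve_sub[OF c(1), of 0 s0] s00 by simp
    have "l * r \<le> len c 0 s0"
    proof (rule has_integral_le[OF I integrable_integral[OF pcurve_speed_integrable[OF pc0]]])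
      fix s assume s: "s \<in> {0..s0}"
      have sp: "0 \<le> speed A g c s" using KU(1)[OF cK[OF s]] chart_subset[OF U(1)] by (intro speed_nonneg) auto
      show "l * (if s \<in> F \<union> {0, s0} then 0 else h' s) \<le> speed A g c s"
      proof (cases "s \<in> F \<union> {0, s0}")
        case False
        then have s': "s \<in> {0<..<s0} - F" "s \<in> {0<..<s0}" using s by auto
        have "h' s \<le> norm (vector_derivative (\<phi> \<circ> c) (at s))"
          unfolding h'_def using norm_cauchy_schwarz[of u] nu by simp
        then have "l * h' s \<le> l * norm (vector_derivative (\<phi> \<circ> c) (at s))" using l(1) by simp
        also have "\<dots> \<le> sqrt (g (U, \<phi>) (c s) (vector_derivative (\<phi> \<circ> c) (at s)) (vector_derivative (\<phi> \<circ> c) (at s)))"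
          by (rule low[OF cK[OF s]])
        also have "\<dots> = speed A g c s"
        proof (rule speed_eq[where c = c and s = s, symmetric, OF U(1) _ _ s'(2) KU(1)[OF cK[OF s]] vel[OF s'(1)]])
          show "continuous_on {0<..<s0} c" by (rule continuous_on_subset[OF contc0]) auto
          show "c ` {0<..<s0} \<subseteq> M" using pcurve_in[OF pc0] by (auto simp: image_subset_iff)
        qed
        finally show ?thesis using False by simp
      qed (use sp in simp)
    qed
    also have "\<dots> \<le> len c 0 1"
    proof (cases "s0 = 1")
      case False
      then have "pcurve c s0 1" using pcurve_sub[OF c(1), of s0 1] s00 by simp
      then show ?thesis using len_combine[OF c(1), of s0] s00 len_nonneg[of c s0 1] by simp
    qed simp
    finally show ?thesis .
  qed
  then show ?thesis using l(1) r(1) unfolding joined_def by (intro exI[of _ "l * r"]) auto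
qed

lemma joined_connected:
  assumes "connected M" "p \<in> M" "q \<in> M"
  shows "\<exists>L. joined p q L"
proof (rule connected_equivalence_relation[OF assms, where R = "\<lambda>p q. \<exists>L. joined p q L"])
  show "\<exists>T. openin (top_of_set M) T \<and> a \<in> T \<and> (\<forall>x\<in>T. \<exists>L. joined a x L)" if "a \<in> M" for a
    using joined_locally[OF that zero_less_one] by blast
qed (use joined_sym joined_trans in blast)+

end

section \<open>The Riemannian distance as a continuous metric\<close>

locale connected_riemannian = riemannian +
  assumes connected: "connected M"
begin

abbreviation "rdist \<equiv> riemannian_dist M A g"

lemma rdist_less_iff:
  assumes "p \<in> M" "q \<in> M"
  shows "rdist p q < e \<longleftrightarrow> (\<exists>L<e. joined p q L)"
proof -
  have "{L. joined p q L} \<noteq> {}" using joined_connected[OF connected assms] by blast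
  moreover have "bdd_below {L. joined p q L}" using joined_nonneg by (intro bdd_belowI[of _ 0]) auto
  ultimately show ?thesis unfolding riemannian_dist_eq by (subst cInf_less_iff) auto
qed

lemma rdist_le: "p \<in> M \<Longrightarrow> q \<in> M \<Longrightarrow> joined p q L \<Longrightarrow> rdist p q \<le> L"
  using rdist_less_iff by (meson dense_ge le_less_trans less_imp_le not_less order_refl)

lemma rdist_sym: "rdist p q = rdist q p"
proof -
  have "{L. joined p q L} = {L. joined q p L}" using joined_sym by blast
  then show ?thesis by (simp add: riemannian_dist_eq)
qed

lemma rdist_nonneg: "p \<in> M \<Longrightarrow> q \<in> M \<Longrightarrow> 0 \<le> rdist p q"
  using rdist_less_iff[of p q 0] joined_nonneg by force

lemma rdist_self: "p \<in> M \<Longrightarrow> rdist p p = 0"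
proof -
  assume p: "p \<in> M"
  have "rdist p p < e" if "e > 0" for e
    using joined_locally[OF p that] rdist_less_iff[OF p p] by blast
  with rdist_nonneg[OF p p] show ?thesis by (meson less_irrefl linorder_neqE_linordered_idom not_less)
qed

lemma rdist_pos: "p \<in> M \<Longrightarrow> q \<in> M \<Longrightarrow> p \<noteq> q \<Longrightarrow> 0 < rdist p q"
  using joined_lower_bound[of p q] rdist_less_iff[of p q] by (metis less_eq_real_def not_less rdist_nonneg)

lemma rdist_triangle:
  assumes "p \<in> M" "q \<in> M" "r \<in> M"
  shows "rdist p r \<le> rdist p q + rdist q r"
proof (rule field_le_epsilon)
  fix e :: real assume "e > 0"
  then have "rdist p q < rdist p q + e / 2" "rdist q r < rdist q r + e / 2" by simp_all
  then obtain L L' where "L < rdist p q + e / 2" "joined p q L" "L' < rdist q r + e / 2" "joined q r L'"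
    using rdist_less_iff assms by meson
  then show "rdist p r \<le> rdist p q + rdist q r + e"
    using rdist_le[OF assms(1,3) joined_trans[of p q L r L']] by simp
qed

text \<open>Points near \<open>x\<close> in the topology of \<open>M\<close> are joined to
  \<open>x\<close> by short curves, so the triangle inequality gives continuity in both
  arguments.\<close>

lemma rdist_continuous: "continuous_on (M \<times> M) (\<lambda>(x, y). rdist x y)"
  unfolding continuous_on_def
proof (clarify, rule tendstoI)
  fix x y and e :: real assume xy: "x \<in> M" "y \<in> M" and e: "0 < e"
  have nbhd: "\<exists>O'. open O' \<and> z \<in> O' \<and> (\<forall>w\<in>M \<inter> O'. rdist z w < e / 2)" if z: "z \<in> M" for z
  proof -
    obtain T where T: "openin (top_of_set M) T" "z \<in> T" "\<forall>q\<in>T. \<exists>L<e/2. joined z q L"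
      using joined_locally[OF z, of "e / 2"] e by auto
    obtain O' where O': "open O'" "T = M \<inter> O'" using T(1) by (metis openin_open)
    have "\<forall>w\<in>M \<inter> O'. rdist z w < e / 2" using T(3) rdist_less_iff[OF z] unfolding O'(2) by blast
    then show ?thesis using O' T(2) by blast
  qed
  obtain O1 O2 where O: "open O1" "x \<in> O1" "\<forall>w\<in>M \<inter> O1. rdist x w < e / 2"
    "open O2" "y \<in> O2" "\<forall>w\<in>M \<inter> O2. rdist y w < e / 2"
    using nbhd[OF xy(1)] nbhd[OF xy(2)] by metis
  have "dist (rdist x' y') (rdist x y) < e" if "x' \<in> M \<inter> O1" "y' \<in> M \<inter> O2" for x' y'
  proof -
    have M: "x' \<in> M" "y' \<in> M" using that by auto
    have "rdist x x' < e / 2" "rdist y y' < e / 2" using O that by blast+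
    moreover have "rdist x' y' \<le> rdist x x' + (rdist x y + rdist y y')"
      using rdist_triangle[OF M(1) xy(1) M(2)] rdist_triangle[OF xy M(2)] rdist_sym[of x' x] by linarith
    moreover have "rdist x y \<le> rdist x x' + (rdist x' y' + rdist y y')"
      using rdist_triangle[OF xy(1) M(1) xy(2)] rdist_triangle[OF M xy(2)] rdist_sym[of y' y] by linarith
    ultimately show ?thesis by (simp add: dist_real_def)
  qed
  then show "\<forall>\<^sub>F z in at (x, y) within M \<times> M. dist (case z of (x, y) \<Rightarrow> rdist x y) (rdist x y) < e"
    unfolding eventually_at_topological using O
    by (intro exI[of _ "O1 \<times> O2"]) (auto intro: open_Times)
qed

text \<open>\<open>F\<close> is the length run through up to time \<open>s\<close>. It records how a
  nearly minimal curve spends its length, and its continuity later allows cutting the curve at a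
  prescribed cost.\<close>

lemma rdist_curve:
  assumes "p \<in> M" "q \<in> M" "rdist p q < e"
  shows "\<exists>c F. path c \<and> path_image c \<subseteq> M \<and> pathstart c = p \<and> pathfinish c = q \<and>
           continuous_on {0..1} F \<and> F 0 = 0 \<and> F 1 < e \<and>
           (\<forall>s\<in>{0..1}. \<forall>s'\<in>{0..1}. s \<le> s' \<longrightarrow> rdist (c s) (c s') \<le> F s' - F s)"
proof -
  obtain c where c: "pcurve c 0 1" "c 0 = p" "c 1 = q" "len c 0 1 < e"
    using assms rdist_less_iff unfolding joined_def by blast
  have cM: "c s \<in> M" if "s \<in> {0..1}" for s using pcurve_in[OF c(1)] that by auto
  have "rdist (c s) (c s') \<le> len c 0 s' - len c 0 s" if s: "s \<in> {0..1}" "s' \<in> {0..1}" "s \<le> s'" for s s'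
  proof (cases "s = s'")
    case True
    then show ?thesis using rdist_self cM s by simp
  next
    case False
    then have ss': "pcurve c s s'" using pcurve_sub[OF c(1), of s s'] s by auto
    have "len c 0 s + len c s s' = len c 0 s'"
      using pcurve_sub[OF c(1), of 0 s'] s False by (intro len_combine) auto
    then show ?thesis using rdist_le[OF cM cM joined_pcurve(1)[OF ss']] s by simp
  qed
  moreover have "continuous_on {0..1} (\<lambda>s. len c 0 s)"
    by (rule indefinite_integral_continuous_1[OF pcurve_speed_integrable[OF c(1)]])
  ultimately show ?thesis
    using c pcurve_basics[OF c(1)] unfolding path_def path_image_def pathstart_def pathfinish_def
    by (intro exI[of _ c] exI[of _ "\<lambda>s. len c 0 s"]) simp
qed

end

section \<open>Finite presentations\<close>

text \<open>Products of classes are defined as unions over all representatives, both for presented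
  groups and for \<theta>-loops; this evaluates such a union once its members are known to
  coincide.\<close>

lemma UN2_const:
  "(\<And>x y. x \<in> P \<Longrightarrow> y \<in> Q \<Longrightarrow> F x y = C) \<Longrightarrow> a \<in> P \<Longrightarrow> b \<in> Q \<Longrightarrow> (\<Union>x\<in>P. \<Union>y\<in>Q. F x y) = C"
  by blast

lemma words_append [simp]: "u @ v \<in> words X \<longleftrightarrow> u \<in> words X \<and> v \<in> words X"
  by (auto simp: words_def)

lemma words_Nil [simp]: "[] \<in> words X"
  by (simp add: words_def)

lemma word_step_context:
  assumes "word_step X R u v" "a \<in> words X" "b \<in> words X"
  shows "word_step X R (a @ u @ b) (a @ v @ b)"
  using assms
proof (induction rule: word_step.induct)
  case (relator u v r)
  then show ?case using word_step.relator[of "a @ u" X "v @ b" r R] by simp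
next
  case (cancel u v c e)
  then show ?case using word_step.cancel[of "a @ u" X "v @ b" c R e] by simp
qed

lemma equivclp_context:
  assumes "equivclp r u v" and "\<And>u v. r u v \<Longrightarrow> r (f u) (f v)"
  shows "equivclp r (f u) (f v)"
  using assms(1)
proof (induction rule: equivclp_induct)
  case (step y z)
  then show ?case using assms(2) by (metis converse_r_into_equivclp equivclp_trans r_into_equivclp)
qed simp

lemma equiv_word_rel: "equiv (words X) (word_rel X R)"
proof (rule equivI)
  show "refl_on (words X) (word_rel X R)" "word_rel X R \<subseteq> words X \<times> words X"
    by (auto simp: refl_on_def word_rel_def)
  show "sym (word_rel X R)" by (auto simp: sym_def word_rel_def intro: equivclp_sym)
  show "trans (word_rel X R)" by (auto simp: trans_def word_rel_def intro: equivclp_trans)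
qed

lemma word_rel_append:
  assumes "(u, u') \<in> word_rel X R" "(v, v') \<in> word_rel X R"
  shows "(u @ v, u' @ v') \<in> word_rel X R"
proof -
  have w: "u \<in> words X" "u' \<in> words X" "v \<in> words X" "v' \<in> words X"
    using assms by (auto simp: word_rel_def)
  have "equivclp (word_step X R) (u @ v) (u' @ v)"
    using assms(1) w word_step_context[where a = "[]" and b = v and X = X]
    by (intro equivclp_context[where f = "\<lambda>u. u @ v"]) (auto simp: word_rel_def)
  moreover have "equivclp (word_step X R) (u' @ v) (u' @ v')"
    using assms(2) w word_step_context[where a = u' and b = "[]" and X = X]
    by (intro equivclp_context[where f = "\<lambda>v. u' @ v"]) (auto simp: word_rel_def)
  ultimately show ?thesis using w by (auto simp: word_rel_def intro: equivclp_trans)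
qed

lemma presented_group_mult:
  assumes "u \<in> words X" "v \<in> words X"
  shows "word_rel X R `` {u} \<otimes>\<^bsub>presented_group X R\<^esub> word_rel X R `` {v} = word_rel X R `` {u @ v}"
proof -
  have eq: "word_rel X R `` {u' @ v'} = word_rel X R `` {u @ v}"
    if "u' \<in> word_rel X R `` {u}" "v' \<in> word_rel X R `` {v}" for u' v'
    using that word_rel_append[of u u' X R v v'] equiv_class_eq[OF equiv_word_rel] by force
  have "u \<in> word_rel X R `` {u}" "v \<in> word_rel X R `` {v}"
    using assms equiv_class_self[OF equiv_word_rel] by blast+
  from UN2_const[OF eq this] show ?thesis by (simp add: presented_group_def)
qed

section \<open>Words over a generating set and change of presentation\<close>

context group
begin

definition lprod :: "'a list \<Rightarrow> 'a" where
  "lprod w = foldr (\<otimes>) w \<one>"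

lemma lprod_simps [simp]: "lprod [] = \<one>" "lprod (s # w) = s \<otimes> lprod w"
  by (simp_all add: lprod_def)

lemma lprod_closed [simp]: "w \<in> lists (carrier G) \<Longrightarrow> lprod w \<in> carrier G"
  by (induction w) auto

lemma lprod_append [simp]:
  "u \<in> lists (carrier G) \<Longrightarrow> v \<in> lists (carrier G) \<Longrightarrow> lprod (u @ v) = lprod u \<otimes> lprod v"
  by (induction u) (auto simp: m_assoc)

lemma generate_lprod:
  assumes "g \<in> generate G S" "S \<subseteq> carrier G"
  shows "\<exists>w\<in>lists (S \<union> m_inv G ` S). lprod w = g"
  using assms(1)
proof (induction rule: generate.induct)
  case one
  then show ?case by (intro bexI[of _ "[]"]) auto
next
  case (incl h)
  then show ?case using assms(2) by (intro bexI[of _ "[h]"]) auto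
next
  case (inv h)
  then show ?case using assms(2) by (intro bexI[of _ "[inv h]"]) auto
next
  case (eng h1 h2)
  then obtain u v where "u \<in> lists (S \<union> m_inv G ` S)" "v \<in> lists (S \<union> m_inv G ` S)"
    "lprod u = h1" "lprod v = h2" by blast
  moreover have "lists (S \<union> m_inv G ` S) \<subseteq> lists (carrier G)" using assms(2) by (intro lists_mono) auto
  ultimately show ?case by (intro bexI[of _ "u @ v"]) (auto simp: subset_iff)
qed

text \<open>\<open>val u\<close> is the element of \<open>G\<close> represented by the word
  \<open>u\<close> under a fixed isomorphism. With the listed properties the quotient construction
  can be left behind.\<close>

lemma presentation_valuation:
  assumes "finitely_presented G"
  obtains X R val where "finite X" "finite R" "R \<subseteq> words X"
    "\<And>u. u \<in> words X \<Longrightarrow> val u \<in> carrier G"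
    "val [] = \<one>"
    "\<And>u v. u \<in> words X \<Longrightarrow> v \<in> words X \<Longrightarrow> val (u @ v) = val u \<otimes> val v"
    "\<And>u v. u \<in> words X \<Longrightarrow> v \<in> words X \<Longrightarrow> word_step X R u v \<Longrightarrow> val u = val v"
    "\<And>u. u \<in> words X \<Longrightarrow> val u = \<one> \<Longrightarrow> equivclp (word_step X R) u []"
    "\<And>x. x \<in> carrier G \<Longrightarrow> \<exists>u\<in>words X. val u = x"
proof -
  obtain X R f where X: "finite X" "finite R" "R \<subseteq> words X" and f: "f \<in> iso G (presented_group X R)"
    using assms unfolding finitely_presented_def is_iso_def by blast
  let ?P = "presented_group X R"
  have carr: "carrier ?P = words X // word_rel X R" by (simp add: presented_group_def)
  have bij: "bij_betw f (carrier G) (carrier ?P)" and hom: "f \<in> hom G ?P" using f by (auto simp: iso_def)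
  define cls where "cls u = word_rel X R `` {u}" for u
  define val where "val u = inv_into (carrier G) f (cls u)" for u
  have cls: "cls u \<in> carrier ?P" if "u \<in> words X" for u
    using that by (simp add: carr cls_def quotientI)
  have val: "val u \<in> carrier G" "f (val u) = cls u" if "u \<in> words X" for u
    unfolding val_def using bij cls[OF that]
    by (auto simp: bij_betw_def inv_into_into f_inv_into_f)
  have mult: "val (u @ v) = val u \<otimes> val v" if "u \<in> words X" "v \<in> words X" for u v
  proof (rule inj_onD[OF bij_betw_imp_inj_on[OF bij]])
    have "f (val u \<otimes> val v) = cls u \<otimes>\<^bsub>?P\<^esub> cls v" using hom val that by (simp add: hom_mult)
    also have "\<dots> = cls (u @ v)" unfolding cls_def by (rule presented_group_mult[OF that])
    finally show "f (val (u @ v)) = f (val u \<otimes> val v)" using val that by simp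
  qed (use val that in auto)
  have "val [] = val [] \<otimes> val []" using mult[of "[]" "[]"] by simp
  then have one: "val [] = \<one>" using val(1)[of "[]"] by (metis r_cancel_one' words_Nil)
  have step: "val u = val v" if "u \<in> words X" "v \<in> words X" "word_step X R u v" for u v
  proof -
    have "(u, v) \<in> word_rel X R" using that by (auto simp: word_rel_def)
    then show ?thesis by (simp add: val_def cls_def equiv_class_eq[OF equiv_word_rel])
  qed
  have ker: "equivclp (word_step X R) u []" if "u \<in> words X" "val u = \<one>" for u
  proof -
    have "cls u = cls []" using val(2)[OF that(1)] val(2)[of "[]"] that(2) one by simp
    then have "(u, []) \<in> word_rel X R"
      using eq_equiv_class_iff[OF equiv_word_rel that(1), of "[]" R] by (simp add: cls_def)
    then show ?thesis by (simp add: word_rel_def)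
  qed
  have surj: "\<exists>u\<in>words X. val u = x" if "x \<in> carrier G" for x
  proof -
    have "f x \<in> words X // word_rel X R" using bij that carr by (auto simp: bij_betw_def)
    then obtain u where "u \<in> words X" "f x = cls u" unfolding cls_def by (rule quotientE)
    then show ?thesis using bij that by (auto simp: val_def bij_betw_def intro!: bexI[of _ u] dest: sym)
  qed
  show thesis using that[OF X val(1) one mult step ker surj] .
qed

text \<open>An application of a relator over a subset \<open>T\<close> of the group itself, without
  a list of relators: any word of length at most \<open>K\<close> with product one may be
  removed.\<close>

definition deletion :: "'a set \<Rightarrow> nat \<Rightarrow> 'a list \<Rightarrow> 'a list \<Rightarrow> bool" where
  "deletion T K w w' \<longleftrightarrow> (\<exists>u r v. u \<in> lists T \<and> r \<in> lists T \<and> v \<in> lists T \<and>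
     lprod r = \<one> \<and> length r \<le> K \<and> w = u @ r @ v \<and> w' = u @ v)"

lemma deletion_context:
  assumes "deletion T K w w'" "a \<in> lists T" "b \<in> lists T"
  shows "deletion T K (a @ w @ b) (a @ w' @ b)"
proof -
  obtain u r v where "u \<in> lists T" "r \<in> lists T" "v \<in> lists T" "lprod r = \<one>" "length r \<le> K" "w = u @ r @ v" "w' = u @ v"
    using assms(1) unfolding deletion_def by blast
  then show ?thesis
    unfolding deletion_def using assms(2,3) by (intro exI[of _ "a @ u"] exI[of _ r] exI[of _ "v @ b"]) simp
qed

lemma equivclp_deletion_append:
  assumes "equivclp (deletion T K) u u'" "a \<in> lists T" "b \<in> lists T"
  shows "equivclp (deletion T K) (a @ u @ b) (a @ u' @ b)"
  by (rule equivclp_context[OF assms(1)]) (rule deletion_context[OF _ assms(2,3)])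

text \<open>A change of generators. Letters of the presentation are rewritten as words over
  \<open>T\<close> by \<sigma> and elements of \<open>T\<close> as words over \<open>X\<close> by
  \<tau>, which carries a derivation over \<open>X\<close> to one over \<open>T\<close>. The
  relators used are the images of \<open>R\<close>, the images of the cancellations and the words
  \<open>inv s # \<sigma> (\<tau> s)\<close>; being finitely many, they have bounded length.\<close>

lemma bounded_relations:
  assumes "finitely_presented G" and T: "finite T" "T \<subseteq> carrier G" "\<And>s. s \<in> T \<Longrightarrow> inv s \<in> T"
    and gen: "\<And>x. x \<in> carrier G \<Longrightarrow> \<exists>w\<in>lists T. lprod w = x"
  shows "\<exists>K. \<forall>w\<in>lists T. lprod w = \<one> \<longrightarrow> equivclp (deletion T K) w []"
proof -
  from assms(1) obtain X R val where X: "finite X" "finite R" "R \<subseteq> words X"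
    and val: "\<And>u. u \<in> words X \<Longrightarrow> val u \<in> carrier G"
    "val [] = \<one>"
    "\<And>u v. u \<in> words X \<Longrightarrow> v \<in> words X \<Longrightarrow> val (u @ v) = val u \<otimes> val v"
    "\<And>u v. u \<in> words X \<Longrightarrow> v \<in> words X \<Longrightarrow> word_step X R u v \<Longrightarrow> val u = val v"
    "\<And>u. u \<in> words X \<Longrightarrow> val u = \<one> \<Longrightarrow> equivclp (word_step X R) u []"
    "\<And>x. x \<in> carrier G \<Longrightarrow> \<exists>u\<in>words X. val u = x"
    by (rule presentation_valuation) blast
  have LT: "w \<in> lists (carrier G)" if "w \<in> lists T" for w using that T(2) lists_mono by blast
  have "\<forall>l\<in>X \<times> UNIV. \<exists>w. w \<in> lists T \<and> lprod w = val [l]"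
  proof
    fix l :: "nat \<times> bool" assume "l \<in> X \<times> UNIV"
    then have "val [l] \<in> carrier G" by (intro val(1)) (simp add: words_def)
    then show "\<exists>w. w \<in> lists T \<and> lprod w = val [l]" using gen by blast
  qed
  from bchoice[OF this] obtain \<sigma>0 where
    "\<forall>l\<in>X \<times> UNIV. \<sigma>0 l \<in> lists T \<and> lprod (\<sigma>0 l) = val [l]" by (elim exE)
  note \<sigma>0 = bspec[OF this]
  have "\<forall>s\<in>T. \<exists>u. u \<in> words X \<and> val u = s" using val(6) T(2) by blast
  from bchoice[OF this] obtain \<tau> where
    "\<forall>s\<in>T. \<tau> s \<in> words X \<and> val (\<tau> s) = s" by (elim exE)
  note \<tau> = bspec[OF this]
  define \<sigma> where "\<sigma> u = concat (map \<sigma>0 u)" for u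
  have \<sigma>: "\<sigma> u \<in> lists T \<and> lprod (\<sigma> u) = val u" if "u \<in> words X" for u
    using that
  proof (induction u)
    case (Cons l u)
    then have l: "l \<in> X \<times> UNIV" "[l] \<in> words X" "u \<in> words X" by (auto simp: words_def)
    have "val (l # u) = val [l] \<otimes> val u" using val(3)[OF l(2,3)] by simp
    then show ?case using Cons.IH[OF l(3)] \<sigma>0[OF l(1)] LT by (auto simp: \<sigma>_def)
  qed (simp add: \<sigma>_def val(2))
  have \<sigma>_append: "\<sigma> (u @ v) = \<sigma> u @ \<sigma> v" for u v by (simp add: \<sigma>_def)
  define Q where "Q = \<sigma> ` R \<union> (\<lambda>(a, b). \<sigma> [(a, b), (a, \<not> b)]) ` (X \<times> UNIV) \<union> (\<lambda>s. inv s # \<sigma> (\<tau> s)) ` T"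
  have "finite Q" unfolding Q_def using X T(1) by simp
  \<comment> \<open>The 2 admits the deletion of \<open>[s, inv s]\<close>.\<close>
  define K where "K = Max (insert 2 (length ` Q))"
  have K: "length q \<le> K" if "q \<in> Q" for q
    using \<open>finite Q\<close> that by (auto simp: K_def)
  have K2: "2 \<le> K" using \<open>finite Q\<close> by (simp add: K_def)
  have del: "equivclp (deletion T K) (u @ r @ v) (u @ v)"
    if "u \<in> lists T" "r \<in> lists T" "v \<in> lists T" "lprod r = \<one>" "length r \<le> K" for u r v
    using that unfolding deletion_def by (intro r_into_equivclp) blast
  have step: "equivclp (deletion T K) (\<sigma> u) (\<sigma> v)" if "word_step X R u v" for u v
    using that
  proof (induction rule: word_step.induct)
    case (relator u v r)
    have r: "r \<in> words X" using relator X(3) by blast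
    have "val r = val []" using word_step.relator[of "[]" X "[]" r R] relator(3) r by (intro val(4)) auto
    then show ?case unfolding \<sigma>_append
      using \<sigma> relator r K[of "\<sigma> r"] val(2) by (intro del) (auto simp: Q_def)
  next
    case (cancel u v a b)
    have r: "[(a, b), (a, \<not> b)] \<in> words X" using cancel by (simp add: words_def)
    have "val [(a, b), (a, \<not> b)] = val []"
      using word_step.cancel[of "[]" X "[]" a R b] cancel(3) r by (intro val(4)) auto
    moreover have "\<sigma> [(a, b), (a, \<not> b)] \<in> Q" using cancel(3) by (force simp: Q_def)
    ultimately show ?case unfolding \<sigma>_append
      using \<sigma>[OF r] \<sigma>[OF cancel(1)] \<sigma>[OF cancel(2)] K val(2) by (intro del) auto
  qed
  have steps: "equivclp (deletion T K) (\<sigma> u) (\<sigma> v)" if "equivclp (word_step X R) u v" for u v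
    using that
  proof (induction rule: equivclp_induct)
    case (step y z)
    then show ?case using \<open>\<And>u v. word_step X R u v \<Longrightarrow> equivclp (deletion T K) (\<sigma> u) (\<sigma> v)\<close>
      by (metis equivclp_sym equivclp_trans)
  qed simp
  have subst_letters: "equivclp (deletion T K) w (\<sigma> (concat (map \<tau> w)))" if "w \<in> lists T" for w
    using that
  proof (induction w)
    case (Cons s w)
    then have s: "s \<in> T" and w: "w \<in> lists T" by auto
    have st: "\<sigma> (\<tau> s) \<in> lists T" "lprod (\<sigma> (\<tau> s)) = s" using \<sigma> \<tau>[OF s] by auto
    have sc: "s \<in> carrier G" using s T(2) by blast
    have q: "inv s # \<sigma> (\<tau> s) \<in> Q" using s by (simp add: Q_def)
    \<comment> \<open>Inserting \<open>inv s # \<sigma> (\<tau> s)\<close> after the letter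
      \<open>s\<close> and then cancelling \<open>s\<close> with its inverse replaces the letter by
      \<open>\<sigma> (\<tau> s)\<close>.\<close>
    have "equivclp (deletion T K) ([s] @ (inv s # \<sigma> (\<tau> s)) @ w) ([s] @ w)"
      by (rule del) (use s w st T(3) sc K[OF q] in auto)
    moreover have "equivclp (deletion T K) ([] @ [s, inv s] @ (\<sigma> (\<tau> s) @ w)) ([] @ (\<sigma> (\<tau> s) @ w))"
      by (rule del) (use s w st T(3) sc K2 in auto)
    moreover have "equivclp (deletion T K) (\<sigma> (\<tau> s) @ w @ []) (\<sigma> (\<tau> s) @ \<sigma> (concat (map \<tau> w)) @ [])"
      using Cons.IH w st(1) by (intro equivclp_deletion_append) simp_all
    ultimately show ?case by (simp add: \<sigma>_append) (metis equivclp_sym equivclp_trans)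
  qed (simp add: \<sigma>_def)
  have "equivclp (deletion T K) w []" if w: "w \<in> lists T" "lprod w = \<one>" for w
  proof -
    have "concat (map \<tau> w) \<in> words X \<and> val (concat (map \<tau> w)) = lprod w"
      using w(1) by (induction w) (auto simp: val \<tau>)
    then have "equivclp (deletion T K) (\<sigma> (concat (map \<tau> w))) (\<sigma> [])"
      using w(2) by (intro steps val(5)) auto
    then have "equivclp (deletion T K) (\<sigma> (concat (map \<tau> w))) []" by (simp add: \<sigma>_def)
    with subst_letters[OF w(1)] show ?thesis by (rule equivclp_trans)
  qed
  then show ?thesis by blast
qed

end

section \<open>Discrete homotopies and holonomy\<close>

locale theta_space = Metric_space Z \<rho> for Z :: "'a set" and \<rho> +
  fixes \<theta> :: real
  assumes theta_pos: "0 < \<theta>"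
begin

abbreviation "adj x y \<equiv> \<rho> x y \<le> \<theta>"

abbreviation "paths \<equiv> theta_paths \<theta> Z \<rho>"

lemma paths_iff: "zs \<in> paths \<longleftrightarrow> zs \<noteq> [] \<and> set zs \<subseteq> Z \<and> successively adj zs"
  by (auto simp: theta_paths_def successively_conv_nth)

lemma theta_nonneg [simp]: "0 \<le> \<theta>"
  using theta_pos by simp

lemma adj_refl: "x \<in> Z \<Longrightarrow> adj x x"
  by simp

text \<open>Unlike general lazifications and grid homotopies, these two moves visibly extend to longer paths,
  and they generate enough of the homotopy relation.\<close>

definition row :: "'a list \<Rightarrow> 'a list \<Rightarrow> bool" where
  "row zs ws \<longleftrightarrow> zs \<in> paths \<and> ws \<in> paths \<and> hd zs = hd ws \<and> last zs = last ws \<and> list_all2 adj zs ws"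

definition stutter :: "'a list \<Rightarrow> 'a list \<Rightarrow> bool" where
  "stutter zs ws \<longleftrightarrow> zs \<in> paths \<and> (\<exists>us x vs. zs = us @ [x] @ vs \<and> ws = us @ [x, x] @ vs)"

abbreviation "sim \<equiv> equivclp (\<lambda>zs ws. row zs ws \<or> stutter zs ws)"

lemma sim_trans [trans]: "sim a b \<Longrightarrow> sim b c \<Longrightarrow> sim a c"
  by (rule equivclp_trans)

lemma sim_sym: "sim a b \<Longrightarrow> sim b a"
  by (rule equivclp_sym)

lemma row_sim: "row a b \<Longrightarrow> sim a b"
  by (auto intro: r_into_equivclp)

lemma stutter_paths: "stutter zs ws \<Longrightarrow> ws \<in> paths"
  by (auto simp: stutter_def paths_iff successively_append_iff)

lemma move_ends:
  assumes "row zs ws \<or> stutter zs ws"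
  shows "zs \<in> paths" "ws \<in> paths" "hd zs = hd ws" "last zs = last ws"
  using assms stutter_paths[of zs ws] by (auto simp: row_def) (auto simp: stutter_def hd_append)

lemma sim_ends:
  assumes "sim zs ws" "zs \<in> paths"
  shows "ws \<in> paths \<and> hd ws = hd zs \<and> last ws = last zs"
  using assms(1)
proof (induction rule: equivclp_induct)
  case (step y z)
  then show ?case using move_ends[of y z] move_ends[of z y] by auto
qed (use assms in simp)

lemma path_context:
  assumes "as @ zs @ bs \<in> paths" "zs \<in> paths" "ws \<in> paths" "hd zs = hd ws" "last zs = last ws"
  shows "as @ ws @ bs \<in> paths"
  using assms by (auto simp: paths_iff successively_append_iff)

lemma move_context:
  assumes "row zs ws \<or> stutter zs ws" "as @ zs @ bs \<in> paths"
  shows "row (as @ zs @ bs) (as @ ws @ bs) \<or> stutter (as @ zs @ bs) (as @ ws @ bs)"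
  using assms(1)
proof
  assume r: "row zs ws"
  then have ne: "zs \<noteq> []" "ws \<noteq> []" by (auto simp: row_def paths_iff)
  have "list_all2 adj as as" "list_all2 adj bs bs"
    using assms(2) by (auto simp: paths_iff intro!: list.rel_refl_strong adj_refl)
  then have "list_all2 adj (as @ zs @ bs) (as @ ws @ bs)"
    using r by (auto simp: row_def intro: list_all2_appendI)
  moreover have "as @ ws @ bs \<in> paths" using path_context[OF assms(2)] r by (auto simp: row_def)
  ultimately show ?thesis using r assms(2) ne by (auto simp: row_def hd_append last_append)
next
  assume "stutter zs ws"
  then obtain us x vs where "zs = us @ [x] @ vs" "ws = us @ [x, x] @ vs" by (auto simp: stutter_def)
  then have "as @ zs @ bs = (as @ us) @ [x] @ (vs @ bs)" "as @ ws @ bs = (as @ us) @ [x, x] @ (vs @ bs)" by simp_all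
  then have "stutter (as @ zs @ bs) (as @ ws @ bs)" unfolding stutter_def using assms(2) by blast
  then show ?thesis ..
qed

text \<open>Moves keep both end points, so each path of the derivation can be inserted between
  \<open>as\<close> and \<open>bs\<close>.\<close>

lemma sim_context:
  assumes "sim zs ws" "zs \<in> paths" "as @ zs @ bs \<in> paths"
  shows "sim (as @ zs @ bs) (as @ ws @ bs)"
  using assms(1)
proof (induction rule: equivclp_induct)
  case (step y z)
  have y: "y \<in> paths" "hd y = hd zs" "last y = last zs" using sim_ends[OF step(1) assms(2)] by auto
  have asy: "as @ y @ bs \<in> paths" using path_context[OF assms(3,2) y(1)] y by simp
  have asz: "as @ z @ bs \<in> paths"
    using path_context[OF asy y(1), of z] step(2) move_ends[of y z] move_ends[of z y] by metis
  from step(2) have yz: "sim (as @ y @ bs) (as @ z @ bs)"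
  proof
    assume "row y z \<or> stutter y z"
    then show ?thesis using move_context[OF _ asy] by (intro r_into_equivclp) blast
  next
    assume "row z y \<or> stutter z y"
    then show ?thesis using move_context[OF _ asz] by (intro converse_r_into_equivclp) blast
  qed
  show ?case by (rule sim_trans[OF step.IH yz])
qed simp

lemma sim_context_left:
  "sim zs ws \<Longrightarrow> zs \<in> paths \<Longrightarrow> as @ zs \<in> paths \<Longrightarrow> sim (as @ zs) (as @ ws)"
  using sim_context[of zs ws as "[]"] by simp

lemma sim_context_right:
  "sim zs ws \<Longrightarrow> zs \<in> paths \<Longrightarrow> zs @ bs \<in> paths \<Longrightarrow> sim (zs @ bs) (ws @ bs)"
  using sim_context[of zs ws "[]" bs] by simp

lemma sim_stutter:
  "us @ [x] @ vs \<in> paths \<Longrightarrow> sim (us @ [x] @ vs) (us @ [x, x] @ vs)"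
  by (rule r_into_equivclp) (auto simp: stutter_def)

text \<open>Listing the common end point twice is one stutter. Homotopies can therefore be written
  with plain concatenation, although the group multiplication uses \<open>tl\<close>.\<close>

lemma sim_joint:
  assumes "zs \<in> paths" "ws \<in> paths" "last zs = hd ws"
  shows "sim (zs @ ws) (zs @ tl ws)" "zs @ tl ws \<in> paths" "zs @ ws \<in> paths"
proof -
  obtain zs' x where zs: "zs = zs' @ [x]" using assms(1) by (metis paths_iff append_butlast_last_id)
  obtain ws' where ws: "ws = x # ws'" using assms zs by (cases ws) (auto simp: paths_iff)
  have "hd ws \<in> Z" using assms(2) by (auto simp: paths_iff)
  then show "zs @ ws \<in> paths" using assms by (auto simp: paths_iff successively_append_iff)
  show p: "zs @ tl ws \<in> paths" using assms zs ws by (auto simp: paths_iff successively_append_iff successively_Cons)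
  then show "sim (zs @ ws) (zs @ tl ws)" using sim_sym[OF sim_stutter[of zs' x ws']] zs ws by simp
qed

lemma sim_replicate: "x \<in> Z \<Longrightarrow> sim [x] (replicate (Suc n) x)"
proof (induction n)
  case (Suc n)
  have "replicate (Suc n) x \<in> paths" using Suc.prems
    by (simp add: paths_iff successively_conv_nth del: replicate_Suc)
  then have "sim (replicate (Suc n) x) (replicate (Suc (Suc n)) x)"
    using sim_stutter[of "[]" x "replicate n x"] by simp
  with Suc.IH[OF Suc.prems] show ?case by (rule sim_trans)
qed simp

text \<open>Repeating \<open>a\<close> turns \<open>[a, c]\<close> into \<open>[a, a, c]\<close>,
  and one row move takes the second \<open>a\<close> to \<open>b\<close>. So \<theta>-small
  triangles can be filled.\<close>

lemma sim_triangle: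
  assumes "us @ [a, b, c] @ vs \<in> paths" "adj a c"
  shows "sim (us @ [a, c] @ vs) (us @ [a, b, c] @ vs)"
proof -
  have Z: "a \<in> Z" "b \<in> Z" "c \<in> Z" and ab: "adj a b" "adj b c" using assms(1) by (auto simp: paths_iff successively_append_iff)
  have p: "[a, c] \<in> paths" "[a, a, c] \<in> paths" "[a, b, c] \<in> paths" using Z ab assms(2) by (auto simp: paths_iff)
  have "sim [a, c] [a, a, c]" using sim_stutter[of "[]" a "[c]"] p by simp
  moreover have "row [a, a, c] [a, b, c]" using p Z ab by (auto simp: row_def)
  ultimately have "sim [a, c] [a, b, c]" by (blast intro: row_sim sim_trans)
  moreover have "us @ [a, c] @ vs \<in> paths" using path_context[OF assms(1) p(3,1)] by simp
  ultimately show ?thesis by (intro sim_context p(1))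
qed

lemma path_dist:
  assumes "zs \<in> paths" "i < length zs" "j < length zs"
  shows "\<rho> (zs ! i) (zs ! j) \<le> \<theta> * \<bar>real i - real j\<bar>"
proof -
  have *: "\<rho> (zs ! i) (zs ! (i + k)) \<le> \<theta> * real k" if "i + k < length zs" for i k
    using that
  proof (induction k)
    case 0
    then have "zs ! i \<in> Z" using assms(1) by (auto simp: paths_iff)
    then show ?case by simp
  next
    case (Suc k)
    have Z: "zs ! i \<in> Z" "zs ! (i + k) \<in> Z" "zs ! Suc (i + k) \<in> Z" using Suc.prems assms(1) by (auto simp: paths_iff)
    have "\<rho> (zs ! (i + k)) (zs ! Suc (i + k)) \<le> \<theta>"
      using Suc.prems assms(1) by (auto simp: theta_paths_def)
    then show ?case using triangle[OF Z] Suc by (simp add: algebra_simps)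
  qed
  show ?thesis
  proof (cases "i \<le> j")
    case True
    then show ?thesis using *[of i "j - i"] assms(3) by (simp add: of_nat_diff)
  next
    case False
    then show ?thesis using *[of j "i - j"] assms(2) by (simp add: of_nat_diff commute)
  qed
qed

text \<open>A grid with \<open>m = 1\<close>. The Lipschitz bound between the two rows follows by
  going along \<open>zs\<close> and then changing the row once.\<close>

lemma row_grid_homotopic:
  assumes "row zs ws"
  shows "grid_homotopic \<theta> Z \<rho> zs ws"
proof -
  have p: "zs \<in> paths" "ws \<in> paths" "hd zs = hd ws" "last zs = last ws" "length zs = length ws"
    and vert: "\<And>i. i < length zs \<Longrightarrow> adj (zs ! i) (ws ! i)"
    using assms by (auto simp: row_def list_all2_conv_all_nth)
  have ne: "zs \<noteq> []" "ws \<noteq> []" using p by (auto simp: paths_iff)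
  define n where "n = length zs - 1"
  have n: "length zs = Suc n" "length ws = Suc n" using ne p(5) by (auto simp: n_def)
  define H where "H i j = (if j = 0 then zs ! i else ws ! i)" for i and j :: nat
  have HZ: "zs ! i \<in> Z" "ws ! i \<in> Z" if "i \<le> n" for i
    using p(1,2) n that by (auto simp: paths_iff)
  have zw: "\<rho> (zs ! i) (ws ! i') \<le> \<theta> * (\<bar>real i - real i'\<bar> + 1)" if "i \<le> n" "i' \<le> n" for i i'
  proof -
    have "\<rho> (zs ! i) (ws ! i') \<le> \<rho> (zs ! i) (zs ! i') + \<rho> (zs ! i') (ws ! i')"
      using triangle HZ that by blast
    also have "\<dots> \<le> \<theta> * \<bar>real i - real i'\<bar> + \<theta>"
      using path_dist[OF p(1), of i i'] vert[of i'] that n by (intro add_mono) auto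
    finally show ?thesis by (simp add: algebra_simps)
  qed
  have "\<rho> (H i j) (H i' j') \<le> \<theta> * (\<bar>real i - real i'\<bar> + \<bar>real j - real j'\<bar>)"
    if "i \<le> n" "j \<le> 1" "i' \<le> n" "j' \<le> 1" for i j i' j'
  proof -
    have "j = 0 \<or> j = 1" "j' = 0 \<or> j' = 1" using that by auto
    then show ?thesis
      using path_dist[OF p(1), of i i'] path_dist[OF p(2), of i i'] zw[of i i'] zw[of i' i] that n
      by (auto simp: H_def commute[of "ws ! i"] abs_minus_commute)
  qed
  moreover have "H 0 j = H 0 0" "H n j = H n 0" if "j \<le> 1" for j
    using p(3,4) ne n by (auto simp: H_def hd_conv_nth last_conv_nth)
  ultimately show ?thesis
    unfolding grid_homotopic_def using n HZ
    by (intro exI[of _ n] exI[of _ 1] exI[of _ H]) (auto simp: H_def)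
qed

lemma stutter_lazification:
  "lazification_of (us @ [x, x] @ vs) (us @ [x] @ vs)"
proof -
  define f where "f i = (if i \<le> length us then i else i - 1)" for i
  have "f ` {..<length (us @ [x, x] @ vs)} = {..<length (us @ [x] @ vs)}"
  proof (intro subset_antisym subsetI)
    fix j assume "j \<in> {..<length (us @ [x] @ vs)}"
    then show "j \<in> f ` {..<length (us @ [x, x] @ vs)}"
      by (cases "j \<le> length us") (auto simp: f_def intro: image_eqI[of _ _ j] image_eqI[of _ _ "Suc j"])
  qed (auto simp: f_def split: if_splits)
  moreover have "(us @ [x, x] @ vs) ! i = (us @ [x] @ vs) ! f i" if "i < length (us @ [x, x] @ vs)" for i
  proof -
    consider "i < length us" | "i = length us" | "i = Suc (length us)" | k where "i = Suc (Suc (length us + k))"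
      by (metis add_Suc_right less_antisym less_iff_Suc_add not_less_eq)
    then show ?thesis by cases (auto simp: f_def nth_append)
  qed
  ultimately show ?thesis
    unfolding lazification_of_def by (intro exI[of _ f]) (auto simp: mono_on_def f_def)
qed

lemma move_theta_step: "row zs ws \<or> stutter zs ws \<Longrightarrow> theta_step \<theta> Z \<rho> zs ws"
  using move_ends[of zs ws] row_grid_homotopic stutter_lazification
  unfolding theta_step_def by (auto simp: stutter_def)

text \<open>Homotopies are constructed from the elementary moves and reach the group through this
  implication; invariants are checked against the full relation.\<close>

lemma sim_theta_homotopy:
  assumes "sim zs ws" "zs \<in> paths"
  shows "(zs, ws) \<in> theta_homotopy \<theta> Z \<rho>"
proof -
  have "equivclp (theta_step \<theta> Z \<rho>) zs ws"
    using assms(1)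
  proof (induction rule: equivclp_induct)
    case (step y z)
    from step.hyps(2) have "equivclp (theta_step \<theta> Z \<rho>) y z"
      by (elim disjE) (auto intro: r_into_equivclp converse_r_into_equivclp move_theta_step)
    with step.IH show ?case by (rule equivclp_trans)
  qed simp
  then show ?thesis using sim_ends[OF assms] assms(2) by (simp add: theta_homotopy_def)
qed

lemma equiv_theta_homotopy: "equiv paths (theta_homotopy \<theta> Z \<rho>)"
proof (rule equivI)
  show "refl_on paths (theta_homotopy \<theta> Z \<rho>)" "theta_homotopy \<theta> Z \<rho> \<subseteq> paths \<times> paths"
    by (auto simp: refl_on_def theta_homotopy_def)
  show "sym (theta_homotopy \<theta> Z \<rho>)" by (auto simp: sym_def theta_homotopy_def intro: equivclp_sym)
  show "trans (theta_homotopy \<theta> Z \<rho>)" by (auto simp: trans_def theta_homotopy_def intro: equivclp_trans)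
qed

end

text \<open>By monotonicity a jump by more than one would leave out a value, against surjectivity;
  the same reasoning determines the values at the ends.\<close>

lemma lazification_map:
  assumes "mono_on {..<m} f" "f ` {..<m} = {..<n}" "0 < m"
  shows "f 0 = (0::nat)" "f (m - 1) = n - (1::nat)" "Suc i < m \<Longrightarrow> f (Suc i) = f i \<or> f (Suc i) = Suc (f i)"
proof -
  have lt: "f i < n" if "i < m" for i using assms(2) that by blast
  have pre: "\<exists>i<m. f i = j" if "j < n" for j using assms(2) that by (metis imageE lessThan_iff)
  have mono: "f i \<le> f j" if "i \<le> j" "j < m" for i j using assms(1) that by (auto simp: mono_on_def)
  have n: "0 < n" using lt[OF assms(3)] by simp
  show "f 0 = 0" using pre[OF n] mono[of 0] by force
  have "n - 1 \<le> f (m - 1)"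
  proof -
    obtain j where "j < m" "f j = n - 1" using pre[of "n - 1"] n by auto
    moreover from this have "j \<le> m - 1" "m - 1 < m" by auto
    ultimately show ?thesis using mono[of j "m - 1"] by simp
  qed
  then show "f (m - 1) = n - 1" using lt[of "m - 1"] assms(3) by simp
  show "f (Suc i) = f i \<or> f (Suc i) = Suc (f i)" if i: "Suc i < m"
  proof (rule ccontr)
    assume "\<not> ?thesis"
    then have big: "Suc (f i) < f (Suc i)" using mono[of i "Suc i"] i by auto
    then obtain k where k: "k < m" "f k = Suc (f i)" using pre[of "Suc (f i)"] lt[OF i] by auto
    show False
    proof (cases "k \<le> i")
      case True
      then show False using mono[of k i] i k by simp
    next
      case False
      then show False using mono[of "Suc i" k] k big by simp
    qed
  qed
qed

section \<open>Flat connections and the holonomy isomorphism\<close>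

text \<open>\<open>k\<close> is the transport along an edge, and \<open>k_square\<close> is the
  vanishing of curvature on small squares. The corners may coincide, so triangles and backtracking
  edges are included.\<close>

locale flat_connection = theta_space Z \<rho> \<theta> + group G
  for Z :: "'a set" and \<rho> and \<theta> and G :: "('g, 'h) monoid_scheme" (structure) +
  fixes k :: "'a \<Rightarrow> 'a \<Rightarrow> 'g"
  assumes k_closed [simp]: "k x y \<in> carrier G"
    and k_refl [simp]: "x \<in> Z \<Longrightarrow> k x x = \<one>"
    and k_square: "\<lbrakk>x \<in> Z; y \<in> Z; z \<in> Z; w \<in> Z; adj x y; adj y w; adj x z; adj z w\<rbrakk> \<Longrightarrow>
      k x y \<otimes> k y w = k x z \<otimes> k z w"
begin

primrec transport :: "(nat \<Rightarrow> 'a) \<Rightarrow> nat \<Rightarrow> 'g" where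
  "transport h 0 = \<one>"
| "transport h (Suc i) = transport h i \<otimes> k (h i) (h (Suc i))"

lemma transport_closed [simp]: "transport h i \<in> carrier G"
  by (induction i) auto

lemma transport_cong: "(\<And>j. j \<le> i \<Longrightarrow> h j = h' j) \<Longrightarrow> transport h i = transport h' i"
  by (induction i) auto

definition holonomy :: "'a list \<Rightarrow> 'g" where
  "holonomy zs = transport ((!) zs) (length zs - 1)"

lemma holonomy_closed [simp]: "holonomy zs \<in> carrier G"
  by (simp add: holonomy_def)

lemma holonomy_single [simp]: "holonomy [x] = \<one>"
  by (simp add: holonomy_def)

lemma holonomy_snoc:
  assumes "zs \<noteq> []"
  shows "holonomy (zs @ [y]) = holonomy zs \<otimes> k (last zs) y"
proof -
  obtain n where n: "length zs = Suc n" using assms by (metis length_Suc_conv neq_Nil_conv)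
  have "holonomy (zs @ [y]) = transport ((!) (zs @ [y])) (Suc n)" by (simp add: holonomy_def n)
  also have "\<dots> = transport ((!) (zs @ [y])) n \<otimes> k (last zs) y"
    using assms n by (simp add: nth_append last_conv_nth)
  also have "transport ((!) (zs @ [y])) n = holonomy zs"
    unfolding holonomy_def n by (simp, rule transport_cong) (simp add: nth_append n)
  finally show ?thesis .
qed

lemma holonomy_append:
  assumes "zs \<noteq> []" "ws \<noteq> []"
  shows "holonomy (zs @ ws) = holonomy zs \<otimes> k (last zs) (hd ws) \<otimes> holonomy ws"
  using assms(2)
proof (induction ws rule: rev_nonempty_induct)
  case (single y)
  then show ?case using holonomy_snoc[OF assms(1)] by simp
next
  case (snoc y ws)
  have "holonomy (zs @ ws @ [y]) = holonomy (zs @ ws) \<otimes> k (last ws) y"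
    using holonomy_snoc[of "zs @ ws" y] snoc.hyps by simp
  then show ?case using snoc holonomy_snoc[OF snoc.hyps, of y] by (simp add: m_assoc)
qed

lemma k_inverse: "x \<in> Z \<Longrightarrow> y \<in> Z \<Longrightarrow> adj x y \<Longrightarrow> k y x = inv (k x y)"
  using k_square[of x y x x] by (simp add: commute inv_equality[symmetric]) (metis inv_equality inv_inv k_closed)

lemma holonomy_rev: "zs \<in> paths \<Longrightarrow> holonomy (rev zs) = inv (holonomy zs)"
proof (induction zs rule: rev_induct)
  case (snoc y zs)
  show ?case
  proof (cases "zs = []")
    case False
    then have zs: "zs \<in> paths" "last zs \<in> Z" "y \<in> Z" "adj (last zs) y"
      using snoc.prems by (auto simp: paths_iff successively_append_iff)
    have "holonomy (rev (zs @ [y])) = k y (last zs) \<otimes> inv (holonomy zs)"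
      using holonomy_append[of "[y]" "rev zs"] False snoc.IH[OF zs(1)] by (simp add: hd_rev)
    also have "\<dots> = inv (holonomy zs \<otimes> k (last zs) y)"
      using k_inverse[OF zs(2,3,4)] by (simp add: inv_mult_group)
    finally show ?thesis using holonomy_snoc[OF False] by simp
  qed simp
qed (simp add: paths_iff)

text \<open>Repeated points contribute \<open>k x x = \<one>\<close>, so the transport along
  \<open>ws\<close> up to \<open>i\<close> is that along \<open>zs\<close> up to
  \<open>f i\<close>.\<close>

lemma holonomy_lazification:
  assumes "lazification_of ws zs" "ws \<in> paths"
  shows "holonomy ws = holonomy zs"
proof -
  obtain f where f: "mono_on {..<length ws} f" "f ` {..<length ws} = {..<length zs}"
    "\<And>i. i < length ws \<Longrightarrow> ws ! i = zs ! f i"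
    using assms(1) unfolding lazification_of_def by blast
  have pos: "0 < length ws" and Z: "set ws \<subseteq> Z" using assms(2) by (auto simp: paths_iff)
  note lf = lazification_map[OF f(1,2) pos]
  have "transport ((!) ws) i = transport ((!) zs) (f i)" if "i < length ws" for i
    using that
  proof (induction i)
    case (Suc i)
    have "ws ! i \<in> Z" using Z Suc.prems by auto
    then show ?case using lf(3)[OF Suc.prems] Suc f(3)[of i] f(3)[of "Suc i"] by auto
  qed (simp add: lf(1))
  then show ?thesis unfolding holonomy_def using lf(2) pos by (metis diff_less zero_less_one)
qed

text \<open>\<open>step\<close> pushes the transport across one strip of squares: row
  \<open>j\<close> up to \<open>i\<close>, followed by the vertical edge at \<open>i\<close>, equals
  row \<open>j + 1\<close> up to \<open>i\<close>. The left edge drops out because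
  \<open>H 0\<close> is constant, and at \<open>i = n\<close> the right one does too.\<close>

lemma holonomy_grid:
  assumes "grid_homotopic \<theta> Z \<rho> zs ws"
  shows "holonomy ws = holonomy zs"
proof -
  from assms obtain n m H where n: "length zs = Suc n" "length ws = Suc n"
    and Z0: "\<forall>i\<le>n. \<forall>j\<le>m. H i j \<in> Z"
    and lip0: "\<forall>i\<le>n. \<forall>j\<le>m. \<forall>i'\<le>n. \<forall>j'\<le>m.
        \<rho> (H i j) (H i' j') \<le> \<theta> * (\<bar>real i - real i'\<bar> + \<bar>real j - real j'\<bar>)"
    and ends0: "\<forall>i\<le>n. H i 0 = zs ! i \<and> H i m = ws ! i"
    and const0: "\<forall>j\<le>m. H 0 j = H 0 0 \<and> H n j = H n 0"
    unfolding grid_homotopic_def by (elim exE conjE)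
  note Z = Z0[rule_format] and lip = lip0[rule_format]
    and ends = ends0[rule_format, THEN conjunct1] ends0[rule_format, THEN conjunct2]
    and const = const0[rule_format, THEN conjunct1] const0[rule_format, THEN conjunct2]
  have hor: "adj (H i j) (H (Suc i) j)" if "Suc i \<le> n" "j \<le> m" for i j
    using lip[of i j "Suc i" j] that by simp
  have ver: "adj (H i j) (H i (Suc j))" if "i \<le> n" "Suc j \<le> m" for i j
    using lip[of i j i "Suc j"] that by simp
  have step: "transport (\<lambda>i. H i j) i \<otimes> k (H i j) (H i (Suc j)) = transport (\<lambda>i. H i (Suc j)) i"
    if "i \<le> n" "Suc j \<le> m" for i j
    using that(1)
  proof (induction i)
    case 0
    then show ?case using const(1)[of j] const(1)[of "Suc j"] Z[of 0 0] that by simp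
  next
    case (Suc i)
    have "k (H i j) (H (Suc i) j) \<otimes> k (H (Suc i) j) (H (Suc i) (Suc j)) =
        k (H i j) (H i (Suc j)) \<otimes> k (H i (Suc j)) (H (Suc i) (Suc j))"
      using Suc.prems that(2) by (intro k_square Z hor ver) auto
    then show ?case using Suc by (simp add: m_assoc) (simp add: m_assoc[symmetric])
  qed
  have all: "transport (\<lambda>i. H i j) n = transport (\<lambda>i. H i 0) n" if "j \<le> m" for j
    using that
  proof (induction j)
    case (Suc j)
    have "k (H n j) (H n (Suc j)) = \<one>"
      using const(2)[of j] const(2)[of "Suc j"] Z[of n 0] Suc.prems by simp
    then show ?case using step[of n j] Suc by simp
  qed simp
  have "holonomy ws = transport (\<lambda>i. H i m) n"
    unfolding holonomy_def n diff_Suc_1 by (rule transport_cong) (simp add: ends)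
  also have "\<dots> = transport (\<lambda>i. H i 0) n" by (rule all[OF order_refl])
  also have "\<dots> = holonomy zs"
    unfolding holonomy_def n diff_Suc_1 by (rule transport_cong) (simp add: ends)
  finally show ?thesis .
qed

lemma holonomy_theta_homotopy:
  assumes "(zs, ws) \<in> theta_homotopy \<theta> Z \<rho>"
  shows "holonomy ws = holonomy zs"
proof -
  have step: "holonomy z = holonomy y" if "theta_step \<theta> Z \<rho> y z" for y z
    using that holonomy_lazification holonomy_grid unfolding theta_step_def by blast
  have "equivclp (theta_step \<theta> Z \<rho>) zs ws" using assms by (simp add: theta_homotopy_def)
  then show ?thesis
    by (induction rule: equivclp_induct) (auto dest: step)
qed

lemma holonomy_sim: "sim zs ws \<Longrightarrow> zs \<in> paths \<Longrightarrow> holonomy ws = holonomy zs"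
  by (rule holonomy_theta_homotopy[OF sim_theta_homotopy])

text \<open>Contractibility is assumed only for trivial holonomy. For two loops of equal holonomy a
  reversed loop is inserted: \<open>zs\<close>, \<open>zs @ rev ws @ ws\<close> and
  \<open>ws\<close> are homotopic.\<close>

lemma discrete_pi1_iso:
  assumes x: "x \<in> Z"
    and surj: "\<And>a. a \<in> carrier G \<Longrightarrow> \<exists>zs\<in>theta_loops \<theta> Z \<rho> x. holonomy zs = a"
    and contract: "\<And>zs. zs \<in> theta_loops \<theta> Z \<rho> x \<Longrightarrow> holonomy zs = \<one> \<Longrightarrow> sim zs [x]"
  shows "discrete_pi1 \<theta> Z \<rho> x \<cong> G"
proof -
  let ?L = "theta_loops \<theta> Z \<rho> x"
  define cls where "cls zs = theta_homotopy \<theta> Z \<rho> `` {zs}" for zs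
  have L: "zs \<in> ?L \<longleftrightarrow> zs \<in> paths \<and> hd zs = x \<and> last zs = x" for zs by (auto simp: theta_loops_def)
  have ne: "zs \<noteq> []" if "zs \<in> ?L" for zs using that by (auto simp: L paths_iff)
  have app: "zs @ ws \<in> ?L" "holonomy (zs @ ws) = holonomy zs \<otimes> holonomy ws" if "zs \<in> ?L" "ws \<in> ?L" for zs ws
    using that x holonomy_append[OF ne[OF that(1)] ne[OF that(2)]] ne sim_joint(3)[of zs ws] by (auto simp: L)
  have rev: "rev zs \<in> ?L" if "zs \<in> ?L" for zs
    using that by (auto simp: L paths_iff hd_rev last_rev commute)
  have inj: "sim zs ws" if zs: "zs \<in> ?L" and ws: "ws \<in> ?L" and eq: "holonomy zs = holonomy ws" for zs ws
  proof -
    have hr: "holonomy (rev ws) = inv (holonomy ws)" using ws holonomy_rev by (simp add: L)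
    have a: "sim (rev ws @ ws) [x]" by (rule contract) (use app[OF rev[OF ws] ws] hr in auto)
    have b: "sim (zs @ rev ws) [x]" by (rule contract) (use app[OF zs rev[OF ws]] hr eq in auto)
    have p: "zs @ rev ws @ ws \<in> paths" "rev ws @ ws \<in> paths" "zs @ rev ws \<in> paths" "[x] @ ws \<in> paths" "zs @ [x] \<in> paths"
      using app(1)[OF zs app(1)[OF rev[OF ws] ws]] app(1)[OF rev[OF ws] ws] app(1)[OF zs rev[OF ws]]
        app(1)[of "[x]" ws] app(1)[of zs "[x]"] zs ws x by (auto simp: L paths_iff)
    have "sim zs (zs @ [x])"
      using sim_joint(1)[of zs "[x]"] zs x by (auto simp: L paths_iff intro: sim_sym)
    also have "sim (zs @ [x]) (zs @ rev ws @ ws)"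
      by (rule sim_sym[OF sim_context_left[OF a p(2,1)]])
    also have "sim (zs @ rev ws @ ws) ([x] @ ws)"
      using sim_context_right[OF b p(3), of ws] p(1) by simp
    also have "sim ([x] @ ws) ws"
    proof -
      obtain ws' where "ws = x # ws'" using ws ne[OF ws] by (cases ws) (auto simp: L)
      then show ?thesis using sim_sym[OF sim_stutter[of "[]" x ws']] ws by (simp add: L)
    qed
    finally show ?thesis .
  qed
  have tl: "zs @ tl ws \<in> ?L" "holonomy (zs @ tl ws) = holonomy zs \<otimes> holonomy ws" if "zs \<in> ?L" "ws \<in> ?L" for zs ws
  proof -
    have j: "sim (zs @ ws) (zs @ tl ws)" "zs @ ws \<in> paths" using sim_joint that by (auto simp: L)
    then show "zs @ tl ws \<in> ?L" using sim_ends[OF j] app(1)[OF that] by (simp add: L)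
    show "holonomy (zs @ tl ws) = holonomy zs \<otimes> holonomy ws" using holonomy_sim[OF j] app(2)[OF that] by simp
  qed
  \<comment> \<open>The relation lives on all \<theta>-paths. Each step keeps the end points, so the
    class of a loop contains only loops at \<open>x\<close>.\<close>
  have homL: "ws \<in> ?L" "holonomy ws = holonomy zs" if "zs \<in> ?L" "ws \<in> cls zs" for zs ws
  proof -
    have h: "(zs, ws) \<in> theta_homotopy \<theta> Z \<rho>" using that by (simp add: cls_def)
    then show "holonomy ws = holonomy zs" by (rule holonomy_theta_homotopy)
    have "equivclp (theta_step \<theta> Z \<rho>) zs ws" using h by (simp add: theta_homotopy_def)
    then have "hd ws = hd zs \<and> last ws = last zs"
    proof (induction rule: equivclp_induct)
      case (step y z)
      have "hd v = hd u \<and> last v = last u" if "theta_step \<theta> Z \<rho> u v" for u v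
      proof -
        have uv: "u \<noteq> []" "v \<noteq> []" using that by (auto simp: theta_step_def theta_paths_def)
        from that consider "lazification_of v u" | "grid_homotopic \<theta> Z \<rho> u v" by (auto simp: theta_step_def)
        then show ?thesis
        proof cases
          case 1
          then obtain f where f: "mono_on {..<length v} f" "f ` {..<length v} = {..<length u}"
            "\<And>i. i < length v \<Longrightarrow> v ! i = u ! f i" unfolding lazification_of_def by blast
          have "0 < length v" using uv by simp
          from lazification_map(1,2)[OF f(1,2) this] f(3)[of 0] f(3)[of "length v - 1"] uv
          show ?thesis by (simp add: hd_conv_nth last_conv_nth)
        next
          case 2
          then obtain n m H where n: "length u = Suc n" "length v = Suc n"
            and "\<forall>i\<le>n. \<forall>j\<le>m. H i j \<in> Z"
            and "\<forall>i\<le>n. \<forall>j\<le>m. \<forall>i'\<le>n. \<forall>j'\<le>m.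
              \<rho> (H i j) (H i' j') \<le> \<theta> * (\<bar>real i - real i'\<bar> + \<bar>real j - real j'\<bar>)"
            and e: "\<forall>i\<le>n. H i 0 = u ! i \<and> H i m = v ! i" "\<forall>j\<le>m. H 0 j = H 0 0 \<and> H n j = H n 0"
            unfolding grid_homotopic_def by (elim exE conjE)
          have "u ! 0 = v ! 0" "u ! n = v ! n" using e by (metis le_refl zero_le)+
          then show ?thesis using n uv by (simp add: hd_conv_nth last_conv_nth)
        qed
      qed
      then show ?case using step by metis
    qed simp
    then show "ws \<in> ?L" using that(1) h by (simp add: L theta_homotopy_def)
  qed
  have self: "zs \<in> cls zs" if "zs \<in> ?L" for zs
    using that equiv_class_self[OF equiv_theta_homotopy, of zs] by (simp add: cls_def L)
  have cls_eq: "cls zs = cls ws \<longleftrightarrow> holonomy zs = holonomy ws" if "zs \<in> ?L" "ws \<in> ?L" for zs ws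
  proof
    assume "cls zs = cls ws"
    then show "holonomy zs = holonomy ws" using homL(2)[OF that(2), of zs] self[OF that(1)] by simp
  next
    assume "holonomy zs = holonomy ws"
    then have "(zs, ws) \<in> theta_homotopy \<theta> Z \<rho>" using sim_theta_homotopy[OF inj[OF that]] that by (simp add: L)
    then show "cls zs = cls ws" unfolding cls_def by (rule equiv_class_eq[OF equiv_theta_homotopy])
  qed
  let ?D = "discrete_pi1 \<theta> Z \<rho> x"
  have carr: "carrier ?D = cls ` ?L" by (auto simp: discrete_pi1_def quotient_def cls_def)
  have mult: "cls zs \<otimes>\<^bsub>?D\<^esub> cls ws = cls (zs @ tl ws)" if zs: "zs \<in> ?L" and ws: "ws \<in> ?L" for zs ws
  proof -
    have "cls (zs' @ tl ws') = cls (zs @ tl ws)" if "zs' \<in> cls zs" "ws' \<in> cls ws" for zs' ws'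
      using homL[OF zs that(1)] homL[OF ws that(2)] tl[of zs' ws'] tl[OF zs ws]
      by (subst cls_eq) simp_all
    from UN2_const[of "cls zs" "cls ws" "\<lambda>zs ws. cls (zs @ tl ws)", OF this self[OF zs] self[OF ws]]
    show ?thesis by (simp add: discrete_pi1_def cls_def)
  qed
  define F where "F P = holonomy (SOME zs. zs \<in> P)" for P
  have F: "F (cls zs) = holonomy zs" if "zs \<in> ?L" for zs
    unfolding F_def by (rule homL(2)[OF that]) (rule someI[where P = "\<lambda>z. z \<in> cls zs" and x = zs, OF self[OF that]])
  have "F \<in> hom ?D G"
    unfolding hom_def carr using F mult tl by auto
  moreover have "bij_betw F (carrier ?D) (carrier G)"
    unfolding bij_betw_def carr
  proof
    show "inj_on F (cls ` ?L)"
    proof (rule inj_onI)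
      fix P Q assume "P \<in> cls ` ?L" "Q \<in> cls ` ?L" and eq: "F P = F Q"
      then obtain zs ws where z: "P = cls zs" "zs \<in> ?L" "Q = cls ws" "ws \<in> ?L" by blast
      then show "P = Q" using eq F[OF z(2)] F[OF z(4)] cls_eq[OF z(2,4)] by simp
    qed
    show "F ` cls ` ?L = carrier G"
      using surj F by (auto simp: image_iff) metis
  qed
  ultimately show ?thesis unfolding is_iso_def iso_def by blast
qed

end

section \<open>Warped metrics of free actions\<close>

locale compact_length_space =
  fixes M :: "'m::t2_space set" and d :: "'m \<Rightarrow> 'm \<Rightarrow> real"
  assumes compact: "compact M"
    and d_sym: "d x y = d y x"
    and d_self: "x \<in> M \<Longrightarrow> d x x = 0"
    and d_pos: "x \<in> M \<Longrightarrow> y \<in> M \<Longrightarrow> x \<noteq> y \<Longrightarrow> 0 < d x y"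
    and d_triangle: "x \<in> M \<Longrightarrow> y \<in> M \<Longrightarrow> z \<in> M \<Longrightarrow> d x z \<le> d x y + d y z"
    and d_continuous: "continuous_on (M \<times> M) (\<lambda>(x, y). d x y)"
    and d_curve: "x \<in> M \<Longrightarrow> y \<in> M \<Longrightarrow> d x y < e \<Longrightarrow>
      \<exists>c F. path c \<and> path_image c \<subseteq> M \<and> pathstart c = x \<and> pathfinish c = y \<and>
        continuous_on {0..1} F \<and> F 0 = 0 \<and> F 1 < e \<and>
        (\<forall>s\<in>{0..1}. \<forall>s'\<in>{0..1}. s \<le> s' \<longrightarrow> d (c s) (c s') \<le> F s' - F s)"
begin

lemma d_nonneg: "x \<in> M \<Longrightarrow> y \<in> M \<Longrightarrow> 0 \<le> d x y"
  using d_self d_pos by (metis less_eq_real_def)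

lemma d_compose:
  assumes "continuous_on X f" "continuous_on X g" "f ` X \<subseteq> M" "g ` X \<subseteq> M"
  shows "continuous_on X (\<lambda>x. d (f x) (g x))"
  using continuous_on_compose2[OF d_continuous continuous_on_Pair[OF assms(1,2)]] assms(3,4)
  by (auto simp: image_subset_iff)

text \<open>The set of pairs with \<open>d (f a) (f b) \<ge> e\<close> is compact and avoids the diagonal, so \<open>r\<close> has a
  positive minimum on it.\<close>

lemma uniformly_close:
  assumes X: "compact X" and f: "continuous_on X f" "f ` X \<subseteq> M"
    and r: "continuous_on (X \<times> X) (\<lambda>(a, b). r a b)" "\<And>a b. a \<in> X \<Longrightarrow> b \<in> X \<Longrightarrow> a \<noteq> b \<Longrightarrow> (0::real) < r a b"
    and e: "0 < e"
  obtains \<kappa> where "0 < \<kappa>" "\<And>a b. a \<in> X \<Longrightarrow> b \<in> X \<Longrightarrow> r a b < \<kappa> \<Longrightarrow> d (f a) (f b) < e"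
proof -
  define D where "D z = d (f (fst z)) (f (snd z))" for z
  have "continuous_on (X \<times> X) (\<lambda>z. f (fst z))" "continuous_on (X \<times> X) (\<lambda>z. f (snd z))"
    by (auto intro!: continuous_on_compose2[OF f(1)] continuous_intros)
  then have D: "continuous_on (X \<times> X) D"
    unfolding D_def by (rule d_compose) (use f(2) in auto)
  define B where "B = (X \<times> X) \<inter> D -` {e..}"
  have "closedin (top_of_set (X \<times> X)) B"
    unfolding B_def by (rule continuous_closedin_preimage[OF D closed_atLeast])
  then have B: "compact B" by (rule closedin_compact[OF compact_Times[OF X X]])
  show thesis
  proof (cases "B = {}")
    case True
    then have "d (f a) (f b) < e" if "a \<in> X" "b \<in> X" for a b
      using that by (force simp: B_def D_def)
    then show thesis using that[of 1] by simp
  next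
    case False
    have "continuous_on B (\<lambda>(a, b). r a b)" by (rule continuous_on_subset[OF r(1)]) (simp add: B_def)
    then obtain z where z: "z \<in> B" "\<And>y. y \<in> B \<Longrightarrow> (\<lambda>(a, b). r a b) z \<le> (\<lambda>(a, b). r a b) y"
      using continuous_attains_inf[OF B False] by blast
    obtain a0 b0 where ab: "z = (a0, b0)" by (cases z)
    have "a0 \<noteq> b0" using z(1) e d_self f(2) by (auto simp: B_def D_def ab)
    then have "0 < r a0 b0" using r(2) z(1) by (auto simp: B_def ab)
    moreover have "d (f a) (f b) < e" if "a \<in> X" "b \<in> X" "r a b < r a0 b0" for a b
    proof (rule ccontr)
      assume "\<not> d (f a) (f b) < e"
      then have "(a, b) \<in> B" using that by (simp add: B_def D_def)
      then show False using z(2)[of "(a, b)"] that(3) by (simp add: ab)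
    qed
    ultimately show thesis using that[of "r a0 b0"] by blast
  qed
qed

lemma uniformly_close_dist:
  fixes f :: "'x::metric_space \<Rightarrow> 'm"
  assumes "compact X" "continuous_on X f" "f ` X \<subseteq> M" "0 < e"
  obtains \<kappa> where "0 < \<kappa>" "\<And>a b. a \<in> X \<Longrightarrow> b \<in> X \<Longrightarrow> dist a b < \<kappa> \<Longrightarrow> d (f a) (f b) < e"
proof (rule uniformly_close[OF assms(1-3) _ _ assms(4)])
  show "continuous_on (X \<times> X) (\<lambda>(a, b). dist a b)"
    unfolding split_def by (intro continuous_intros)
qed (use that in auto)

end

locale free_action = compact_length_space M d + group G
  for M :: "'m::t2_space set" and d and G :: "('g, 'b) monoid_scheme" (structure) +
  fixes S :: "'g set" and act :: "'g \<Rightarrow> 'm \<Rightarrow> 'm"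
  assumes S: "finite S" "S \<subseteq> carrier G" "generate G S = carrier G"
    and free: "acts_freely_by_homeomorphisms G M act"
begin

lemma action: "group_action G M act"
  using free by (simp add: acts_freely_by_homeomorphisms_def)

lemma act_closed [simp]: "a \<in> carrier G \<Longrightarrow> x \<in> M \<Longrightarrow> act a x \<in> M"
  using group_action.element_image[OF action] by blast

lemma act_mult: "a \<in> carrier G \<Longrightarrow> b \<in> carrier G \<Longrightarrow> x \<in> M \<Longrightarrow> act (a \<otimes> b) x = act a (act b x)"
  using group_action.composition_rule[OF action] by blast

lemma act_one [simp]: "x \<in> M \<Longrightarrow> act \<one> x = x"
  using group_action.id_eq_one[OF action] by (metis restrict_apply)

lemma act_inv [simp]: "a \<in> carrier G \<Longrightarrow> x \<in> M \<Longrightarrow> act (inv a) (act a x) = x"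
  "a \<in> carrier G \<Longrightarrow> x \<in> M \<Longrightarrow> act a (act (inv a) x) = x"
  by (simp_all add: act_mult[symmetric])

lemma act_continuous: "a \<in> carrier G \<Longrightarrow> continuous_on M (act a)"
  using free unfolding acts_freely_by_homeomorphisms_def homeomorphism_def by blast

lemma act_free: "a \<in> carrier G \<Longrightarrow> x \<in> M \<Longrightarrow> act a x = x \<Longrightarrow> a = \<one>"
  using free unfolding acts_freely_by_homeomorphisms_def by blast

lemma act_eq_iff:
  assumes "a \<in> carrier G" "b \<in> carrier G" "x \<in> M"
  shows "act a x = act b x \<longleftrightarrow> a = b"
proof
  assume "act a x = act b x"
  then have "act (inv b \<otimes> a) x = x" using assms by (simp add: act_mult)
  then have "inv b \<otimes> a = \<one>" using act_free assms by simp
  then show "a = b" using assms by (metis inv_closed inv_equality inv_inv)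
qed simp

text \<open>Homeomorphisms come with no Lipschitz bound; compactness yields a common modulus of
  continuity for finitely many elements.\<close>

lemma act_uniformly:
  assumes "finite B" "B \<subseteq> carrier G" "0 < e"
  shows "\<exists>\<kappa>>0. \<forall>a\<in>B. \<forall>x\<in>M. \<forall>y\<in>M. d x y < \<kappa> \<longrightarrow> d (act a x) (act a y) < e"
  using assms
proof (induction B rule: finite_induct)
  case (insert a B)
  then obtain \<kappa> where \<kappa>: "0 < \<kappa>" "\<forall>a\<in>B. \<forall>x\<in>M. \<forall>y\<in>M. d x y < \<kappa> \<longrightarrow> d (act a x) (act a y) < e" by auto
  obtain \<kappa>' where \<kappa>': "0 < \<kappa>'" "\<And>x y. x \<in> M \<Longrightarrow> y \<in> M \<Longrightarrow> d x y < \<kappa>' \<Longrightarrow> d (act a x) (act a y) < e"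
  proof (rule uniformly_close[OF compact, of "act a" d e])
    show "continuous_on M (act a)" "act a ` M \<subseteq> M" using insert by (auto intro: act_continuous)
  qed (use d_continuous d_pos insert in auto)
  show ?case using \<kappa> \<kappa>' by (intro exI[of _ "min \<kappa> \<kappa>'"]) auto
qed (auto intro: exI[of _ 1])

text \<open>For \<open>a \<noteq> b\<close> freeness makes \<open>d (act a x) (act b x)\<close>
  positive, and as a continuous function of \<open>x\<close> it is bounded below on compact
  \<open>M\<close>. Finitely many pairs leave a positive minimum.\<close>

lemma displacement:
  assumes "finite B" "B \<subseteq> carrier G"
  shows "\<exists>\<epsilon>>0. \<forall>a\<in>B. \<forall>b\<in>B. \<forall>x\<in>M. a \<noteq> b \<longrightarrow> \<epsilon> \<le> d (act a x) (act b x)"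
proof -
  have one: "\<exists>\<epsilon>>0. \<forall>x\<in>M. a \<noteq> b \<longrightarrow> \<epsilon> \<le> d (act a x) (act b x)" if ab: "a \<in> carrier G" "b \<in> carrier G" for a b
  proof (cases "M = {} \<or> a = b")
    case False
    have cont: "continuous_on M (\<lambda>x. d (act a x) (act b x))"
      using ab by (intro d_compose act_continuous) auto
    have "M \<noteq> {}" using False by simp
    from continuous_attains_inf[OF compact this cont]
    obtain x0 where x0: "x0 \<in> M" "\<forall>x\<in>M. d (act a x0) (act b x0) \<le> d (act a x) (act b x)" by (elim bexE)
    have "0 < d (act a x0) (act b x0)"
      using x0(1) False ab act_eq_iff by (intro d_pos) auto
    then show ?thesis using x0(2) by (intro exI[of _ "d (act a x0) (act b x0)"]) simp
  qed (auto intro: exI[of _ 1])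
  have "\<forall>p\<in>B \<times> B. \<exists>\<epsilon>>0. \<forall>x\<in>M. fst p \<noteq> snd p \<longrightarrow> \<epsilon> \<le> d (act (fst p) x) (act (snd p) x)"
    using one assms(2) by auto
  from bchoice[OF this] obtain E where
    E: "\<forall>p\<in>B \<times> B. 0 < E p \<and> (\<forall>x\<in>M. fst p \<noteq> snd p \<longrightarrow> E p \<le> d (act (fst p) x) (act (snd p) x))" by (elim exE)
  define \<epsilon> where "\<epsilon> = Min (insert 1 (E ` (B \<times> B)))"
  have fin: "finite (insert 1 (E ` (B \<times> B)))" using assms(1) by simp
  have "0 < \<epsilon>" unfolding \<epsilon>_def using fin E by (subst Min_gr_iff) auto
  moreover have "\<epsilon> \<le> d (act a x) (act b x)" if "a \<in> B" "b \<in> B" "x \<in> M" "a \<noteq> b" for a b x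
  proof -
    have "\<epsilon> \<le> E (a, b)" unfolding \<epsilon>_def using fin that by (intro Min_le) auto
    also have "\<dots> \<le> d (act a x) (act b x)" using bspec[OF E, of "(a, b)"] that by auto
    finally show ?thesis .
  qed
  ultimately show ?thesis by blast
qed

section \<open>Word balls, chains and a formula for the warped metric\<close>

definition gens :: "'g set" where
  "gens = S \<union> m_inv G ` S"

lemma gens: "finite gens" "gens \<subseteq> carrier G" "s \<in> gens \<Longrightarrow> inv s \<in> gens"
  using S by (auto simp: gens_def)

lemma gens_carrier [simp]: "s \<in> gens \<Longrightarrow> s \<in> carrier G"
  using gens by blast

lemma gens_lists: "w \<in> lists gens \<Longrightarrow> w \<in> lists (carrier G)"
  using gens(2) lists_mono by blast

lemma gens_lprod: "a \<in> carrier G \<Longrightarrow> \<exists>w\<in>lists gens. lprod w = a"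
  unfolding gens_def using generate_lprod S by simp

definition gball :: "nat \<Rightarrow> 'g set" where
  "gball n = lprod ` {w. set w \<subseteq> gens \<and> length w \<le> n}"

lemma finite_gball: "finite (gball n)"
  unfolding gball_def by (intro finite_imageI finite_lists_length_le gens(1))

lemma gball_carrier: "gball n \<subseteq> carrier G"
  using gens_lists by (auto simp: gball_def lists_eq_set)

lemma gball_mono: "m \<le> n \<Longrightarrow> gball m \<subseteq> gball n"
  unfolding gball_def by (intro image_mono) auto

lemma gball_one: "\<one> \<in> gball n"
  unfolding gball_def by (intro image_eqI[of _ _ "[]"]) auto

lemma gball_mult: "a \<in> gball m \<Longrightarrow> b \<in> gball n \<Longrightarrow> a \<otimes> b \<in> gball (m + n)"
proof -
  assume "a \<in> gball m" "b \<in> gball n"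
  then obtain u v where "set u \<subseteq> gens" "length u \<le> m" "a = lprod u" "set v \<subseteq> gens" "length v \<le> n" "b = lprod v"
    by (auto simp: gball_def)
  then show ?thesis unfolding gball_def
    using gens_lists[of u] gens_lists[of v] by (intro image_eqI[of _ _ "u @ v"]) (auto simp: lists_eq_set)
qed

lemma gens_gball: "s \<in> gens \<Longrightarrow> s \<in> gball (Suc n)"
  unfolding gball_def by (intro image_eqI[of _ _ "[s]"]) auto

text \<open>A route of moves inside \<open>M\<close> and \<open>n\<close> jumps along generators.
  \<open>m\<close> is an upper bound for the total \<open>d\<close>-length rather than its value, so
  a further move can be merged into the last one by the triangle inequality. The warped distance
  will be the infimum of \<open>n + t * m\<close>.\<close>

inductive chain :: "nat \<Rightarrow> real \<Rightarrow> 'm \<Rightarrow> 'm \<Rightarrow> bool" where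
  move: "\<lbrakk>x \<in> M; y \<in> M; d x y \<le> m\<rbrakk> \<Longrightarrow> chain 0 m x y"
| jump: "\<lbrakk>chain n m x y; s \<in> gens; z \<in> M; d (act s y) z \<le> m'\<rbrakk> \<Longrightarrow> chain (Suc n) (m + m') x z"

lemma chain_props: "chain n m x y \<Longrightarrow> x \<in> M \<and> y \<in> M \<and> 0 \<le> m"
proof (induction rule: chain.induct)
  case (move x y m)
  then show ?case using d_nonneg[of x y] by simp
next
  case (jump n m x y s z m')
  then show ?case using d_nonneg[of "act s y" z] by simp
qed

lemma chain_move: "chain n m x y \<Longrightarrow> z \<in> M \<Longrightarrow> d y z \<le> m' \<Longrightarrow> chain n (m + m') x z"
proof (induction rule: chain.cases)
  case (move x' y' m1)
  then show ?case using d_triangle[of x' y' z] by (auto intro!: chain.move)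
next
  case (jump n1 m1 x' y' s z' m2)
  have "d (act s y') z \<le> m2 + m'"
    using d_triangle[of "act s y'" z' z] jump chain_props[of n1 m1 x' y'] by simp
  then show ?case using chain.jump[of n1 m1 x' y' s z "m2 + m'"] jump by (simp add: add.assoc)
qed

lemma chain_trans: "chain n' m' y z \<Longrightarrow> chain n m x y \<Longrightarrow> chain (n + n') (m + m') x z"
proof (induction rule: chain.induct)
  case (move y z m')
  then show ?case using chain_move by simp
next
  case (jump n' m' y w s z m'')
  then show ?case using chain.jump[of "n + n'" "m + m'" x w s z m''] by (simp add: add.assoc)
qed

lemma chain_sym: "chain n m x y \<Longrightarrow> chain n m y x"
proof (induction rule: chain.induct)
  case (move x y m)
  then show ?case by (auto intro!: chain.move simp: d_sym)
next
  case (jump n m x y s z m')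
  have y: "y \<in> M" using chain_props jump by blast
  have "chain 0 m' z (act s y)" using jump y by (auto intro!: chain.move simp: d_sym)
  then have "chain (Suc 0) (m' + 0) z y"
    by (rule chain.jump[of _ _ _ _ "inv s"]) (use y jump gens(3) d_self in auto)
  from chain_trans[OF jump.IH this] show ?case by (simp add: add.commute)
qed

text \<open>The candidate for the largest admissible metric. Off \<open>M\<close> the value is fixed
  as \<open>0\<close> because \<open>Metric_space\<close> demands symmetry and nonnegativity for all
  arguments.\<close>

definition cost :: "real \<Rightarrow> 'm \<Rightarrow> 'm \<Rightarrow> real" where
  "cost t x y = (if x \<in> M \<and> y \<in> M then Inf {real n + t * m | n m. chain n m x y} else 0)"

context
  fixes t :: real
  assumes t: "0 < t"
begin

lemma cost_bdd: "bdd_below {real n + t * m | n m. chain n m x y}"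
  using t chain_props by (intro bdd_belowI[of _ 0]) fastforce

lemma cost_le: "chain n m x y \<Longrightarrow> cost t x y \<le> n + t * m"
  using chain_props[of n m x y] unfolding cost_def by (auto intro!: cInf_lower cost_bdd)

lemma cost_less_iff:
  assumes "x \<in> M" "y \<in> M"
  shows "cost t x y < c \<longleftrightarrow> (\<exists>n m. chain n m x y \<and> n + t * m < c)"
proof -
  have "chain 0 (d x y) x y" using assms by (simp add: chain.move)
  then have "{real n + t * m | n m. chain n m x y} \<noteq> {}" by blast
  then show ?thesis unfolding cost_def using assms by (subst if_P) (auto simp: cInf_less_iff[OF _ cost_bdd])
qed

lemma cost_nonneg: "0 \<le> cost t x y"
proof (cases "x \<in> M \<and> y \<in> M")
  case True
  show ?thesis
  proof (rule ccontr)
    assume "\<not> 0 \<le> cost t x y"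
    then obtain n m where c: "chain n m x y" "n + t * m < 0"
      using cost_less_iff[of x y 0] True unfolding not_le by blast
    have "0 \<le> t * m" using chain_props[OF c(1)] t by simp
    then show False using c(2) by simp
  qed
qed (auto simp: cost_def)

lemma cost_metric: "Metric_space M (cost t)"
proof
  show "0 \<le> cost t x y" for x y by (rule cost_nonneg)
  show "cost t x y = cost t y x" for x y
  proof -
    have "{real n + t * m | n m. chain n m x y} = {real n + t * m | n m. chain n m y x}"
      using chain_sym by blast
    then show ?thesis by (auto simp: cost_def)
  qed
  show "cost t x y = 0 \<longleftrightarrow> x = y" if xy: "x \<in> M" "y \<in> M" for x y
  proof
    assume z: "cost t x y = 0"
    show "x = y"
    proof (rule ccontr)
      assume "x \<noteq> y"
      \<comment> \<open>A chain of cost below 1 contains no jump, and without jumps the cost is at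
        least \<open>t * d x y\<close>.\<close>
      then have "0 < min 1 (t * d x y)" using d_pos xy t by simp
      then obtain n m where c: "chain n m x y" "n + t * m < min 1 (t * d x y)"
        using cost_less_iff[OF xy, of "min 1 (t * d x y)"] unfolding z by blast
      have "0 \<le> t * m" using chain_props[OF c(1)] t by simp
      then have "n = 0" using c(2) by (cases n) auto
      with c(1) have "d x y \<le> m" by (cases rule: chain.cases) auto
      then have "t * d x y \<le> t * m" using t by simp
      then show False using c(2) \<open>n = 0\<close> by simp
    qed
  next
    assume "x = y"
    then have "cost t x y \<le> real 0 + t * 0" using xy d_self by (intro cost_le chain.move) auto
    then show "cost t x y = 0" using cost_nonneg[of x y] by simp
  qed
  show "cost t x z \<le> cost t x y + cost t y z" if M: "x \<in> M" "y \<in> M" "z \<in> M" for x y z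
  proof (rule field_le_epsilon)
    fix e :: real assume "0 < e"
    then have "cost t x y < cost t x y + e / 2" "cost t y z < cost t y z + e / 2" by simp_all
    then obtain n m n' m' where "chain n m x y" "n + t * m < cost t x y + e / 2"
      "chain n' m' y z" "n' + t * m' < cost t y z + e / 2"
      using cost_less_iff[OF M(1,2)] cost_less_iff[OF M(2,3)] by blast
    then show "cost t x z \<le> cost t x y + cost t y z + e"
      using cost_le[OF chain_trans[of n' m' y z n m x]] by (simp add: algebra_simps)
  qed
qed

text \<open>A move costs at most \<open>t\<close> times its \<open>d\<close>-length and a jump at
  most 1, along an inverse generator by symmetry. So no admissible metric exceeds
  \<open>cost\<close>.\<close>

lemma admissible_chain:
  assumes \<delta>: "warped_admissible M d S act t \<delta>" and c: "chain n m x y"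
  shows "\<delta> x y \<le> n + t * m"
proof -
  interpret Metric_space M \<delta> using \<delta> by (simp add: warped_admissible_def)
  have le: "\<delta> x y \<le> t * m" if "x \<in> M" "y \<in> M" "d x y \<le> m" for x y m
  proof -
    have "\<delta> x y \<le> t * d x y" using \<delta> that by (simp add: warped_admissible_def)
    also have "\<dots> \<le> t * m" using that t by simp
    finally show ?thesis .
  qed
  have gen: "\<delta> x (act s x) \<le> 1" if x: "x \<in> M" and s: "s \<in> gens" for x s
    using s unfolding gens_def
  proof
    assume "s \<in> S"
    then show ?thesis using \<delta> x by (simp add: warped_admissible_def)
  next
    assume "s \<in> m_inv G ` S"
    then obtain r where r: "r \<in> S" "s = inv r" by blast
    then have rc: "r \<in> carrier G" using S by blast
    have "\<forall>x\<in>M. \<forall>s\<in>S. \<delta> x (act s x) \<le> 1" using \<delta> by (simp add: warped_admissible_def)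
    moreover have "act s x \<in> M" using x r rc by simp
    ultimately have "\<delta> (act s x) (act r (act s x)) \<le> 1" using r(1) by blast
    then show ?thesis using r rc x by (simp add: commute)
  qed
  show ?thesis
    using c
  proof (induction rule: chain.induct)
    case (jump n m x y s z m')
    have M: "x \<in> M" "y \<in> M" using chain_props jump by blast+
    have "\<delta> x z \<le> \<delta> x y + \<delta> y z" using triangle M jump by blast
    also have "\<delta> y z \<le> \<delta> y (act s y) + \<delta> (act s y) z" using triangle[of y "act s y" z] M jump by simp
    finally show ?case using gen[of y s] le[of "act s y" z m'] jump M by (simp add: algebra_simps)
  qed (use le in simp)
qed

lemma cost_admissible: "warped_admissible M d S act t (cost t)"
  unfolding warped_admissible_def
proof (intro conjI ballI cost_metric)
  show "cost t x y \<le> t * d x y" if "x \<in> M" "y \<in> M" for x y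
    using cost_le[of 0 "d x y" x y] that by (simp add: chain.move)
  show "cost t x (act s x) \<le> 1" if "x \<in> M" "s \<in> S" for x s
  proof -
    have sc: "s \<in> gens" "s \<in> carrier G" using that S by (auto simp: gens_def)
    have "chain 0 0 x x" using that d_self by (simp add: chain.move)
    then have "chain (Suc 0) (0 + 0) x (act s x)"
      by (rule chain.jump[of _ _ _ _ s]) (use that sc d_self in auto)
    from cost_le[OF this] show ?thesis by simp
  qed
qed

text \<open>\<open>cost\<close> is admissible and dominates all admissible metrics, so the choice in
  \<open>warped_metric\<close> has a witness and its result is at least \<open>cost\<close>. A
  strict upper bound on it therefore produces a chain.\<close>

lemma warped_metric_props:
  "warped_admissible M d S act t (warped_metric M d S act t)"
  "x \<in> M \<Longrightarrow> y \<in> M \<Longrightarrow> warped_metric M d S act t x y < c \<Longrightarrow> \<exists>n m. chain n m x y \<and> n + t * m < c"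
proof -
  define \<delta> where "\<delta> = warped_metric M d S act t"
  have max: "\<rho> x y \<le> cost t x y" if \<rho>: "warped_admissible M d S act t \<rho>" and xy: "x \<in> M" "y \<in> M" for \<rho> x y
  proof (rule ccontr)
    assume "\<not> \<rho> x y \<le> cost t x y"
    then obtain n m where "chain n m x y" "n + t * m < \<rho> x y" using cost_less_iff[OF xy, of "\<rho> x y"] unfolding not_le by blast
    then show False using admissible_chain[OF \<rho>] by force
  qed
  have *: "warped_admissible M d S act t \<delta> \<and>
      (\<forall>\<rho>. warped_admissible M d S act t \<rho> \<longrightarrow> (\<forall>x\<in>M. \<forall>y\<in>M. \<rho> x y \<le> \<delta> x y))"
    unfolding \<delta>_def warped_metric_def
    by (rule someI[where x = "cost t"]) (use max cost_admissible in blast)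
  then show "warped_admissible M d S act t (warped_metric M d S act t)" by (simp add: \<delta>_def)
  assume xy: "x \<in> M" "y \<in> M" "warped_metric M d S act t x y < c"
  have "cost t x y \<le> \<delta> x y" using * cost_admissible xy by blast
  then show "\<exists>n m. chain n m x y \<and> n + t * m < c" using xy cost_less_iff[of x y c] by (simp add: \<delta>_def)
qed

end

text \<open>The error before a jump is distorted by the jump, so \<kappa> results from using uniform
  continuity of the generators once for each of the \<open>n\<close> jumps. For drift below \<kappa>
  the chain ends near the image of \<open>x\<close> under the product of its generators.\<close>

lemma chain_near:
  assumes "0 < \<eta>"
  shows "\<exists>\<kappa>>0. \<forall>n' m x y. chain n' m x y \<longrightarrow> n' \<le> n \<longrightarrow> m < \<kappa> \<longrightarrow> (\<exists>a\<in>gball n. d (act a x) y < \<eta>)"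
  using assms
proof (induction n arbitrary: \<eta>)
  case 0
  have "\<exists>a\<in>gball 0. d (act a x) y < \<eta>" if "chain n' m x y" "n' \<le> 0" "m < \<eta>" for n' m x y
    using that(1)
  proof (cases rule: chain.cases)
    case move
    then show ?thesis using that gball_one by (intro bexI[of _ \<one>]) auto
  qed (use that in simp)
  then show ?case using 0 by blast
next
  case (Suc n)
  \<comment> \<open>Half of \<eta> is allotted to the error before the last jump, as transported by
    the generator, the other half to the final move. The minimum with \<eta> below serves chains
    with fewer jumps.\<close>
  obtain \<kappa>1 where \<kappa>1: "0 < \<kappa>1" "\<forall>a\<in>gens. \<forall>x\<in>M. \<forall>y\<in>M. d x y < \<kappa>1 \<longrightarrow> d (act a x) (act a y) < \<eta> / 2"
    using act_uniformly[OF gens(1,2), of "\<eta> / 2"] Suc.prems by auto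
  obtain \<kappa>2 where \<kappa>2: "0 < \<kappa>2" "\<forall>n' m x y. chain n' m x y \<longrightarrow> n' \<le> n \<longrightarrow> m < \<kappa>2 \<longrightarrow> (\<exists>a\<in>gball n. d (act a x) y < min \<kappa>1 \<eta>)"
    using Suc.IH[of "min \<kappa>1 \<eta>"] \<kappa>1(1) Suc.prems by auto
  have "\<exists>a\<in>gball (Suc n). d (act a x) y < \<eta>"
    if c: "chain n' m x y" "n' \<le> Suc n" "m < min \<kappa>2 (\<eta> / 2)" for n' m x y
  proof (cases "n' \<le> n")
    case True
    then obtain a where "a \<in> gball n" "d (act a x) y < min \<kappa>1 \<eta>"
      using \<kappa>2(2)[rule_format, OF c(1)] c(3) by auto
    then show ?thesis using gball_mono[of n "Suc n"] by auto
  next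
    case False
    then have "n' = Suc n" using c(2) by simp
    from c(1) this show ?thesis
    proof (cases rule: chain.cases)
      case (jump n1 m1 y1 s m2)
      have y1: "x \<in> M" "y1 \<in> M" "0 \<le> m1" using chain_props[OF jump(3)] by auto
      have m2: "0 \<le> m2" using d_nonneg[of "act s y1" y] jump y1 by simp
      have "n1 \<le> n" "m1 < \<kappa>2" using jump \<open>n' = Suc n\<close> c(3) m2 by auto
      then obtain a where a: "a \<in> gball n" "d (act a x) y1 < min \<kappa>1 \<eta>" using \<kappa>2(2)[rule_format, OF jump(3)] by blast
      have ac: "a \<in> carrier G" "s \<in> carrier G" using a(1) gball_carrier jump by auto
      have "d (act s (act a x)) (act s y1) < \<eta> / 2" using \<kappa>1(2) a(2) jump y1 ac by simp
      moreover have "d (act s y1) y < \<eta> / 2" using jump c(3) y1 by auto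
      moreover have "d (act s (act a x)) y \<le> d (act s (act a x)) (act s y1) + d (act s y1) y"
        using ac y1 jump by (intro d_triangle) auto
      ultimately have "d (act (s \<otimes> a) x) y < \<eta>" using ac y1 by (simp add: act_mult)
      moreover have "s \<otimes> a \<in> gball (Suc n)" using gball_mult[OF gens_gball[of s 0] a(1)] jump by simp
      ultimately show ?thesis by blast
    qed simp
  qed
  then show ?case using \<kappa>2(1) Suc.prems by (intro exI[of _ "min \<kappa>2 (\<eta> / 2)"]) auto
qed

end

section \<open>Normal forms of paths in a level set\<close>

text \<open>Dyadic sampling fits \<open>+++\<close>, which runs through both paths at double speed:
  at level \<open>Suc N\<close> a joined path consists of the samples of its parts at level
  \<open>N\<close>.\<close>

definition samples :: "nat \<Rightarrow> (real \<Rightarrow> 'a) \<Rightarrow> 'a list" where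
  "samples N p = map (\<lambda>i. p (real i / 2 ^ N)) [0..<Suc (2 ^ N)]"

lemma samples_length [simp]: "length (samples N p) = Suc (2 ^ N)"
  by (simp add: samples_def)

lemma samples_nth: "i \<le> 2 ^ N \<Longrightarrow> samples N p ! i = p (real i / 2 ^ N)"
  by (simp add: samples_def less_Suc_eq_le del: upt_Suc)

lemma samples_not_Nil [simp]: "samples N p \<noteq> []"
  by (simp add: samples_def)

lemma samples_hd [simp]: "hd (samples N p) = p 0"
  using samples_nth[of 0 N p] by (simp add: hd_conv_nth)

lemma samples_last [simp]: "last (samples N p) = p 1"
  using samples_nth[of "2 ^ N" N p] by (simp add: last_conv_nth)

lemma samples_Cons: "samples N p = p 0 # tl (samples N p)"
  using samples_hd by (metis list.collapse samples_not_Nil)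

lemma samples_set: "set (samples N p) \<subseteq> p ` {0..1}"
proof
  fix v assume "v \<in> set (samples N p)"
  then obtain i where "i \<le> 2 ^ N" "v = p (real i / 2 ^ N)"
    by (auto simp: samples_def less_Suc_eq_le simp del: upt_Suc)
  moreover from this have "real i / 2 ^ N \<in> {0..1}"
    by (simp add: divide_le_eq)
  ultimately show "v \<in> p ` {0..1}" by blast
qed

lemma samples_const: "samples N (\<lambda>_. x) = replicate (Suc (2 ^ N)) x"
  by (rule nth_equalityI) (simp_all add: samples_nth less_Suc_eq_le del: replicate_Suc)

lemma samples_comp: "samples N (f \<circ> p) = map f (samples N p)"
  by (simp add: samples_def)

lemma samples_joinpaths:
  assumes "pathfinish p = pathstart q"
  shows "samples (Suc N) (p +++ q) = samples N p @ tl (samples N q)"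
proof (rule nth_equalityI)
  show "length (samples (Suc N) (p +++ q)) = length (samples N p @ tl (samples N q))" by simp
  fix i assume "i < length (samples (Suc N) (p +++ q))"
  then have i: "i \<le> 2 ^ Suc N" by simp
  then have l: "samples (Suc N) (p +++ q) ! i = (p +++ q) (real i / 2 ^ Suc N)" by (rule samples_nth)
  show "samples (Suc N) (p +++ q) ! i = (samples N p @ tl (samples N q)) ! i"
  proof (cases "i \<le> 2 ^ N")
    case True
    then have "real i \<le> 2 ^ N" by (metis of_nat_le_iff of_nat_numeral of_nat_power)
    then have "real i / 2 ^ Suc N \<le> 1 / 2" by (simp add: divide_le_eq)
    then have "(p +++ q) (real i / 2 ^ Suc N) = p (real i / 2 ^ N)" by (simp add: joinpaths_def)
    then show ?thesis using l True by (simp add: nth_append less_Suc_eq_le samples_nth)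
  next
    case False
    then obtain j where j: "i = 2 ^ N + Suc j" by (metis add_Suc_right less_iff_Suc_add not_le)
    then have j2: "Suc j \<le> 2 ^ N" using i by simp
    have "\<not> real i / 2 ^ Suc N \<le> 1 / 2" by (simp add: j field_simps)
    moreover have "2 * (real i / 2 ^ Suc N) - 1 = real (Suc j) / 2 ^ N" by (simp add: j field_simps)
    ultimately have "(p +++ q) (real i / 2 ^ Suc N) = q (real (Suc j) / 2 ^ N)" by (simp only: joinpaths_def if_False)
    moreover have "(samples N p @ tl (samples N q)) ! i = samples N q ! Suc j"
      using j2 by (simp add: nth_append j nth_tl)
    ultimately show ?thesis using l samples_nth[OF j2, of q] by simp
  qed
qed

lemma (in compact_length_space) samples_fine:
  assumes "path p" "path_image p \<subseteq> M" "0 < e"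
  shows "\<forall>\<^sub>F N in sequentially. \<forall>i<2 ^ N. d (p (real i / 2 ^ N)) (p (real (Suc i) / 2 ^ N)) < e"
proof -
  obtain \<kappa> where \<kappa>: "0 < \<kappa>" "\<And>a b. a \<in> {0..1} \<Longrightarrow> b \<in> {0..1} \<Longrightarrow> dist a b < \<kappa> \<Longrightarrow> d (p a) (p b) < e"
    using uniformly_close_dist[of "{0..1}" p e] assms by (auto simp: path_def path_image_def)
  have "(\<lambda>N. (1 / 2) ^ N :: real) \<longlonglongrightarrow> 0" by (rule LIMSEQ_power_zero) simp
  then have "\<forall>\<^sub>F N in sequentially. (1 / 2 :: real) ^ N < \<kappa>" using \<kappa>(1) by (rule order_tendstoD)
  then show ?thesis
  proof eventually_elim
    case (elim N)
    show ?case
    proof (intro allI impI \<kappa>(2))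
      fix i :: nat assume "i < 2 ^ N"
      then have "Suc i \<le> 2 ^ N" by simp
      then have "real (Suc i) \<le> 2 ^ N" by (metis of_nat_le_iff of_nat_numeral of_nat_power)
      then show "real i / 2 ^ N \<in> {0..1}" "real (Suc i) / 2 ^ N \<in> {0..1}"
        using \<open>i < 2 ^ N\<close> by (simp_all add: divide_le_eq)
      have "dist (real i / 2 ^ N) (real (Suc i) / 2 ^ N) = (1 / 2) ^ N"
        by (simp add: dist_real_def diff_divide_distrib[symmetric] power_divide)
      then show "dist (real i / 2 ^ N) (real (Suc i) / 2 ^ N) < \<kappa>" using elim by simp
    qed
  qed
qed

lemma (in theta_space) sim_snoc_last:
  assumes "zs \<in> paths"
  shows "sim (zs @ [last zs]) zs" "zs @ [last zs] \<in> paths"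
proof -
  have l: "[last zs] \<in> paths" using assms by (auto simp: paths_iff)
  have "sim (zs @ [last zs]) (zs @ tl [last zs])" by (rule sim_joint(1)[OF assms l]) (simp only: list.sel)
  then show "sim (zs @ [last zs]) zs" unfolding list.sel append_Nil2 .
  show "zs @ [last zs] \<in> paths" by (rule sim_joint(3)[OF assms l]) (simp only: list.sel)
qed

text \<open>Every point of \<open>L\<close> is adjacent to the apex \<open>last zs\<close>, so the
  points before the last one are inserted one at a time by filling triangles at the apex.\<close>

lemma (in theta_space) sim_fan:
  assumes "zs \<in> paths" "zs @ L \<in> paths" "L \<noteq> []" "\<And>v. v \<in> set L \<Longrightarrow> adj (last zs) v"
  shows "sim (zs @ [last L]) (zs @ L)"
proof -
  obtain us y where zs: "zs = us @ [y]" using assms(1) by (metis paths_iff append_butlast_last_id)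
  have "sim (us @ [y, last L]) (us @ [y] @ L)"
    using assms(3,2,4) unfolding zs
  proof (induction L rule: list_nonempty_induct)
    case (cons l L)
    then have p: "us @ [y, l, hd L] @ tl L \<in> paths" by simp
    have "us @ [y] @ L \<in> paths" using cons.prems cons.hyps
      by (auto simp: paths_iff successively_append_iff successively_Cons)
    then have "sim (us @ [y, last L]) (us @ [y] @ L)" using cons by simp
    also have "sim (us @ [y] @ L) (us @ [y, l] @ L)"
      using sim_triangle[OF p] cons by simp
    finally show ?case using cons.hyps by simp
  qed simp
  then show ?thesis using zs by simp
qed

text \<open>\<open>k x y\<close> is the inverse of the group element that carries \<open>x\<close> close to \<open>y\<close>, so that it multiplies in
  the order of concatenation.\<close>

locale level_set = free_action M d G S act + flat_connection M \<delta> \<theta> G k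
  for M :: "'m::t2_space set" and d and G :: "('g, 'b) monoid_scheme" (structure)
    and S and act and \<delta> :: "'m \<Rightarrow> 'm \<Rightarrow> real" and \<theta> and k +
  fixes t \<mu> :: real and K :: nat
  assumes t: "0 < t" and \<mu>: "0 < \<mu>" and theta_large: "2 \<le> \<theta>" "real K \<le> \<theta>"
    and \<delta>_le: "x \<in> M \<Longrightarrow> y \<in> M \<Longrightarrow> \<delta> x y \<le> t * d x y"
    and \<delta>_chain_le: "chain n m x y \<Longrightarrow> \<delta> x y \<le> n + t * m"
    and \<delta>_chain: "x \<in> M \<Longrightarrow> y \<in> M \<Longrightarrow> \<delta> x y < c \<Longrightarrow> \<exists>n m. chain n m x y \<and> n + t * m < c"
    and fine: "x \<in> M \<Longrightarrow> y \<in> M \<Longrightarrow> d x y < \<mu> \<Longrightarrow> \<delta> x y \<le> 1 \<and> k x y = \<one>"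
    and k_jump: "x \<in> M \<Longrightarrow> s \<in> gens \<Longrightarrow> k x (act (inv s) x) = s"
    and relations: "w \<in> lists gens \<Longrightarrow> lprod w = \<one> \<Longrightarrow> equivclp (deletion gens K) w []"
    and simply_connected: "trivial_fundamental_group M"
begin

lemma \<delta>_jump: "x \<in> M \<Longrightarrow> s \<in> gens \<Longrightarrow> \<delta> x (act s x) \<le> 1"
proof -
  assume x: "x \<in> M" and s: "s \<in> gens"
  have "chain 0 0 x x" using x d_self by (simp add: chain.move)
  then have "chain (Suc 0) (0 + 0) x (act s x)"
    by (rule chain.jump[of _ _ _ _ s]) (use x s d_self in auto)
  from \<delta>_chain_le[OF this] show ?thesis by simp
qed

lemma \<delta>_inv_jump: "x \<in> M \<Longrightarrow> s \<in> gens \<Longrightarrow> \<delta> x (act (inv s) x) \<le> 1"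
  using \<delta>_jump gens(3) by blast

text \<open>At this scale a sampling step has \<delta> at most 1 and trivial \<open>k\<close>. The
  bound 1 leaves room for a jump within the same \<theta>-step, as \<theta> is at least 2.\<close>

definition fine_path :: "nat \<Rightarrow> (real \<Rightarrow> 'm) \<Rightarrow> bool" where
  "fine_path N p \<longleftrightarrow> p ` {0..1} \<subseteq> M \<and> (\<forall>i<2 ^ N. d (p (real i / 2 ^ N)) (p (real (Suc i) / 2 ^ N)) < \<mu>)"

lemma fine_path_eventually:
  "path p \<Longrightarrow> path_image p \<subseteq> M \<Longrightarrow> \<forall>\<^sub>F N in sequentially. fine_path N p"
  using samples_fine[OF _ _ \<mu>, of p] by (auto simp: fine_path_def path_image_def elim: eventually_mono)

lemma fine_path_M: "fine_path N p \<Longrightarrow> v \<in> set (samples N p) \<Longrightarrow> v \<in> M"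
  using samples_set by (force simp: fine_path_def)

lemma fine_path_step:
  assumes "fine_path N p" "i < 2 ^ N"
  shows "samples N p ! i \<in> M" "samples N p ! Suc i \<in> M"
    "\<delta> (samples N p ! i) (samples N p ! Suc i) \<le> 1" "k (samples N p ! i) (samples N p ! Suc i) = \<one>"
proof -
  show M: "samples N p ! i \<in> M" "samples N p ! Suc i \<in> M"
    using assms by (auto intro!: fine_path_M[OF assms(1)] nth_mem)
  have "d (samples N p ! i) (samples N p ! Suc i) < \<mu>"
    using assms by (simp add: fine_path_def samples_nth)
  with fine[OF M] show "\<delta> (samples N p ! i) (samples N p ! Suc i) \<le> 1" "k (samples N p ! i) (samples N p ! Suc i) = \<one>"
    by auto
qed

lemma fine_path_paths: "fine_path N p \<Longrightarrow> samples N p \<in> paths"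
  using fine_path_M fine_path_step(3) theta_large(1)
  by (fastforce simp: theta_paths_def)

lemma fine_path_holonomy:
  assumes "fine_path N p"
  shows "holonomy (samples N p) = \<one>"
proof -
  have "transport ((!) (samples N p)) i = \<one>" if "i \<le> 2 ^ N" for i
    using that by (induction i) (auto simp: fine_path_step(4)[OF assms])
  then show ?thesis by (simp add: holonomy_def)
qed

section \<open>Orbit paths of words\<close>

text \<open>Letters act by their inverses to match \<open>k x (act (inv s) x) = s\<close>. The
  holonomy is then \<open>lprod w\<close> in the order of the word, and the path ends at the image
  of \<open>x\<close> under \<open>inv (lprod w)\<close>.\<close>

primrec orbit_path :: "'m \<Rightarrow> 'g list \<Rightarrow> 'm list" where
  "orbit_path x [] = [x]"
| "orbit_path x (s # w) = x # orbit_path (act (inv s) x) w"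

lemma orbit_path_not_Nil [simp]: "orbit_path x w \<noteq> []"
  by (cases w) auto

lemma orbit_path_hd [simp]: "hd (orbit_path x w) = x"
  by (cases w) auto

lemma orbit_path_last: "x \<in> M \<Longrightarrow> w \<in> lists gens \<Longrightarrow> last (orbit_path x w) = act (inv (lprod w)) x"
proof (induction w arbitrary: x)
  case (Cons s w)
  then have "lprod w \<in> carrier G" "s \<in> carrier G" using gens_lists by auto
  then show ?case using Cons by (simp add: inv_mult_group act_mult)
qed simp

lemma orbit_path_paths: "x \<in> M \<Longrightarrow> w \<in> lists gens \<Longrightarrow> orbit_path x w \<in> paths"
proof (induction w arbitrary: x)
  case (Cons s w)
  then have "orbit_path (act (inv s) x) w \<in> paths" "\<delta> x (act (inv s) x) \<le> \<theta>"
    using \<delta>_inv_jump[of x s] theta_large(1) by auto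
  then show ?case using Cons.prems by (simp add: paths_iff successively_Cons)
qed (simp add: paths_iff)

lemma orbit_path_holonomy: "x \<in> M \<Longrightarrow> w \<in> lists gens \<Longrightarrow> holonomy (orbit_path x w) = lprod w"
proof (induction w arbitrary: x)
  case (Cons s w)
  then show ?case using holonomy_append[of "[x]" "orbit_path (act (inv s) x) w"] k_jump[of x s] by simp
qed simp

lemma orbit_path_append:
  "x \<in> M \<Longrightarrow> u \<in> lists gens \<Longrightarrow> v \<in> lists gens \<Longrightarrow>
    orbit_path x (u @ v) = orbit_path x u @ tl (orbit_path (last (orbit_path x u)) v)"
proof (induction u arbitrary: x)
  case Nil
  then show ?case by (cases v) auto
qed simp

lemma orbit_path_near: "x \<in> M \<Longrightarrow> w \<in> lists gens \<Longrightarrow> y \<in> set (orbit_path x w) \<Longrightarrow> \<delta> x y \<le> length w"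
proof (induction w arbitrary: x)
  case (Cons s w)
  have M: "act (inv s) x \<in> M" using Cons.prems by simp
  show ?case
  proof (cases "y = x")
    case False
    then have y: "y \<in> set (orbit_path (act (inv s) x) w)" using Cons.prems by simp
    then have "y \<in> M" using orbit_path_paths[OF M] Cons.prems by (auto simp: paths_iff)
    then show ?thesis
      using triangle[of x "act (inv s) x" y] Cons.IH[OF M _ y] \<delta>_inv_jump[of x s] Cons.prems by simp
  qed (use Cons.prems in simp)
qed simp

text \<open>The removed word spells a loop at \<open>e\<close> because its product is one. All
  points of the loop are within \<open>length r \<le> K \<le> \<theta>\<close> of \<open>e\<close>,
  so a fan with apex \<open>e\<close> collapses it.\<close>

lemma orbit_path_deletion:
  assumes x: "x \<in> M" and del: "deletion gens K w w'"
  shows "sim (orbit_path x w) (orbit_path x w')"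
proof -
  obtain u r v where w: "u \<in> lists gens" "r \<in> lists gens" "v \<in> lists gens" "lprod r = \<one>" "length r \<le> K"
    "w = u @ r @ v" "w' = u @ v" using del unfolding deletion_def by blast
  show ?thesis
  proof (cases "r = []")
    case False
    define e where "e = last (orbit_path x u)"
    define L where "L = tl (orbit_path e r)"
    define V where "V = tl (orbit_path e v)"
    have pu: "orbit_path x u \<in> paths" using orbit_path_paths[OF x w(1)] .
    have e: "e \<in> M" unfolding e_def using pu by (auto simp: paths_iff)
    have L: "L \<noteq> []" using False by (cases r) (auto simp: L_def)
    have lastr: "last (orbit_path e r) = e" using orbit_path_last[OF e w(2)] w(4) e by simp
    then have lastL: "last L = e" using L by (simp add: L_def last_tl)
    have eq: "orbit_path x w = orbit_path x u @ L @ V" "orbit_path x w' = orbit_path x u @ V"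
      unfolding w(6,7) using orbit_path_append[OF x w(1)] orbit_path_append[OF e w(2,3)] w lastr
      by (simp_all add: e_def[symmetric] L_def V_def tl_append split: list.split) 
    have p: "orbit_path x u @ L @ V \<in> paths" "orbit_path x u @ V \<in> paths"
      using orbit_path_paths[OF x, of w] orbit_path_paths[OF x, of w'] w eq by auto
    have pL: "orbit_path x u @ L \<in> paths"
      using p(1) L by (auto simp: paths_iff successively_append_iff)
    have fan: "sim (orbit_path x u @ [e]) (orbit_path x u @ L)"
      unfolding lastL[symmetric]
    proof (rule sim_fan[OF pu pL L])
      fix y assume "y \<in> set L"
      then have "y \<in> set (orbit_path e r)" by (cases r) (auto simp: L_def)
      then show "adj (last (orbit_path x u)) y"
        using orbit_path_near[OF e w(2)] w(5) theta_large(2) unfolding e_def[symmetric] by fastforce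
    qed
    have "[e] \<in> paths" using e by (simp add: paths_iff)
    then have "sim (orbit_path x u @ [e]) (orbit_path x u @ tl [e])"
      by (rule sim_joint(1)[OF pu]) (simp only: e_def list.sel)
    then have "sim (orbit_path x u @ [e]) (orbit_path x u)" unfolding list.sel append_Nil2 .
    from sim_trans[OF sim_sym[OF this] fan] have "sim (orbit_path x u) (orbit_path x u @ L)" .
    from sim_context_right[OF this pu p(2)] have "sim (orbit_path x u @ V) ((orbit_path x u @ L) @ V)" .
    from sim_sym[OF this] show ?thesis unfolding eq append_assoc .
  qed (use w in simp)
qed

lemma orbit_path_contract:
  assumes "x \<in> M" "w \<in> lists gens" "lprod w = \<one>"
  shows "sim (orbit_path x w) [x]"
proof -
  have "sim (orbit_path x w) (orbit_path x v)" if "equivclp (deletion gens K) w v" for v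
    using that
  proof (induction rule: equivclp_induct)
    case (step y z)
    from step.hyps(2) have "sim (orbit_path x y) (orbit_path x z)"
      by (elim disjE) (rule orbit_path_deletion[OF assms(1)] sim_sym[OF orbit_path_deletion[OF assms(1)]], assumption)+
    with step.IH show ?case by (rule sim_trans)
  qed simp
  from this[OF relations[OF assms(2,3)]] show ?thesis by simp
qed

text \<open>Both parameters of the null-homotopy are sampled at level \<open>N\<close>. Consecutive
  rows differ by one row move, and the last row is a repeated point. Covering all large
  \<open>N\<close> makes the result compatible with other conditions on the level.\<close>

lemma loop_contract:
  assumes p: "path p" "path_image p \<subseteq> M" "pathstart p = x" "pathfinish p = x"
  shows "\<forall>\<^sub>F N in sequentially. sim (samples N p) [x]"
proof -
  have x: "x \<in> M" using p by (metis pathstart_in_path_image subsetD)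
  have "homotopic_paths M p (\<lambda>_. x)"
    using simply_connected p x unfolding trivial_fundamental_group_def by blast
  then obtain h :: "real \<times> real \<Rightarrow> 'm" where h0: "continuous_on ({0..1} \<times> {0..1}) h" "h \<in> ({0..1} \<times> {0..1}) \<rightarrow> M"
    "\<forall>s\<in>{0..1}. h (0, s) = p s" "\<forall>s\<in>{0..1}. h (1, s) = x"
    "\<forall>r\<in>{0..1}. pathstart (h \<circ> Pair r) = pathstart p \<and> pathfinish (h \<circ> Pair r) = pathfinish p"
    unfolding homotopic_paths by (elim exE conjE)
  have h: "continuous_on ({0..1} \<times> {0..1}) h" "h ` ({0..1} \<times> {0..1}) \<subseteq> M"
    "\<And>s. s \<in> {0..1} \<Longrightarrow> h (0, s) = p s" "\<And>s. s \<in> {0..1} \<Longrightarrow> h (1, s) = x"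
    "\<And>r. r \<in> {0..1} \<Longrightarrow> h (r, 0) = x" "\<And>r. r \<in> {0..1} \<Longrightarrow> h (r, 1) = x"
    using h0 p(3,4) by (auto simp: pathstart_def pathfinish_def)
  obtain \<kappa> where \<kappa>: "0 < \<kappa>" "\<And>a b. a \<in> {0..1} \<times> {0..1} \<Longrightarrow> b \<in> {0..1} \<times> {0..1} \<Longrightarrow> dist a b < \<kappa> \<Longrightarrow> d (h a) (h b) < \<mu>"
    using uniformly_close_dist[OF compact_Times[OF compact_Icc compact_Icc] h(1,2) \<mu>] by blast
  have "(\<lambda>N. (1 / 2) ^ N :: real) \<longlonglongrightarrow> 0" by (rule LIMSEQ_power_zero) simp
  then have "\<forall>\<^sub>F N in sequentially. (1 / 2 :: real) ^ N < \<kappa>" using \<kappa>(1) by (rule order_tendstoD)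
  then show ?thesis
  proof eventually_elim
    case (elim N)
    define q where "q j s = h (real j / 2 ^ N, s)" for j s
    have grid: "real i / 2 ^ N \<in> {0..1}" if "i \<le> 2 ^ N" for i
    proof -
      have "real i \<le> 2 ^ N" using that by (metis of_nat_le_iff of_nat_numeral of_nat_power)
      then show ?thesis by (simp add: divide_le_eq)
    qed
    have close: "dist (real i / 2 ^ N) (real (Suc i) / 2 ^ N) < \<kappa>" for i
      using elim by (simp add: dist_real_def diff_divide_distrib[symmetric] power_divide)
    have fp: "fine_path N (q j)" if "j \<le> 2 ^ N" for j
      unfolding fine_path_def
    proof (intro conjI allI impI)
      show "q j ` {0..1} \<subseteq> M" using h(2) grid[OF that] by (auto simp: q_def image_subset_iff)
      fix i :: nat assume "i < 2 ^ N"
      then show "d (q j (real i / 2 ^ N)) (q j (real (Suc i) / 2 ^ N)) < \<mu>"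
        unfolding q_def using grid[OF that] grid[of i] grid[of "Suc i"] close[of i]
        by (intro \<kappa>(2)) (auto simp: dist_Pair_Pair simp del: of_nat_Suc)
    qed
    have "sim (samples N (q 0)) (samples N (q j))" if "j \<le> 2 ^ N" for j
      using that
    proof (induction j)
      case (Suc j)
      have "list_all2 adj (samples N (q j)) (samples N (q (Suc j)))"
        unfolding list_all2_conv_all_nth
      proof (intro conjI allI impI)
        fix i assume "i < length (samples N (q j))"
        then have i: "i \<le> 2 ^ N" by simp
        have "d (q j (real i / 2 ^ N)) (q (Suc j) (real i / 2 ^ N)) < \<mu>"
          unfolding q_def using grid[OF i] grid[of j] grid[of "Suc j"] Suc.prems close[of j]
          by (intro \<kappa>(2)) (auto simp: dist_Pair_Pair)
        moreover have "q j (real i / 2 ^ N) \<in> M" "q (Suc j) (real i / 2 ^ N) \<in> M"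
          unfolding q_def using h(2) grid[OF i] grid[of j] grid[of "Suc j"] Suc.prems by auto
        ultimately show "adj (samples N (q j) ! i) (samples N (q (Suc j)) ! i)"
          using fine theta_large(1) by (force simp: samples_nth[OF i])
      qed simp
      moreover have "q j 0 = x" "q (Suc j) 0 = x" "q j 1 = x" "q (Suc j) 1 = x"
        unfolding q_def using h(5,6) grid[of j] grid[of "Suc j"] Suc.prems by auto
      ultimately have "row (samples N (q j)) (samples N (q (Suc j)))"
        using fine_path_paths[OF fp, of j] fine_path_paths[OF fp, of "Suc j"] Suc.prems by (simp add: row_def)
      then have jj: "sim (samples N (q j)) (samples N (q (Suc j)))" by (rule row_sim)
      have "sim (samples N (q 0)) (samples N (q j))" using Suc by simp
      from sim_trans[OF this jj] show ?case .
    qed simp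
    from this[of "2 ^ N"] have "sim (samples N (q 0)) (samples N (q (2 ^ N)))" by simp
    moreover have "samples N (q 0) = samples N p"
      by (rule nth_equalityI) (auto simp: samples_nth less_Suc_eq_le q_def h(3) grid)
    moreover have "samples N (q (2 ^ N)) = replicate (Suc (2 ^ N)) x"
      by (rule nth_equalityI) (auto simp: samples_nth less_Suc_eq_le q_def h(4) grid simp del: replicate_Suc)
    ultimately have "sim (samples N p) (replicate (Suc (2 ^ N)) x)" by simp
    from sim_trans[OF this sim_sym[OF sim_replicate[OF x]]] show ?case .
  qed
qed

section \<open>Normal forms: an orbit path followed by a sampled curve\<close>

text \<open>Word and curve are fixed while the sampling level is only required to be large. The
  level can thus change when curves are joined, and finitely many conditions on it can be met at
  once.\<close>

definition normalizes :: "'m \<Rightarrow> 'm list \<Rightarrow> bool" where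
  "normalizes x zs \<longleftrightarrow> (\<exists>w p. w \<in> lists gens \<and> path p \<and> path_image p \<subseteq> M \<and>
     pathstart p = last (orbit_path x w) \<and> pathfinish p = last zs \<and>
     (\<forall>\<^sub>F N in sequentially. sim (orbit_path x w @ samples N p) zs))"

lemma normal_paths:
  assumes "x \<in> M" "w \<in> lists gens" "pathstart p = last (orbit_path x w)" "fine_path N p"
  shows "orbit_path x w @ samples N p \<in> paths"
  using sim_joint(3)[OF orbit_path_paths[OF assms(1,2)] fine_path_paths[OF assms(4)]] assms(3)
  by (simp add: pathstart_def)

lemma normalizes_single:
  assumes x: "x \<in> M"
  shows "normalizes x [x]"
proof -
  have "sim (orbit_path x [] @ samples N (\<lambda>_. x)) [x]" for N
    using sim_sym[OF sim_replicate[OF x, of "Suc (2 ^ N)"]] by (simp add: samples_const)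
  then show ?thesis
    unfolding normalizes_def using x
    by (intro exI[of _ "[]"] exI[of _ "\<lambda>_. x"]) (auto simp: path_def path_image_def pathstart_def pathfinish_def)
qed

lemma normalizes_sim:
  assumes "normalizes x zs" "sim zs ws" "zs \<in> paths"
  shows "normalizes x ws"
proof -
  obtain w p where wp: "w \<in> lists gens" "path p" "path_image p \<subseteq> M" "pathstart p = last (orbit_path x w)"
    "pathfinish p = last zs" "\<forall>\<^sub>F N in sequentially. sim (orbit_path x w @ samples N p) zs"
    using assms(1) unfolding normalizes_def by (elim exE conjE)
  have "\<forall>\<^sub>F N in sequentially. sim (orbit_path x w @ samples N p) ws"
    using wp(6) by (rule eventually_mono) (rule sim_trans[OF _ assms(2)])
  moreover have "pathfinish p = last ws" using sim_ends[OF assms(2,3)] wp(5) by simp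
  ultimately show ?thesis unfolding normalizes_def using wp by (intro exI[of _ w] exI[of _ p] conjI)
qed

lemma normalizes_last:
  assumes "zs \<in> paths" "normalizes x zs"
  shows "normalizes x (zs @ [last zs])"
  by (rule normalizes_sim[OF assms(2) sim_sym[OF sim_snoc_last(1)[OF assms(1)]] assms(1)])

text \<open>The appended point slides along \<open>q\<close> while \<open>zs\<close> stays fixed. As
  all of \<open>q\<close> is adjacent to \<open>last zs\<close>, a fan replaces the single step to
  the end of \<open>q\<close> by the sampled curve, which is absorbed into
  \<open>p +++ q\<close>.\<close>

lemma normalizes_curve:
  assumes x: "x \<in> M" and nf: "normalizes x (zs @ [pathstart q])"
    and zs: "zs \<in> paths" "zs @ [pathstart q] \<in> paths"
    and q: "path q" "path_image q \<subseteq> M" "\<And>v. v \<in> path_image q \<Longrightarrow> adj (last zs) v"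
  shows "normalizes x (zs @ [pathfinish q])" "zs @ [pathfinish q] \<in> paths"
proof -
  obtain w p where wp: "w \<in> lists gens" "path p" "path_image p \<subseteq> M" "pathstart p = last (orbit_path x w)"
    "pathfinish p = pathstart q" "\<forall>\<^sub>F N in sequentially. sim (orbit_path x w @ samples N p) (zs @ [pathstart q])"
    using nf unfolding normalizes_def last_snoc by (elim exE conjE)
  have ev: "\<forall>\<^sub>F N in sequentially. sim (orbit_path x w @ samples (Suc N) (p +++ q)) (zs @ [pathfinish q])"
    using wp(6) fine_path_eventually[OF wp(2,3)] fine_path_eventually[OF q(1,2)]
  proof eventually_elim
    case (elim N)
    let ?Q = "samples N q"
    have b: "?Q = pathstart q # tl ?Q" using samples_Cons[of N q] by (simp add: pathstart_def)
    have Q: "?Q \<in> paths" by (rule fine_path_paths[OF elim(3)])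
    note o = normal_paths[OF x wp(1,4) elim(2)]
    have last_o: "last (orbit_path x w @ samples N p) = hd ?Q"
      using wp(5) by (simp add: pathstart_def pathfinish_def)
    have o': "(orbit_path x w @ samples N p) @ tl ?Q \<in> paths"
      by (rule sim_joint(2)[OF o Q last_o])
    from sim_context_right[OF elim(1) o o']
    have 1: "sim ((orbit_path x w @ samples N p) @ tl ?Q) (zs @ ?Q)" using b by simp
    have zsQ: "zs @ ?Q \<in> paths" using sim_joint(2)[OF zs(2) Q] b by (simp add: pathstart_def)
    have "sim (zs @ [last ?Q]) (zs @ ?Q)"
    proof (rule sim_fan[OF zs(1) zsQ samples_not_Nil])
      fix v assume "v \<in> set ?Q"
      then show "adj (last zs) v" using samples_set[of N q] by (intro q(3)) (auto simp: path_image_def)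
    qed
    then have "sim (zs @ [pathfinish q]) (zs @ ?Q)" by (simp add: pathfinish_def)
    from sim_trans[OF 1 sim_sym[OF this]] show ?case
      by (simp add: samples_joinpaths[OF wp(5)])
  qed
  \<comment> \<open>Joining raised the level by one; a statement about all large levels is
    insensitive to this shift.\<close>
  then have "\<forall>\<^sub>F N in sequentially. sim (orbit_path x w @ samples N (p +++ q)) (zs @ [pathfinish q])"
    unfolding eventually_sequentially_Suc[of "\<lambda>N. sim (orbit_path x w @ samples N (p +++ q)) (zs @ [pathfinish q])"] .
  moreover have "path (p +++ q)" "path_image (p +++ q) \<subseteq> M"
    using wp q path_image_join_subset[of p q] by auto
  ultimately show "normalizes x (zs @ [pathfinish q])"
    unfolding normalizes_def using wp by (intro exI[of _ w] exI[of _ "p +++ q"]) simp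
  have "pathfinish q \<in> M" "adj (last zs) (pathfinish q)" using q by auto
  then show "zs @ [pathfinish q] \<in> paths" using zs(1) by (auto simp: paths_iff successively_append_iff)
qed

text \<open>Following the curve and then jumping is homotopic to jumping first and following the
  image curve. The two sampled paths are matched with a shift by one: point \<open>j + 1\<close> of
  the curve faces the image of point \<open>j\<close>, at distance at most \<open>1 + 1\<close>,
  which is within \<theta>.\<close>

lemma normalizes_jump:
  assumes x: "x \<in> M" and nf: "normalizes x (zs @ [b])" and s: "s \<in> gens"
    and zs: "zs \<in> paths" "zs @ [b] \<in> paths" "adj (last zs) (act (inv s) b)"
  shows "normalizes x (zs @ [act (inv s) b])" "zs @ [act (inv s) b] \<in> paths"
proof -
  define c where "c = act (inv s)"
  have sc: "s \<in> carrier G" "inv s \<in> gens" "inv s \<in> carrier G" using s gens(3) by auto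
  have bM: "b \<in> M" using zs(2) by (auto simp: paths_iff)
  have cM: "c y \<in> M" if "y \<in> M" for y using that sc by (simp add: c_def)
  have jump: "\<delta> y (c y) \<le> 1" if "y \<in> M" for y using \<delta>_inv_jump[OF that s] by (simp add: c_def)
  obtain w p where wp: "w \<in> lists gens" "path p" "path_image p \<subseteq> M" "pathstart p = last (orbit_path x w)"
    "pathfinish p = b" "\<forall>\<^sub>F N in sequentially. sim (orbit_path x w @ samples N p) (zs @ [b])"
    using nf unfolding normalizes_def last_snoc by (elim exE conjE)
  let ?o = "orbit_path x w"
  have lo: "last ?o \<in> M" using orbit_path_paths[OF x wp(1)] by (auto simp: paths_iff)
  have o': "orbit_path x (w @ [s]) = ?o @ [c (last ?o)]"
    using orbit_path_append[OF x wp(1), of "[s]"] s by (simp add: c_def)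
  have cp: "path (c \<circ> p)" "path_image (c \<circ> p) \<subseteq> M"
  proof -
    show "path (c \<circ> p)"
      unfolding path_def o_def c_def
      by (rule continuous_on_compose2[OF act_continuous[OF sc(3)]])
        (use wp(2,3) in \<open>auto simp: path_def path_image_def\<close>)
    show "path_image (c \<circ> p) \<subseteq> M" using wp(3) cM by (auto simp: path_image_def)
  qed
  have zsc: "zs @ [c b] \<in> paths" using zs cM[OF bM] by (auto simp: paths_iff successively_append_iff c_def)
  have "\<delta> b (c b) \<le> \<theta>" using jump[OF bM] theta_large(1) by simp
  then have zsbc: "zs @ [b] @ [c b] \<in> paths" using zs cM[OF bM] by (auto simp: paths_iff successively_append_iff)
  have "\<forall>\<^sub>F N in sequentially. sim (orbit_path x (w @ [s]) @ samples N (c \<circ> p)) (zs @ [c b])"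
    using wp(6) fine_path_eventually[OF wp(2,3)] fine_path_eventually[OF cp]
  proof eventually_elim
    case (elim N)
    let ?L = "samples N p"
    have L: "?L \<in> paths" "map c ?L \<in> paths" using fine_path_paths[OF elim(2)] fine_path_paths[OF elim(3)]
      by (auto simp: samples_comp)
    note oL = normal_paths[OF x wp(1,4) elim(2)]
    have ends: "last ?L = b" "hd ?L = last ?o" using wp(4,5) by (simp_all add: pathstart_def pathfinish_def)
    have Lcb: "?L @ [c b] \<in> paths"
      using L ends cM[OF bM] \<open>\<delta> b (c b) \<le> \<theta>\<close> by (auto simp: paths_iff successively_append_iff)
    have "adj (hd ?L) (c (hd ?L))" using jump[OF lo] ends theta_large(1) by simp
    then have cL: "[last ?o] @ map c ?L \<in> paths"
      using L ends lo by (auto simp: paths_iff successively_Cons hd_map)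
    have "list_all2 adj (?L @ [c b]) ([last ?o] @ map c ?L)"
      unfolding list_all2_conv_all_nth
    proof (intro conjI allI impI)
      fix i assume "i < length (?L @ [c b])"
      then consider "i = 0" | j where "i = Suc j" "j < 2 ^ N" | "i = Suc (2 ^ N)"
        by (cases i) (auto simp: less_Suc_eq)
      then show "adj ((?L @ [c b]) ! i) (([last ?o] @ map c ?L) ! i)"
      proof cases
        case 1
        then show ?thesis using ends lo by (simp add: nth_append hd_conv_nth[symmetric])
      next
        case 2
        note st = fine_path_step[OF elim(2) 2(2)]
        have "\<delta> (?L ! Suc j) (c (?L ! j)) \<le> \<delta> (?L ! Suc j) (?L ! j) + \<delta> (?L ! j) (c (?L ! j))"
          by (rule triangle[OF st(2,1) cM[OF st(1)]])
        also have "\<dots> \<le> \<theta>" using st(3) jump[OF st(1)] theta_large(1) by (simp add: commute)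
        finally show ?thesis using 2 by (simp add: nth_append)
      next
        case 3
        then show ?thesis using ends cM[OF bM] samples_nth[of "2 ^ N" N p] by (simp add: nth_append)
      qed
    qed simp
    then have "row (?L @ [c b]) ([last ?o] @ map c ?L)"
      using Lcb cL ends by (simp add: row_def hd_append last_map)
    then have r: "sim (?L @ [c b]) ([last ?o] @ map c ?L)" by (rule row_sim)
    have oLcb: "?o @ ?L @ [c b] \<in> paths"
      using sim_joint(3)[OF orbit_path_paths[OF x wp(1)] Lcb] ends by (simp add: hd_append)
    from sim_context_left[OF r Lcb oLcb]
    have 1: "sim (?o @ ?L @ [c b]) (?o @ [last ?o] @ map c ?L)" .
    have p1: "?o @ [last ?o] @ map c ?L \<in> paths" using sim_ends[OF 1 oLcb] by simp
    have "(?o @ [last ?o]) @ map c ?L \<in> paths" using p1 by simp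
    from sim_context_right[OF sim_snoc_last[OF orbit_path_paths[OF x wp(1)]] this]
    have 2: "sim (?o @ [last ?o] @ map c ?L) (?o @ map c ?L)" by simp
    have hd: "hd (map c ?L) = c (last ?o)" using ends by (simp add: hd_map)
    then have m: "c (last ?o) # tl (map c ?L) = map c ?L" by (metis list.collapse list.map_disc_iff samples_not_Nil)
    have oc: "?o @ [c (last ?o)] \<in> paths"
      using orbit_path_paths[OF x, of "w @ [s]"] o' s wp(1) by simp
    have "sim ((?o @ [c (last ?o)]) @ map c ?L) ((?o @ [c (last ?o)]) @ tl (map c ?L))"
      by (rule sim_joint(1)[OF oc L(2)]) (simp only: hd last_snoc)
    then have 3: "sim (orbit_path x (w @ [s]) @ samples N (c \<circ> p)) (?o @ map c ?L)"
      unfolding o' samples_comp append_assoc append_Cons append_Nil m .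
    have 4: "sim (?o @ ?L @ [c b]) (zs @ [b] @ [c b])"
      using sim_context_right[OF elim(1) oL, of "[c b]"] oLcb by simp
    \<comment> \<open>The point \<open>b\<close> is dropped by a triangle, since
      \<open>last zs\<close> is adjacent to \<open>c b\<close>.\<close>
    have 5: "sim (zs @ [c b]) (zs @ [b] @ [c b])"
    proof -
      obtain us y where us: "zs = us @ [y]" using zs(1) by (metis paths_iff append_butlast_last_id)
      show ?thesis using sim_triangle[of us y b "c b" "[]"] zsbc zs(3) by (simp add: us c_def)
    qed
    show ?case
      by (rule sim_trans[OF 3 sim_trans[OF sim_sym[OF sim_trans[OF 1 2]] sim_trans[OF 4 sim_sym[OF 5]]]])
  qed
  moreover have "pathstart (c \<circ> p) = last (orbit_path x (w @ [s]))" "pathfinish (c \<circ> p) = c b"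
    using wp(4,5) by (simp_all add: o' pathstart_def pathfinish_def)
  ultimately show "normalizes x (zs @ [act (inv s) b])"
    unfolding normalizes_def using wp(1) s cp by (intro exI[of _ "w @ [s]"] exI[of _ "c \<circ> p"]) (simp add: c_def)
  show "zs @ [act (inv s) b] \<in> paths" using zsc by (simp add: c_def)
qed

text \<open>A nearly minimal curve from \<open>b\<close> to \<open>z\<close> costs less than the
  remaining budget \<open>\<theta> - c\<close>, so all its points stay within \<theta> of
  \<open>last zs\<close>.\<close>

lemma normalizes_d_curve:
  assumes x: "x \<in> M" and nf: "normalizes x (zs @ [b])" and zs: "zs \<in> paths" "zs @ [b] \<in> paths"
    and c: "\<delta> (last zs) b \<le> c" and z: "z \<in> M" "c + t * d b z < \<theta>"
  shows "normalizes x (zs @ [z])" "zs @ [z] \<in> paths"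
proof -
  have M: "b \<in> M" "last zs \<in> M" using zs by (auto simp: paths_iff)
  have "d b z < (\<theta> - c) / t" using z(2) t by (simp add: field_simps)
  from d_curve[OF M(1) z(1) this]
  obtain q F where q: "path q" "path_image q \<subseteq> M" "pathstart q = b" "pathfinish q = z"
    and "continuous_on {0..1} F"
    and F: "F 0 = 0" "F 1 < (\<theta> - c) / t" "\<forall>s\<in>{0..1}. \<forall>s'\<in>{0..1}. s \<le> s' \<longrightarrow> d (q s) (q s') \<le> F s' - F s"
    by (elim exE conjE)
  have "adj (last zs) v" if v: "v \<in> path_image q" for v
  proof -
    obtain s where s: "s \<in> {0..1}" "v = q s" using v by (auto simp: path_image_def)
    have qM: "q s \<in> M" "q 1 \<in> M" using q(2) s by (auto simp: path_image_def)
    have "d b v \<le> F s" using F(3)[rule_format, of 0 s] q(3) F(1) s by (simp add: pathstart_def)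
    also have "\<dots> \<le> F 1" using F(3)[rule_format, of s 1] s d_nonneg[OF qM] by simp
    finally have "t * d b v \<le> t * F 1" using t by simp
    moreover have "t * F 1 < \<theta> - c" using F(2) t by (simp add: field_simps)
    ultimately have "t * d b v \<le> \<theta> - c" by simp
    then show ?thesis
      using triangle[of "last zs" b v] M qM s c \<delta>_le[of b v] by simp
  qed
  from normalizes_curve[OF x _ zs(1) _ q(1,2) this] nf zs(2) q(3,4)
  show "normalizes x (zs @ [z])" "zs @ [z] \<in> paths" by simp_all
qed

text \<open>The path \<open>zs\<close> is kept and its appended point travels along the chain. Costs
  only accumulate, so a total below \<theta> keeps every intermediate point adjacent to
  \<open>last zs\<close>.\<close>

lemma normalizes_chain:
  assumes x: "x \<in> M" and zs: "zs \<in> paths" "normalizes x zs"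
    and c: "chain n m (last zs) z" "n + t * m < \<theta>"
  shows "normalizes x (zs @ [z]) \<and> zs @ [z] \<in> paths"
  using c
proof (induction n m "last zs" z rule: chain.induct)
  case (move z m)
  have "t * d (last zs) z \<le> t * m" using move t by simp
  then have "0 + t * d (last zs) z < \<theta>" using move by simp
  with normalizes_d_curve[OF x normalizes_last[OF zs] zs(1) sim_snoc_last(2)[OF zs(1)], of 0 z] move
  show ?case by simp
next
  case (jump n m y s z m')
  have M: "last zs \<in> M" "y \<in> M" using chain_props jump(1) by blast+
  have "0 \<le> t * m'" using d_nonneg[of "act s y" z] jump M t by simp
  then have lt: "n + t * m < \<theta>" "n + 1 + t * m < \<theta>" and lt2: "(n + 1 + t * m) + t * m' < \<theta>"
    using jump(6) by (simp_all add: algebra_simps)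
  note IH = jump(2)[OF lt(1)]
  have "\<delta> (last zs) y \<le> n + t * m" by (rule \<delta>_chain_le[OF jump(1)])
  then have \<delta>: "\<delta> (last zs) (act s y) \<le> n + 1 + t * m"
    using triangle[of "last zs" y "act s y"] \<delta>_jump[of y s] M jump by simp
  have "adj (last zs) (act (inv (inv s)) y)" using \<delta> lt(2) jump by simp
  with normalizes_jump[OF x _ gens(3)[OF jump(3)] zs(1)] IH jump(3)
  have nf: "normalizes x (zs @ [act s y])" "zs @ [act s y] \<in> paths" by auto
  have "t * d (act s y) z \<le> t * m'" using jump t by simp
  then have "(n + 1 + t * m) + t * d (act s y) z < \<theta>" using lt2 by simp
  with normalizes_d_curve[OF x nf(1) zs(1) nf(2) \<delta> jump(4)] show ?case by blast
qed

text \<open>A chain from \<open>last zs\<close> to \<open>z\<close> of cost slightly above \<open>\<theta>\<close> may leave the \<open>\<theta>\<close>-ball near its end: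
  the last part of its final curve is replaced by one step.\<close>

lemma normalizes_last_curve:
  assumes x: "x \<in> M" and nf: "normalizes x (zs @ [b])" and zs: "zs \<in> paths" "zs @ [b] \<in> paths"
    and c: "\<delta> (last zs) b \<le> c" "c < \<theta>" and z: "z \<in> M" "adj (last zs) z" "c + t * d b z < \<theta> + 1"
  shows "normalizes x (zs @ [z])"
proof -
  have M: "b \<in> M" "last zs \<in> M" using zs by (auto simp: paths_iff)
  have "d b z < (\<theta> + 1 - c) / t" using z(3) t by (simp add: field_simps)
  from d_curve[OF M(1) z(1) this]
  obtain q F where q: "path q" "path_image q \<subseteq> M" "pathstart q = b" "pathfinish q = z"
    and F: "continuous_on {0..1} F" "F 0 = 0" "F 1 < (\<theta> + 1 - c) / t"
      "\<forall>s\<in>{0..1}. \<forall>s'\<in>{0..1}. s \<le> s' \<longrightarrow> d (q s) (q s') \<le> F s' - F s"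
    by (elim exE conjE)
  have qM: "q s \<in> M" if "s \<in> {0..1}" for s using q(2) that by (auto simp: path_image_def)
  have Fmono: "F s \<le> F s'" if "s \<in> {0..1}" "s' \<in> {0..1}" "s \<le> s'" for s s'
    using F(4)[rule_format, OF that] d_nonneg[OF qM qM, of s s'] that by simp
  have F1: "c + t * F 1 < \<theta> + 1" using F(3) t by (simp add: field_simps)
  \<comment> \<open>The curve is cut where the accumulated cost reaches \<theta>. The total is below
    \<open>\<theta> + 1\<close>, so the rest costs at most 1. If \<theta> is not exceeded, the cut
    is at the end.\<close>
  obtain u where u: "u \<in> {0..1}" "c + t * F u \<le> \<theta>" "t * (F 1 - F u) \<le> 1"
  proof (cases "c + t * F 1 \<le> \<theta>")
    case True
    then show ?thesis using that[of 1] by simp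
  next
    case False
    have "\<exists>u\<ge>0. u \<le> 1 \<and> c + t * F u = \<theta>"
      by (rule IVT') (use F(1,2) c False in \<open>auto intro!: continuous_intros\<close>)
    then obtain u where "u \<in> {0..1}" "c + t * F u = \<theta>" by auto
    then show ?thesis using that[of u] F1 by (simp add: algebra_simps)
  qed
  define q1 q2 where "q1 s = q (u * s)" and "q2 s = q (u + (1 - u) * s)" for s
  have r1: "u * s \<in> {0..u} \<and> u * s \<in> {0..1}" if "s \<in> {0..1}" for s
    using that u(1) by (auto simp: mult_left_le mult_le_one)
  have r2: "u + (1 - u) * s \<in> {u..1} \<and> u + (1 - u) * s \<in> {0..1}" if "s \<in> {0..1}" for s
  proof -
    have "0 \<le> (1 - u) * s" "(1 - u) * s \<le> (1 - u) * 1"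
      using that u(1) by (auto intro!: mult_left_mono simp del: mult_1_right)
    then show ?thesis using u(1) by auto
  qed
  have q1: "path q1" "path_image q1 \<subseteq> M" "pathstart q1 = b" "pathfinish q1 = q u"
  proof -
    show "path q1" unfolding path_def q1_def
    proof (rule continuous_on_compose2[OF q(1)[unfolded path_def]])
      show "continuous_on {0..1} (\<lambda>s. u * s)" by (intro continuous_intros)
      show "(\<lambda>s. u * s) ` {0..1} \<subseteq> {0..1}" by (intro image_subsetI conjunct2[OF r1])
    qed
    show "path_image q1 \<subseteq> M" unfolding path_image_def q1_def by (intro image_subsetI qM conjunct2[OF r1])
  qed (use q(3) in \<open>simp_all add: q1_def pathstart_def pathfinish_def\<close>)
  have q2: "path q2" "path_image q2 \<subseteq> M" "pathstart q2 = q u" "pathfinish q2 = z"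
  proof -
    show "path q2" unfolding path_def q2_def
    proof (rule continuous_on_compose2[OF q(1)[unfolded path_def]])
      show "continuous_on {0..1} (\<lambda>s. u + (1 - u) * s)" by (intro continuous_intros)
      show "(\<lambda>s. u + (1 - u) * s) ` {0..1} \<subseteq> {0..1}" by (intro image_subsetI conjunct2[OF r2])
    qed
    show "path_image q2 \<subseteq> M" unfolding path_image_def q2_def by (intro image_subsetI qM conjunct2[OF r2])
  qed (use q(4) in \<open>simp_all add: q2_def pathstart_def pathfinish_def\<close>)
  have near1: "adj (last zs) v" if v: "v \<in> path_image q1" for v
  proof -
    obtain s where s: "s \<in> {0..u}" "v = q s" using v r1 unfolding path_image_def q1_def by blast
    then have s01: "s \<in> {0..1}" using u(1) by auto
    have "d b v \<le> F s" using F(4)[rule_format, of 0 s] q(3) F(2) s s01 by (simp add: pathstart_def)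
    also have "\<dots> \<le> F u" using Fmono[OF s01 u(1)] s by simp
    finally have "t * d b v \<le> t * F u" using t by simp
    then show ?thesis
      using triangle[of "last zs" b v] M qM[OF s01] s c(1) u(2) \<delta>_le[of b v] by simp
  qed
  have near2: "adj (q u) v" if v: "v \<in> path_image q2" for v
  proof -
    obtain s where s: "s \<in> {u..1}" "v = q s" using v r2 unfolding path_image_def q2_def by blast
    then have s01: "s \<in> {0..1}" using u(1) by auto
    have "d (q u) v \<le> F s - F u" using F(4)[rule_format, of u s] s s01 u(1) by simp
    also have "\<dots> \<le> F 1 - F u" using Fmono[OF s01] s by simp
    finally have "t * d (q u) v \<le> t * (F 1 - F u)" using t by simp
    then show ?thesis
      using qM[OF s01] qM[OF u(1)] s u(3) \<delta>_le[of "q u" v] theta_large(1) by simp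
  qed
  have n1: "normalizes x (zs @ [q u])" "zs @ [q u] \<in> paths"
    using normalizes_curve[OF x _ zs(1) _ q1(1,2) near1] nf zs(2) q1(3,4) by simp_all
  have n1': "normalizes x ((zs @ [q u]) @ [q u])" "(zs @ [q u]) @ [q u] \<in> paths"
    using normalizes_last[OF n1(2,1)] sim_snoc_last(2)[OF n1(2)] by simp_all
  have n2: "normalizes x ((zs @ [q u]) @ [z])" "(zs @ [q u]) @ [z] \<in> paths"
    using normalizes_curve[OF x _ n1(2) _ q2(1,2)] n1' near2 q2(3,4) by simp_all
  \<comment> \<open>The cut point is still an additional vertex; a triangle removes it because
    \<open>last zs\<close> is adjacent to \<open>z\<close>.\<close>
  obtain us y where us: "zs = us @ [y]" using zs(1) by (metis paths_iff append_butlast_last_id)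
  have "us @ [y, q u, z] @ [] \<in> paths" using n2(2) us by simp
  then have "sim (us @ [y, z] @ []) (us @ [y, q u, z] @ [])"
    by (rule sim_triangle) (use z(2) us in simp)
  then have "sim ((zs @ [q u]) @ [z]) (zs @ [z])" using us by (simp add: sim_sym[of "us @ [y, z]"])
  from normalizes_sim[OF n2(1) this n2(2)] show ?thesis .
qed

text \<open>A chain of cost below \<open>\<theta> + \<eta>\<close> is followed. If the point after
  its last jump is reached at cost below \<theta>, the final curve is cut. Otherwise the final move
  costs less than \<eta> and is exchanged with the last jump: carried back by \<open>inv s\<close>
  it is made before the jump, which then lands exactly at \<open>z\<close>.\<close>

lemma normalizes_snoc:
  assumes x: "x \<in> M" and nf: "normalizes x zs" and zs: "zs \<in> paths" and z: "z \<in> M" "adj (last zs) z"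
  shows "normalizes x (zs @ [z])"
proof -
  have lM: "last zs \<in> M" using zs by (auto simp: paths_iff)
  \<comment> \<open>This controls the distortion of the final move: carried back through a jump it
    costs less than 1/2.\<close>
  obtain \<eta>1 where \<eta>1: "0 < \<eta>1" "\<forall>a\<in>gens. \<forall>x\<in>M. \<forall>y\<in>M. d x y < \<eta>1 \<longrightarrow> d (act a x) (act a y) < 1 / (2 * t)"
    using act_uniformly[OF gens(1,2), of "1 / (2 * t)"] t by auto
  define \<eta> where "\<eta> = min (1 / 2) (t * \<eta>1)"
  have \<eta>: "0 < \<eta>" "\<eta> \<le> 1 / 2" "\<eta> \<le> t * \<eta>1" using \<eta>1(1) t by (auto simp: \<eta>_def)
  have "\<delta> (last zs) z < \<theta> + \<eta>" using z(2) \<eta>(1) by simp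
  then obtain n m where c: "chain n m (last zs) z" "n + t * m < \<theta> + \<eta>" using \<delta>_chain[OF lM z(1)] by blast
  from c(1) show ?thesis
  proof (cases rule: chain.cases)
    case move
    have "0 + t * d (last zs) z < \<theta> + 1"
    proof -
      have "t * d (last zs) z \<le> t * m" using move t by simp
      then show ?thesis using move c(2) \<eta>(2) by simp
    qed
    from normalizes_last_curve[OF x normalizes_last[OF zs nf] zs sim_snoc_last(2)[OF zs] _ _ z this] lM theta_pos
    show ?thesis by simp
  next
    case (jump n0 m0 y s m')
    have M: "y \<in> M" using chain_props[OF jump(3)] by simp
    have m': "0 \<le> m'" using d_nonneg[of "act s y" z] jump M by simp
    have tot: "n0 + 1 + t * m0 + t * m' < \<theta> + \<eta>" using c(2) jump(1,2) by (simp add: algebra_simps)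
    have tm': "t * d (act s y) z \<le> t * m'" using jump t by simp
    have sM: "act s y \<in> M" using M jump by simp
    show ?thesis
    proof (cases "n0 + 1 + t * m0 < \<theta>")
      case True
      have ch: "chain (Suc n0) (m0 + 0) (last zs) (act s y)"
        by (rule chain.jump[OF jump(3,4) sM]) (use d_self[OF sM] in simp)
      have lt: "Suc n0 + t * (m0 + 0) < \<theta>" using True by simp
      have n: "normalizes x (zs @ [act s y])" "zs @ [act s y] \<in> paths"
        using normalizes_chain[OF x zs nf ch lt] by auto
      have "(n0 + 1 + t * m0) + t * d (act s y) z < \<theta> + 1" using tot tm' \<eta>(2) by simp
      moreover have "\<delta> (last zs) (act s y) \<le> n0 + 1 + t * m0" using \<delta>_chain_le[OF ch] by simp
      ultimately show ?thesis using normalizes_last_curve[OF x n(1) zs n(2) _ True z] by simp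
    next
      case False
      then have "t * m' < \<eta>" using tot by simp
      then have "t * m' < t * \<eta>1" using \<eta>(3) by simp
      then have "d (act s y) z < \<eta>1" using jump t by simp
      then have "d (act (inv s) (act s y)) (act (inv s) z) < 1 / (2 * t)"
        using \<eta>1(2) gens(3)[OF jump(4)] sM z(1) by blast
      then have dz: "d y (act (inv s) z) < 1 / (2 * t)" using M jump by simp
      have tm: "0 \<le> t * m'" using m' t by simp
      \<comment> \<open>The last jump accounts for 1 and \<eta> is at most 1/2, so at least 1/2 of
        the budget \<theta> is left for the move carried back.\<close>
      have cost: "n0 + t * m0 < \<theta> + \<eta> - 1" using tot tm by simp
      have n: "normalizes x (zs @ [y])" "zs @ [y] \<in> paths"
        using normalizes_chain[OF x zs nf jump(3)] cost \<eta>(2) by auto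
      have "\<delta> (last zs) y \<le> n0 + t * m0" by (rule \<delta>_chain_le[OF jump(3)])
      moreover have "n0 + t * m0 + t * d y (act (inv s) z) < \<theta>"
      proof -
        have "t * d y (act (inv s) z) < t * (1 / (2 * t))" using dz t by (intro mult_strict_left_mono)
        then show ?thesis using cost \<eta>(2) t by simp
      qed
      ultimately have n': "normalizes x (zs @ [act (inv s) z])" "zs @ [act (inv s) z] \<in> paths"
        using normalizes_d_curve[OF x n(1) zs n(2)] z(1) jump(4) gens(3) by simp_all
      have e: "act (inv (inv s)) (act (inv s) z) = z" using z(1) jump(4) by simp
      from normalizes_jump(1)[OF x n'(1) gens(3)[OF jump(4)] zs n'(2), unfolded e, OF z(2)]
      show ?thesis .
    qed
  qed
qed

lemma normalizes_path:
  assumes "zs \<in> paths"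
  shows "normalizes (hd zs) zs"
  using assms
proof (induction zs rule: rev_induct)
  case (snoc z zs)
  show ?case
  proof (cases "zs = []")
    case True
    then show ?thesis using normalizes_single snoc.prems by (simp add: paths_iff)
  next
    case False
    then have zs: "zs \<in> paths" "z \<in> M" "adj (last zs) z" "hd zs \<in> M"
      using snoc.prems by (auto simp: paths_iff successively_append_iff)
    from normalizes_snoc[OF zs(4) snoc.IH[OF zs(1)] zs(1,2,3)] False show ?thesis by simp
  qed
qed (simp add: paths_iff)

section \<open>Kernel and image of the holonomy\<close>

text \<open>Finely sampled curves have trivial holonomy, so all of it sits in the word of the normal
  form. If it is trivial, the orbit path returns to \<open>x\<close>, which makes the remaining
  curve a loop.\<close>

lemma holonomy_kernel:
  assumes "zs \<in> theta_loops \<theta> M \<delta> x" "holonomy zs = \<one>"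
  shows "sim zs [x]"
proof -
  have zs: "zs \<in> paths" "hd zs = x" "last zs = x" using assms(1) by (auto simp: theta_loops_def)
  then have x: "x \<in> M" by (auto simp: paths_iff)
  have "normalizes x zs" using normalizes_path[OF zs(1)] zs(2) by simp
  then obtain w p where wp: "w \<in> lists gens" "path p" "path_image p \<subseteq> M" "pathstart p = last (orbit_path x w)"
    "pathfinish p = x" "\<forall>\<^sub>F N in sequentially. sim (orbit_path x w @ samples N p) zs"
    unfolding normalizes_def zs(3) by (elim exE conjE)
  let ?o = "orbit_path x w"
  have o: "?o \<in> paths" by (rule orbit_path_paths[OF x wp(1)])
  then have lo: "last ?o \<in> M" by (auto simp: paths_iff)
  have "\<forall>\<^sub>F N in sequentially. sim (?o @ samples N p) zs \<and> fine_path N p"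
    using wp(6) fine_path_eventually[OF wp(2,3)] by (rule eventually_conj)
  then obtain N0 where N0: "sim (?o @ samples N0 p) zs" "fine_path N0 p"
    unfolding eventually_sequentially by blast
  have "\<one> = holonomy (?o @ samples N0 p)"
    using holonomy_sim[OF N0(1) normal_paths[OF x wp(1,4) N0(2)]] assms(2) by simp
  also have "\<dots> = lprod w"
    using holonomy_append[of ?o "samples N0 p"] orbit_path_holonomy[OF x wp(1)] fine_path_holonomy[OF N0(2)]
      wp(4) lo gens_lists[OF wp(1)] by (simp add: pathstart_def)
  finally have w1: "lprod w = \<one>" by simp
  then have lox: "last ?o = x" using orbit_path_last[OF x wp(1)] x by simp
  \<comment> \<open>A second level is chosen, because \<open>p\<close> is known to be a loop only
    after the holonomy at level \<open>N0\<close> has been computed.\<close>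
  have "\<forall>\<^sub>F N in sequentially. (sim (?o @ samples N p) zs \<and> fine_path N p) \<and> sim (samples N p) [x]"
    by (intro eventually_conj wp(6) fine_path_eventually loop_contract wp(2,3,5)) (simp add: wp(4) lox)
  then obtain N where N: "sim (?o @ samples N p) zs" "fine_path N p" "sim (samples N p) [x]"
    unfolding eventually_sequentially by blast
  have P: "samples N p \<in> paths" "?o @ samples N p \<in> paths"
    using fine_path_paths[OF N(2)] normal_paths[OF x wp(1,4) N(2)] by auto
  have "sim zs (?o @ samples N p)" by (rule sim_sym[OF N(1)])
  also have "sim (?o @ samples N p) (?o @ [x])" by (rule sim_context_left[OF N(3) P])
  also have "sim (?o @ [x]) ?o" using sim_snoc_last(1)[OF o] unfolding lox .
  also have "sim ?o [x]" by (rule orbit_path_contract[OF x wp(1) w1])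
  finally show ?thesis .
qed

lemma curve_exists:
  assumes "x \<in> M" "y \<in> M"
  shows "\<exists>p. path p \<and> path_image p \<subseteq> M \<and> pathstart p = x \<and> pathfinish p = y"
proof -
  have "d x y < d x y + 1" by simp
  from d_curve[OF assms this] show ?thesis by (elim exE conjE) (intro exI conjI)
qed

lemma holonomy_surj:
  assumes x: "x \<in> M" and a: "a \<in> carrier G"
  shows "\<exists>zs\<in>theta_loops \<theta> M \<delta> x. holonomy zs = a"
proof -
  obtain w where w: "w \<in> lists gens" "lprod w = a" using gens_lprod[OF a] by blast
  let ?o = "orbit_path x w"
  have o: "?o \<in> paths" by (rule orbit_path_paths[OF x w(1)])
  then have lo: "last ?o \<in> M" by (auto simp: paths_iff)
  obtain p where p: "path p" "path_image p \<subseteq> M" "pathstart p = last ?o" "pathfinish p = x"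
    using curve_exists[OF lo x] by (elim exE conjE)
  obtain N where N: "fine_path N p"
    using fine_path_eventually[OF p(1,2)] unfolding eventually_sequentially by blast
  have "?o @ samples N p \<in> theta_loops \<theta> M \<delta> x"
    using normal_paths[OF x w(1) p(3) N] p(4) by (simp add: theta_loops_def pathfinish_def)
  moreover have "holonomy (?o @ samples N p) = a"
    using holonomy_append[of ?o "samples N p"] orbit_path_holonomy[OF x w(1)] fine_path_holonomy[OF N]
      p(3) lo a w(2) by (simp add: pathstart_def)
  ultimately show ?thesis by blast
qed

lemma discrete_pi1_level_set: "x \<in> M \<Longrightarrow> discrete_pi1 \<theta> M \<delta> x \<cong> G"
  by (rule discrete_pi1_iso[OF _ holonomy_surj holonomy_kernel])

end

section \<open>The connection on a level set for large \<open>t\<close>\<close>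

context free_action
begin

text \<open>For large \<open>t\<close>, points at warped distance at most \<open>\<theta>\<close> differ by a unique short group element up
  to a small \<open>d\<close>-error \<open>\<eta>\<close>; uniqueness on squares makes this a flat connection.\<close>

lemma discrete_pi1_warped:
  assumes pres: "\<And>w. w \<in> lists gens \<Longrightarrow> lprod w = \<one> \<Longrightarrow> equivclp (deletion gens K) w []"
    and sc: "trivial_fundamental_group M"
    and \<theta>: "2 \<le> \<theta>" "real K \<le> \<theta>"
  shows "\<exists>t0\<ge>1. \<forall>t\<ge>t0. \<forall>x\<in>M. discrete_pi1 \<theta> M (warped_metric M d S act t) x \<cong> G"
proof -
  \<comment> \<open>Bounds the number of jumps in a chain of cost below \<open>\<theta> + 1\<close>,
    where the 1 is slack for the infimum.\<close>
  define n where "n = nat \<lceil>\<theta>\<rceil> + 1"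
  have n: "\<theta> + 1 \<le> real n" unfolding n_def by linarith
  \<comment> \<open>Flatness compares products of two short elements, hence the radius
    \<open>n + n\<close>.\<close>
  from displacement[OF finite_gball[of "n + n"] gball_carrier] obtain \<epsilon> where \<epsilon>: "0 < \<epsilon>" "\<forall>a\<in>gball (n + n). \<forall>b\<in>gball (n + n). \<forall>x\<in>M. a \<noteq> b \<longrightarrow> \<epsilon> \<le> d (act a x) (act b x)"
    by (elim exE conjE)
  have "0 < \<epsilon> / 4" using \<epsilon>(1) by simp
  from act_uniformly[OF finite_gball[of n] gball_carrier this] obtain \<kappa>1 where \<kappa>1: "0 < \<kappa>1" "\<forall>a\<in>gball n. \<forall>x\<in>M. \<forall>y\<in>M. d x y < \<kappa>1 \<longrightarrow> d (act a x) (act a y) < \<epsilon> / 4"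
    by (elim exE conjE)
  \<comment> \<open>Each route around a square contributes two errors of at most
    \<open>\<epsilon> / 4\<close>. Two different products would then move \<open>x\<close> to points
    at distance less than \<epsilon>, against the displacement bound.\<close>
  define \<eta> where "\<eta> = min \<kappa>1 (\<epsilon> / 4)"
  have \<eta>: "0 < \<eta>" "\<eta> \<le> \<kappa>1" "\<eta> \<le> \<epsilon> / 4" using \<kappa>1(1) \<epsilon>(1) by (auto simp: \<eta>_def)
  from chain_near[OF \<eta>(1), of n] obtain \<kappa> where \<kappa>: "0 < \<kappa>" "\<forall>n' m x y. chain n' m x y \<longrightarrow> n' \<le> n \<longrightarrow> m < \<kappa> \<longrightarrow> (\<exists>a\<in>gball n. d (act a x) y < \<eta>)"
    by (elim exE conjE)
  define near where "near a x y \<longleftrightarrow> a \<in> gball n \<and> d (act a x) y < \<eta>" for a x y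
  have near_carrier: "a \<in> carrier G" if "near a x y" for a x y
    using that gball_carrier by (auto simp: near_def)
  have two_steps: "d (act (b \<otimes> a) x) w < \<epsilon> / 2 \<and> b \<otimes> a \<in> gball (n + n)"
    if M: "x \<in> M" "y \<in> M" "w \<in> M" and ab: "near a x y" "near b y w" for a b x y w
  proof -
    note c = near_carrier[OF ab(1)] near_carrier[OF ab(2)]
    have "d (act b (act a x)) (act b y) < \<epsilon> / 4"
      using \<kappa>1(2) ab M c \<eta>(2) by (simp add: near_def)
    moreover have "d (act b y) w < \<epsilon> / 4" using ab(2) \<eta>(3) by (simp add: near_def)
    moreover have "d (act b (act a x)) w \<le> d (act b (act a x)) (act b y) + d (act b y) w"
      using M c by (intro d_triangle) auto
    ultimately have "d (act (b \<otimes> a) x) w < \<epsilon> / 2" using M c by (simp add: act_mult)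
    then show ?thesis using ab gball_mult by (auto simp: near_def)
  qed
  have square: "b \<otimes> a = e \<otimes> c"
    if M: "x \<in> M" "y \<in> M" "z \<in> M" "w \<in> M" and nr: "near a x y" "near b y w" "near c x z" "near e z w"
    for a b c e x y z w
  proof (rule ccontr)
    assume ne: "b \<otimes> a \<noteq> e \<otimes> c"
    note 1 = two_steps[OF M(1,2,4) nr(1,2)] and 2 = two_steps[OF M(1,3,4) nr(3,4)]
    have cc: "b \<otimes> a \<in> carrier G" "e \<otimes> c \<in> carrier G" using nr near_carrier by blast+
    have "\<epsilon> \<le> d (act (b \<otimes> a) x) (act (e \<otimes> c) x)" using \<epsilon>(2) 1 2 ne M(1) by blast
    also have "\<dots> \<le> d (act (b \<otimes> a) x) w + d w (act (e \<otimes> c) x)" using M cc by (intro d_triangle) auto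
    also have "\<dots> < \<epsilon>" using 1 2 d_sym[of w] by simp
    finally show False by simp
  qed
  have near_one: "near \<one> x y" if "x \<in> M" "y \<in> M" "d x y < \<eta>" for x y
    using that gball_one by (simp add: near_def)
  have near_refl: "near \<one> x x" if "x \<in> M" for x using near_one[OF that that] d_self[OF that] \<eta>(1) by simp
  \<comment> \<open>Two candidates for one pair are compared in the degenerate square with corners
    \<open>x\<close>, \<open>y\<close>, \<open>y\<close>, \<open>y\<close>.\<close>
  have unique: "a = b" if "x \<in> M" "y \<in> M" "near a x y" "near b x y" for a b x y
    using square[of x y y y a \<one> b \<one>] that near_refl near_carrier by simp
  have near_jump: "near (inv s) x (act (inv s) x)" if "x \<in> M" "s \<in> gens" for x s
    using that gens_gball[of "inv s" "n - 1"] gens(3) d_self \<eta>(1) by (simp add: near_def n_def)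
  \<comment> \<open>The default keeps \<open>k\<close> in the group for pairs that no short element
    relates.\<close>
  define k where "k x y = (if \<exists>a. near a x y then inv (SOME a. near a x y) else \<one>)" for x y
  have k: "k x y = inv a" if "x \<in> M" "y \<in> M" "near a x y" for a x y
  proof -
    have "near (SOME a. near a x y) x y" using that(3) by (rule someI)
    then have "(SOME a. near a x y) = a" using unique that by blast
    then show ?thesis using that(3) by (auto simp: k_def)
  qed
  have k_closed: "k x y \<in> carrier G" for x y
  proof (cases "\<exists>a. near a x y")
    case True
    then have "near (SOME a. near a x y) x y" by (rule someI_ex)
    then show ?thesis using True near_carrier by (simp add: k_def)
  qed (simp add: k_def)
  \<comment> \<open>For such \<open>t\<close> a chain of cost below \<open>\<theta> + 1\<close> has
    drift below \<kappa>, since \<open>t * m < \<theta> + 1 \<le> t * \<kappa>\<close>.\<close>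
  define t0 where "t0 = max 1 ((\<theta> + 1) / \<kappa> + 1)"
  have "discrete_pi1 \<theta> M (warped_metric M d S act t) x \<cong> G" if t0: "t0 \<le> t" and x: "x \<in> M" for t x
  proof -
    have t: "0 < t" "(\<theta> + 1) / \<kappa> < t" using t0 by (auto simp: t0_def)
    define \<delta> where "\<delta> = warped_metric M d S act t"
    have adm: "warped_admissible M d S act t \<delta>" unfolding \<delta>_def by (rule warped_metric_props(1)[OF t(1)])
    have ch: "\<exists>n m. chain n m x y \<and> n + t * m < c" if "x \<in> M" "y \<in> M" "\<delta> x y < c" for x y c
      using warped_metric_props(2)[OF t(1) that(1,2)] that(3) by (simp add: \<delta>_def)
    interpret \<delta>: Metric_space M \<delta> using adm by (simp add: warped_admissible_def)
    have ex: "\<exists>a. near a x y" if xy: "x \<in> M" "y \<in> M" "\<delta> x y \<le> \<theta>" for x y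
    proof -
      obtain n' m where c: "chain n' m x y" "n' + t * m < \<theta> + 1" using ch[OF xy(1,2), of "\<theta> + 1"] xy(3) by auto
      have m: "0 \<le> t * m" using chain_props[OF c(1)] t(1) by simp
      then have "real n' \<le> real n" using c(2) n by simp
      moreover have "t * m < t * \<kappa>"
      proof -
        have "t * m < \<theta> + 1" using c(2) by simp
        also have "\<dots> \<le> t * \<kappa>" using t(2) \<kappa>(1) by (simp add: field_simps)
        finally show ?thesis .
      qed
      then have "m < \<kappa>" using t(1) by simp
      ultimately show ?thesis
        using \<kappa>(2)[rule_format, OF c(1)] unfolding near_def by (simp add: Bex_def)
    qed
    \<comment> \<open>In the scale \<open>min (1 / t) \<eta>\<close>, the bound \<open>1 / t\<close>
      gives \<delta> at most 1, and \<eta> makes \<open>\<one>\<close> the element relating the two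
      points.\<close>
    interpret level_set M d G S act \<delta> \<theta> k t "min (1 / t) \<eta>" K
    proof unfold_locales
      show "k x y \<in> carrier G" for x y by (rule k_closed)
      show "k x x = \<one>" if "x \<in> M" for x using k[OF that that near_refl[OF that]] by simp
      show "k x y \<otimes> k y w = k x z \<otimes> k z w"
        if M: "x \<in> M" "y \<in> M" "z \<in> M" "w \<in> M" and adj: "\<delta> x y \<le> \<theta>" "\<delta> y w \<le> \<theta>" "\<delta> x z \<le> \<theta>" "\<delta> z w \<le> \<theta>"
        for x y z w
      proof -
        obtain a b c e where nr: "near a x y" "near b y w" "near c x z" "near e z w"
          using ex M adj by meson
        have "inv a \<otimes> inv b = inv c \<otimes> inv e"
          using square[OF M nr] nr[THEN near_carrier] by (simp add: inv_mult_group[symmetric])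
        then show ?thesis using k M nr by simp
      qed
      show "\<delta> x y \<le> t * d x y" if "x \<in> M" "y \<in> M" for x y using adm that by (simp add: warped_admissible_def)
      show "\<delta> x y \<le> 1 \<and> k x y = \<one>" if xy: "x \<in> M" "y \<in> M" "d x y < min (1 / t) \<eta>" for x y
      proof
        have "t * d x y \<le> 1" using xy(3) t(1) by (simp add: field_simps)
        moreover have "\<delta> x y \<le> t * d x y" using adm xy by (simp add: warped_admissible_def)
        ultimately show "\<delta> x y \<le> 1" by simp
        show "k x y = \<one>" using k[OF xy(1,2) near_one[OF xy(1,2)]] xy(3) by simp
      qed
      show "k x (act (inv s) x) = s" if "x \<in> M" "s \<in> gens" for x s
        using k[OF that(1) _ near_jump[OF that]] that by simp
      show "\<delta> x y \<le> n + t * m" if "chain n m x y" for n m x y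
        by (rule admissible_chain[OF t(1) adm that])
    qed (use t(1) \<eta>(1) \<theta> ch pres sc in auto)
    show ?thesis using discrete_pi1_level_set[OF x] by (simp add: \<delta>_def)
  qed
  then show ?thesis by (intro exI[of _ t0]) (simp add: t0_def)
qed

end

theorem corollary1p4:
  fixes M :: "'m::t2_space set"
    and A :: "('m, 'e::{real_inner, heine_borel}) chart set"
    and g :: "('m, 'e) metric_tensor"
    and \<Gamma> :: "('g, 'b) monoid_scheme"
    and S :: "'g set"
    and act :: "'g \<Rightarrow> 'm \<Rightarrow> 'm"
  assumes "riemannian_manifold M A g"
    and "compact M" and "connected M" and "M \<noteq> {}"
    and "trivial_fundamental_group M"
    and "finitely_presented \<Gamma>"
    and "finite S" and "S \<subseteq> carrier \<Gamma>" and "generate \<Gamma> S = carrier \<Gamma>"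
    and "acts_freely_by_homeomorphisms \<Gamma> M act"
  shows "\<exists>\<theta>\<^sub>0>0. \<forall>\<theta>\<ge>\<theta>\<^sub>0. \<exists>t\<^sub>0\<ge>1. \<forall>t\<ge>t\<^sub>0. \<forall>x\<in>M.
           discrete_pi1 \<theta> M (warped_metric M (riemannian_dist M A g) S act t) x \<cong> \<Gamma>"
proof -
  interpret connected_riemannian M A g
    by unfold_locales (rule assms)+
  interpret group \<Gamma> using assms(6) by (simp add: finitely_presented_def)
  interpret free_action M "riemannian_dist M A g" \<Gamma> S act
    by unfold_locales
      (use assms rdist_sym rdist_self rdist_pos rdist_triangle rdist_continuous rdist_curve in auto)
  obtain K where K: "\<forall>w\<in>lists gens. lprod w = \<one>\<^bsub>\<Gamma>\<^esub> \<longrightarrow> equivclp (deletion gens K) w []"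
    using bounded_relations[OF assms(6) gens(1,2) gens(3) gens_lprod] by blast
  \<comment> \<open>The 2 is the cost of a jump plus a sampling step; \<open>K\<close> is the length
    up to which words of product one must collapse at once.\<close>
  show ?thesis
    using discrete_pi1_warped[of K] K assms(5) by (intro exI[of _ "max 2 (real K)"]) simp
qed

end
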